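(* Let $F$ be a distribution function on $\mathbb{R}$ with mean $0$ and variance $1$, and for each $n$ and each dimension $p=p_n\in\mathbb{N}$ let $X_{ij}$ ($1\le i\le n$, $1\le j\le p$) be iid with distribution function $F$, with $X_i=(X_{i1},\dots,X_{ip})$. Let $h:[0,\infty)\to[0,\infty)$ be a function with a monotonically decreasing continuous derivative such that, for some constant $\alpha<1/2$ and some positive function $\varrho(\cdot)$ increasing to $\infty$ (as slowly as one wishes), $$0<h'(x)<\frac{\alpha h(x)}{x}\quad\text{and}\quad h(x)>\varrho(x)\log x\qquad\text{for all }x>1.$$ Let $\Lambda_n$ be the (positive) solution of the equation $h\big(n^{1/2}\Lambda_n\big)=\Lambda_n^2$. Then: (Sufficiency) If $E e^{h(|X_{11}|)}<\infty$, then $\rho^{|X|}_{n,\mathcal{A}^{re}}\to 0$ as $n\to\infty$ whenever $\log p\le \Lambda_n^2/2$ (i.e. for every sequence $p=p_n$ of positive integers satisfying this inequality). (Necessity) If $\rho^{|X|}_{n,\mathcal{A}^{max}}\to 0$ as $n\to\infty$ whenever $\log p\le \sqrt{2}\,\Lambda_n^2$ (i.e. for every sequence $p=p_n$ of positive integers satisfying this inequality), then $E e^{h(|X_{11}|)}<\infty$.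
   Context: The dimension $p=p_n$ may depend on $n$; the distribution $F$ of $X_{11}$ does not depend on $n$. Put $T_n=n^{-1/2}\sum_{i=1}^n X_i\in\mathbb{R}^p$ and let $Z$ be a standard Gaussian random vector in $\mathbb{R}^p$. For a collection $\mathcal{A}$ of Borel subsets of $\mathbb{R}^p$, $$\rho^{X}_{n,\mathcal{A}}=\sup_{A\in\mathcal{A}}\big|P(T_n\in A)-P(Z\in A)\big|,$$ and $\rho^{-X}_{n,\mathcal{A}}$ is the same quantity with each $X_i$ replaced by $-X_i$. The notation "$\rho^{|X|}_{n,\mathcal{A}}\to 0$" means that both $\rho^{X}_{n,\mathcal{A}}\to0$ and $\rho^{-X}_{n,\mathcal{A}}\to 0$ as $n\to\infty$. Collections of sets: $\mathcal{A}^{max}=\{(-\infty,t]\times\cdots\times(-\infty,t]: t\in\mathbb{R}\}$ (left-infinite squares in $\mathbb{R}^p$) and $\mathcal{A}^{re}=\{\prod_{j=1}^p ([a_j,b_j]\cap\mathbb{R}): -\infty\le a_j\le b_j\le\infty,\ j=1,\dots,p\}$ (hyper-rectangles in $\mathbb{R}^p$). *)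

theory Defs
  imports "HOL-Probability.Probability"
begin

text \<open>
  A vector in \<open>\<real>\<^sup>p\<close> is an extensional function on \<open>{1..p}\<close>, so that the dimension can vary
  with the sample size.
\<close>

definition iid_array ::
  "'a measure \<Rightarrow> nat \<Rightarrow> nat \<Rightarrow> (nat \<Rightarrow> nat \<Rightarrow> 'a \<Rightarrow> real) \<Rightarrow> real measure \<Rightarrow> bool"
where
  "iid_array M n p X F \<longleftrightarrow>
     prob_space M \<and>
     prob_space.indep_vars M (\<lambda>_. borel) (\<lambda>(i, j). X i j) ({1..n} \<times> {1..p}) \<and>
     (\<forall>i\<in>{1..n}. \<forall>j\<in>{1..p}. distr M borel (X i j) = F)"

definition normalized_sum ::
  "nat \<Rightarrow> nat \<Rightarrow> (nat \<Rightarrow> nat \<Rightarrow> 'a \<Rightarrow> real) \<Rightarrow> 'a \<Rightarrow> nat \<Rightarrow> real"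
where
  "normalized_sum n p X \<omega> = (\<lambda>j\<in>{1..p}. (\<Sum>i=1..n. X i j \<omega>) / sqrt (real n))"

definition std_gaussian :: "nat \<Rightarrow> (nat \<Rightarrow> real) measure"
where
  "std_gaussian p = (\<Pi>\<^sub>M j\<in>{1..p}. density lborel (\<lambda>x. ennreal (std_normal_density x)))"

definition gauss_approx_error ::
  "'a measure \<Rightarrow> nat \<Rightarrow> nat \<Rightarrow> (nat \<Rightarrow> nat \<Rightarrow> 'a \<Rightarrow> real) \<Rightarrow> (nat \<Rightarrow> real) set set \<Rightarrow> real"
where
  "gauss_approx_error M n p X \<A> =
     (SUP A\<in>\<A>. \<bar>measure M {\<omega> \<in> space M. normalized_sum n p X \<omega> \<in> A}
                - measure (std_gaussian p) A\<bar>)"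

definition left_infinite_squares :: "nat \<Rightarrow> (nat \<Rightarrow> real) set set"
where
  "left_infinite_squares p = {(\<Pi>\<^sub>E j\<in>{1..p}. {..t}) | t :: real. True}"

text \<open>
  The bounds of a hyper-rectangle may be infinite; the intersection of \<open>[a j, b j]\<close> with \<open>\<real>\<close>
  is the preimage of the extended-real interval under \<open>ereal\<close>.
\<close>

definition hyper_rectangles :: "nat \<Rightarrow> (nat \<Rightarrow> real) set set"
where
  "hyper_rectangles p =
     {(\<Pi>\<^sub>E j\<in>{1..p}. ereal -` {a j..b j}) | a b :: nat \<Rightarrow> ereal. \<forall>j\<in>{1..p}. a j \<le> b j}"

text \<open>
  Here \<open>M n p\<close> and \<open>X n p\<close> are the probability space and the array used for sample size \<open>n\<close> and
  dimension \<open>p\<close>, and \<open>\<A> p\<close> is a collection of subsets of \<open>\<real>\<^sup>p\<close>. The error must vanish both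
  for the array and for its negative.
\<close>

definition two_sided_gauss_approx ::
  "(nat \<Rightarrow> nat \<Rightarrow> 'a measure) \<Rightarrow> (nat \<Rightarrow> nat \<Rightarrow> nat \<Rightarrow> nat \<Rightarrow> 'a \<Rightarrow> real) \<Rightarrow>
   (nat \<Rightarrow> (nat \<Rightarrow> real) set set) \<Rightarrow> (nat \<Rightarrow> nat) \<Rightarrow> bool"
where
  "two_sided_gauss_approx M X \<A> p \<longleftrightarrow>
     (\<lambda>n. gauss_approx_error (M n (p n)) n (p n) (X n (p n)) (\<A> (p n))) \<longlonglongrightarrow> 0 \<and>
     (\<lambda>n. gauss_approx_error (M n (p n)) n (p n) (\<lambda>i j \<omega>. - X n (p n) i j \<omega>) (\<A> (p n)))
       \<longlonglongrightarrow> 0"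

end

theory Submission
  imports Defs "HOL-Real_Asymp.Real_Asymp"
begin

text \<open>
  The coordinates of the normalized sum are independent and have the same law, here called
  \<open>sum_law\<close>, so the probability of a rectangle is a product of \<open>p\<close> one-dimensional probabilities,
  for the sum as for the Gaussian vector. The theorem is therefore a statement about the tails of a
  single normalized sum \<open>S\<close> of \<open>n\<close> independent variables with distribution \<open>F\<close>. Throughout,
  \<open>xn n = sqrt n * \<Lambda> n\<close>, so that \<open>h (xn n) = (\<Lambda> n)\<^sup>2\<close>.

  For sufficiency the main point is Linnik's moderate deviation statement
  \<open>sum_law_tail_uniform\<close>: under the exponential moment condition, \<open>P (S > x)\<close> is asymptotically equal
  to the Gaussian tail, uniformly for \<open>0 \<le> x \<le> \<Lambda> n\<close>. To prove it, the summands are truncated at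
  \<open>xn n / 4\<close>. As \<open>h x / x powr \<alpha>\<close> decreases, \<open>h (xn n / 4) \<ge> 4 powr (- \<alpha>) * (\<Lambda> n)\<^sup>2\<close>, where
  \<open>4 powr (- \<alpha>) > 1 / 2\<close> because \<open>\<alpha> < 1 / 2\<close>; hence the probability that some summand exceeds the
  truncation level is negligible compared with the Gaussian tail at \<open>\<Lambda> n\<close>. The truncated distribution
  has a Laplace transform \<open>m\<close> with \<open>m z = exp (z\<^sup>2 / 2) + O (\<bar>z\<bar>\<^sup>3)\<close>, up to a remainder of size
  \<open>n powr (- 3 / 2)\<close>, in the range needed. Taking \<open>z = (\<theta> + \<i> * t) / sqrt n\<close> with \<open>\<theta> = x + 1\<close> and
  the \<open>n\<close>-th power, the transform of the truncated sum on the line \<open>Re z = \<theta>\<close> agrees with that of the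
  Gaussian law up to a relative error of order \<open>\<theta> ^ 3 / sqrt n\<close>, which tends to zero as
  \<open>\<Lambda> n = o (n powr (1 / 6))\<close>. A Gaussian smoothing on the scale \<open>n powr (- 1 / 4)\<close> converts this into
  a comparison of tails (\<open>smooth_tail_comparison\<close>, \<open>trunc_sum_law_tail_bounds\<close>). The exponential
  tilt by \<open>\<theta>\<close> is built into the transforms; no tilted measure is introduced.

  If \<open>ln p \<le> (\<Lambda> n)\<^sup>2 / 2\<close>, then \<open>p\<close> times the Gaussian tail at \<open>\<Lambda> n\<close> tends to zero, so the complements
  of all intervals have probabilities that agree up to a small relative error and an absolute error
  \<open>o (1 / p)\<close>. Products of \<open>p\<close> such probabilities are close (\<open>prod_one_minus_diff_le\<close>).

  For necessity, take \<open>t\<close> with \<open>t\<^sup>2 / 2 = sqrt 2 * (\<Lambda> n)\<^sup>2\<close> and \<open>p\<close> close to \<open>exp (t\<^sup>2 / 2)\<close>. The Gaussian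
  probability of the square with corner \<open>t\<close> tends to one, so the approximation forces
  \<open>P (S > t) \<le> 1 / p\<close>. One large summand together with a typical remainder makes \<open>S\<close> large, whence
  \<open>F {sqrt n * (t + 2)<..} \<le> 4 / 3 * P (S > t)\<close> (\<open>single_jump\<close>). As \<open>t + 2 \<le> 2 * \<Lambda> n\<close> eventually, this
  bounds the tail of \<open>F\<close> at \<open>2 * xn n\<close> by a multiple of \<open>exp (- sqrt 2 * h (xn n))\<close>. Since
  \<open>h (2 * x) \<le> 2 powr \<alpha> * h x\<close> and \<open>2 powr \<alpha> < sqrt 2\<close>, the tail at \<open>y\<close> is at most a multiple of
  \<open>exp (- (1 + \<eta>) * h y)\<close> for some \<open>\<eta> > 0\<close>, and the exponential moment is finite because \<open>h\<close> grows
  faster than the logarithm.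
\<close>

section \<open>The growth function and its scale\<close>

text \<open>
  The growth conditions on \<open>h\<close> and the defining equation of \<open>\<Lambda>\<close>. The lower bound for \<open>h\<close> is only
  needed in the form that \<open>h\<close> dominates every multiple of the logarithm.
\<close>

locale linnik_growth =
  fixes h h' :: "real \<Rightarrow> real" and \<alpha> :: real and \<Lambda> :: "nat \<Rightarrow> real"
  assumes h_nonneg: "\<And>x. x \<ge> 0 \<Longrightarrow> h x \<ge> 0"
    and h_deriv: "\<And>x. x > 0 \<Longrightarrow> (h has_real_derivative h' x) (at x)"
    and h'_decreasing: "antimono_on {0<..} h'"
    and \<alpha>: "\<alpha> < 1 / 2"
    and h'_bounds: "\<And>x. x > 1 \<Longrightarrow> 0 < h' x \<and> h' x < \<alpha> * h x / x"
    and h_over_ln: "filterlim (\<lambda>x. h x / ln x) at_top at_top"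
    and \<Lambda>: "\<And>n. n \<ge> 1 \<Longrightarrow> \<Lambda> n > 0 \<and> h (sqrt (real n) * \<Lambda> n) = (\<Lambda> n)\<^sup>2"
begin

lemma h'_mono: "0 < x \<Longrightarrow> x \<le> y \<Longrightarrow> h' y \<le> h' x"
  using h'_decreasing by (auto simp: monotone_on_def)

lemma h'_pos: assumes "0 < x" shows "0 < h' x"
proof -
  have "0 < h' (max x 2)" using h'_bounds[of "max x 2"] by auto
  also have "\<dots> \<le> h' x" using assms by (intro h'_mono) auto
  finally show ?thesis .
qed

lemma h_strict_mono: assumes "0 < x" "x < y" shows "h x < h y"
proof (rule DERIV_pos_imp_increasing[OF assms(2)])
  fix z assume "x \<le> z" "z \<le> y"
  then show "\<exists>d. (h has_real_derivative d) (at z) \<and> 0 < d"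
    using assms h_deriv[of z] h'_pos[of z] by auto
qed

lemma h_mono: "0 < x \<Longrightarrow> x \<le> y \<Longrightarrow> h x \<le> h y"
  using h_strict_mono[of x y] by (cases "x = y") auto

lemma h_pos: "0 < x \<Longrightarrow> 0 < h x"
  using h_strict_mono[of "x/2" x] h_nonneg[of "x/2"] by auto

text \<open>
  Concavity and \<open>h \<ge> 0\<close>: the graph lies above the chord to the origin. The value \<open>h 0\<close> plays no role,
  because \<open>h\<close> need not be continuous there.
\<close>

lemma h'_le: assumes "0 < x" shows "x * h' x \<le> h x"
proof (rule field_le_epsilon)
  fix e :: real assume "e > 0"
  define y where "y = min (x/2) (e / h' x)"
  have p: "h' x > 0" using h'_pos assms by auto
  have y: "0 < y" "y < x" "y * h' x \<le> e"
    using assms \<open>e > 0\<close> p by (auto simp: y_def min_def field_simps)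
  have "\<exists>z>y. z < x \<and> h x - h y = (x - y) * h' z"
    by (rule MVT2[OF y(2)]) (use y h_deriv in auto)
  then obtain z where z: "y < z" "z < x" "h x - h y = (x - y) * h' z" by auto
  have "(x - y) * h' x \<le> (x - y) * h' z"
    using y z by (intro mult_left_mono h'_mono) auto
  also have "\<dots> \<le> h x" using z h_nonneg[of y] y by auto
  finally show "x * h' x \<le> h x + e" using y by (simp add: algebra_simps)
qed

lemma h_over_id_mono: assumes "0 < y" "y \<le> x" shows "h x / x \<le> h y / y"
proof (rule DERIV_nonpos_imp_nonincreasing[OF assms(2)])
  fix z assume z: "y \<le> z" "z \<le> x"
  then have "z > 0" using assms by auto
  then have "((\<lambda>x. h x / x) has_real_derivative (h' z * z - h z) / (z * z)) (at z)"
    by (auto intro!: derivative_eq_intros h_deriv)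
  moreover have "(h' z * z - h z) / (z * z) \<le> 0"
    using h'_le[OF \<open>z > 0\<close>] by (auto intro!: divide_nonpos_nonneg simp: mult.commute)
  ultimately show "\<exists>d. ((\<lambda>x. h x / x) has_real_derivative d) (at z) \<and> d \<le> 0" by blast
qed

lemma h_le_powr: assumes "1 < y" "y \<le> x" shows "h x \<le> (x / y) powr \<alpha> * h y"
proof -
  have "h x * x powr (-\<alpha>) \<le> h y * y powr (-\<alpha>)"
  proof (rule DERIV_nonpos_imp_nonincreasing[OF assms(2)])
    fix z assume z: "y \<le> z" "z \<le> x"
    then have "z > 1" using assms by auto
    then have "((\<lambda>x. h x * x powr (-\<alpha>)) has_real_derivative
        h' z * z powr (-\<alpha>) + h z * (-\<alpha> * z powr (-\<alpha> - 1))) (at z)"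
      by (auto intro!: derivative_eq_intros h_deriv)
    moreover have "h' z * z powr (-\<alpha>) + h z * (-\<alpha> * z powr (-\<alpha> - 1))
        = z powr (-\<alpha>) * (h' z - \<alpha> * h z / z)"
      using \<open>z > 1\<close> by (simp add: powr_diff field_simps)
    moreover have "\<dots> \<le> 0"
      using h'_bounds[OF \<open>z > 1\<close>] by (intro mult_nonneg_nonpos) auto
    ultimately show "\<exists>d. ((\<lambda>x. h x * x powr (-\<alpha>)) has_real_derivative d) (at z) \<and> d \<le> 0"
      by metis
  qed
  then show ?thesis using assms by (simp add: powr_divide powr_minus field_simps)
qed

text \<open>
  The jump size that corresponds to a deviation \<open>\<Lambda> n\<close> of the normalized sum.
\<close>

definition "xn n = sqrt (real n) * \<Lambda> n"

lemma \<Lambda>_pos: "n \<ge> 1 \<Longrightarrow> 0 < \<Lambda> n" using \<Lambda> by blast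

lemma xn_pos: "n \<ge> 1 \<Longrightarrow> 0 < xn n" using \<Lambda>_pos[of n] by (simp add: xn_def)

lemma h_xn: "n \<ge> 1 \<Longrightarrow> h (xn n) = (\<Lambda> n)\<^sup>2" using \<Lambda>[of n] by (simp add: xn_def)

lemma xn_sq: assumes "n \<ge> 1" shows "(xn n)\<^sup>2 = real n * h (xn n)"
  by (simp add: h_xn[OF assms]) (simp add: xn_def power_mult_distrib)

lemma xn_at_top: "filterlim xn at_top sequentially"
proof (rule filterlim_at_top_gt[THEN iffD2, rule_format])
  fix B :: real assume B: "B > 0"
  have "B \<le> xn n" if n: "n \<ge> 1" "real n > B\<^sup>2 / h B" for n
  proof (rule ccontr)
    assume c: "\<not> B \<le> xn n"
    have x: "xn n > 0" using xn_pos n by auto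
    have "h B / B \<le> h (xn n) / xn n" using c x by (intro h_over_id_mono) auto
    then have "xn n * h B \<le> h (xn n) * B" using B x by (simp add: field_simps)
    then have "xn n * (xn n * h B) \<le> xn n * (h (xn n) * B)" using x by (intro mult_left_mono) auto
    also have "\<dots> \<le> B * (h (xn n) * B)" using c B h_pos[OF x] by (intro mult_right_mono) auto
    finally have "(xn n)\<^sup>2 * h B \<le> h (xn n) * B\<^sup>2" by (simp add: power2_eq_square mult_ac)
    then have "h (xn n) * (real n * h B) \<le> h (xn n) * B\<^sup>2" using xn_sq[OF n(1)] by (simp add: mult_ac)
    then have "real n * h B \<le> B\<^sup>2" using h_pos[OF x] by simp
    then show False using n(2) h_pos[OF B] by (simp add: field_simps)
  qed
  moreover have "\<forall>\<^sub>F n in sequentially. n \<ge> 1 \<and> real n > B\<^sup>2 / h B"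
    by (intro eventually_conj eventually_ge_at_top)
       (rule eventually_compose_filterlim[OF eventually_gt_at_top filterlim_real_sequentially])
  ultimately show "\<forall>\<^sub>F n in sequentially. B \<le> xn n" by (auto elim!: eventually_mono)
qed

lemma h_ge_ln: "\<forall>\<^sub>F x in at_top. C * ln x \<le> h x"
proof -
  have "\<forall>\<^sub>F x in at_top. C \<le> h x / ln x" using h_over_ln by (auto simp: filterlim_at_top)
  moreover have "\<forall>\<^sub>F x::real in at_top. x > 1" by (rule eventually_gt_at_top)
  ultimately show ?thesis by eventually_elim (simp add: field_simps)
qed

lemma h_at_top: "filterlim h at_top at_top"
  by (rule filterlim_at_top_mono[OF ln_at_top]) (use h_ge_ln[of 1] in simp)

lemma \<Lambda>_sq_at_top: "filterlim (\<lambda>n. (\<Lambda> n)\<^sup>2) at_top sequentially"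
proof -
  have "filterlim (\<lambda>n. h (xn n)) at_top sequentially"
    using filterlim_compose[OF h_at_top xn_at_top] .
  moreover have "\<forall>\<^sub>F n in sequentially. h (xn n) = (\<Lambda> n)\<^sup>2"
    using eventually_ge_at_top[of 1] by eventually_elim (rule h_xn)
  ultimately show ?thesis by (simp cong: filterlim_cong)
qed

lemma \<Lambda>_at_top: "filterlim \<Lambda> at_top sequentially"
proof (rule filterlim_at_top_mono[OF filterlim_compose[OF sqrt_at_top \<Lambda>_sq_at_top]])
  show "\<forall>\<^sub>F n in sequentially. sqrt ((\<Lambda> n)\<^sup>2) \<le> \<Lambda> n"
    using eventually_ge_at_top[of 1] by eventually_elim (use \<Lambda>_pos in \<open>simp add: less_imp_le\<close>)
qed

lemma \<Lambda>_sq_ge_ln: "\<forall>\<^sub>F n in sequentially. C * ln (real n) \<le> (\<Lambda> n)\<^sup>2"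
proof -
  define D where "D = 2 * max C 0"
  have "\<forall>\<^sub>F n in sequentially. D * ln (xn n) \<le> h (xn n)"
    using xn_at_top h_ge_ln[of D] by (rule eventually_compose_filterlim[rotated])
  moreover have "\<forall>\<^sub>F n in sequentially. 1 \<le> (\<Lambda> n)\<^sup>2"
    using \<Lambda>_sq_at_top by (auto simp: filterlim_at_top)
  moreover have "\<forall>\<^sub>F n in sequentially. 1 \<le> n" by (rule eventually_ge_at_top)
  ultimately show ?thesis
  proof eventually_elim
    case (elim n)
    have "real n \<le> real n * h (xn n)" using elim by (simp add: h_xn)
    also have "\<dots> = (xn n)\<^sup>2" using xn_sq elim by auto
    finally have "ln (real n) \<le> ln ((xn n)\<^sup>2)" using elim by (subst ln_le_cancel_iff) auto
    also have "\<dots> = 2 * ln (xn n)" using xn_pos[of n] elim by (simp add: ln_realpow)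
    finally have "max C 0 * ln (real n) \<le> max C 0 * (2 * ln (xn n))"
      by (intro mult_left_mono) auto
    moreover have "C * ln (real n) \<le> max C 0 * ln (real n)" using elim by (intro mult_right_mono) auto
    ultimately show ?case using elim by (simp add: D_def h_xn)
  qed
qed

text \<open>
  This is where \<open>\<alpha> < 1 / 2\<close> enters the size of \<open>\<Lambda>\<close>: since \<open>\<Lambda> n ^ 3 / sqrt n = (h (xn n))\<^sup>2 / xn n\<close>,
  it gives \<open>\<Lambda> n = o (n powr (1 / 6))\<close>.
\<close>

lemma h_sq_over_id: "((\<lambda>x. (h x)\<^sup>2 / x) \<longlongrightarrow> 0) at_top"
proof -
  define C where "C = (h 2)\<^sup>2 / 2 powr (2 * \<alpha>)"
  have lim: "((\<lambda>x. C * x powr (2 * \<alpha> - 1)) \<longlongrightarrow> 0) at_top"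
    using tendsto_mult_right_zero[OF tendsto_neg_powr[OF _ filterlim_ident], of "2*\<alpha> - 1" C] \<alpha> by simp
  have "\<forall>\<^sub>F x in at_top. norm ((h x)\<^sup>2 / x) \<le> C * x powr (2 * \<alpha> - 1)"
    using eventually_ge_at_top[of 2]
  proof eventually_elim
    case (elim x)
    have "(h x)\<^sup>2 \<le> ((x/2) powr \<alpha> * h 2)\<^sup>2"
      using elim h_le_powr[of 2 x] h_pos[of x] by (intro power_mono) auto
    also have "\<dots> = (x powr \<alpha> * x powr \<alpha>) / (2 powr \<alpha> * 2 powr \<alpha>) * (h 2)\<^sup>2"
      using elim by (simp add: power_mult_distrib powr_divide power2_eq_square)
    also have "\<dots> = C * x powr (2 * \<alpha>)"
      by (simp add: C_def powr_add[symmetric])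
    finally show ?case using elim by (simp add: powr_diff field_simps)
  qed
  then show ?thesis using lim by (rule Lim_null_comparison)
qed

lemma \<Lambda>_cube_over_sqrt: "(\<lambda>n. (\<Lambda> n)^3 / sqrt (real n)) \<longlonglongrightarrow> 0"
proof -
  have "(\<lambda>n. (h (xn n))\<^sup>2 / xn n) \<longlonglongrightarrow> 0"
    using filterlim_compose[OF h_sq_over_id xn_at_top] .
  moreover have "\<forall>\<^sub>F n in sequentially. (h (xn n))\<^sup>2 / xn n = (\<Lambda> n)^3 / sqrt (real n)"
    using eventually_ge_at_top[of 1]
  proof eventually_elim
    case (elim n)
    then show ?case using \<Lambda>_pos[of n]
      by (simp add: h_xn) (simp add: xn_def field_simps power2_eq_square power3_eq_cube power4_eq_xxxx)
  qed
  ultimately show ?thesis by (simp cong: tendsto_cong)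
qed

end

section \<open>Tails and Laplace transform of the standard normal distribution\<close>

text \<open>
  The Gaussian tail \<open>1 - \<Phi> x\<close>.
\<close>

definition normal_tail :: "real \<Rightarrow> real" where
  "normal_tail x = measure std_normal_distribution {x<..}"

lemma prob_space_std_normal: "prob_space std_normal_distribution"
  by (rule prob_space_normal_density) simp

lemma measure_std_normal_eq:
  assumes "A \<in> sets borel"
  shows "measure std_normal_distribution A = (\<integral>s. indicator A s * std_normal_density s \<partial>lborel)"
proof -
  interpret prob_space std_normal_distribution by (rule prob_space_std_normal)
  have "measure std_normal_distribution A = (\<integral>s. indicator A s \<partial>std_normal_distribution)"
    using assms by simp
  also have "\<dots> = (\<integral>s. indicator A s * std_normal_density s \<partial>lborel)"
    using assms by (subst integral_density) (auto simp: mult.commute)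
  finally show ?thesis .
qed

lemma integrable_indicator_normal:
  assumes "A \<in> sets borel" "\<sigma> > 0"
  shows "integrable lborel (\<lambda>s. indicator A s * normal_density \<mu> \<sigma> s)"
  using integrable_real_mult_indicator[of A lborel "normal_density \<mu> \<sigma>"] assms by (simp add: mult.commute)

lemma std_normal_density_le: "std_normal_density s \<le> exp (- s\<^sup>2 / 2)"
proof -
  have "1 \<le> sqrt (2 * pi)" using pi_gt3 by (simp add: real_le_rsqrt)
  then have "1 / sqrt (2 * pi) \<le> 1" by simp
  then show ?thesis unfolding std_normal_density_def by (intro mult_left_le_one_le) auto
qed

lemma
  assumes "0 < l"
  shows integrable_exponential_density: "integrable lborel (exponential_density l)"
    and integral_exponential_density: "(\<integral>v. exponential_density l v \<partial>lborel) = 1"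
proof -
  interpret prob_space "density lborel (exponential_density l)"
    by (rule prob_space_exponential_density[OF assms])
  show "integrable lborel (exponential_density l)"
    using assms emeasure_space_1
    by (intro integrableI_nonneg) (auto simp: emeasure_density exponential_density_nonneg)
  show "(\<integral>v. exponential_density l v \<partial>lborel) = 1"
    using assms emeasure_space_1
    by (simp add: emeasure_density integral_eq_nn_integral exponential_density_nonneg)
qed

lemma normal_tail_upper: assumes "x > 0" shows "normal_tail x \<le> exp (- x\<^sup>2 / 2) / x"
proof -
  have "normal_tail x = (\<integral>s. indicator {x<..} s * std_normal_density s \<partial>lborel)"
    unfolding normal_tail_def by (rule measure_std_normal_eq) auto
  also have "\<dots> = (\<integral>v. indicator {x<..} (x + v) * std_normal_density (x + v) \<partial>lborel)"
    using lborel_integral_real_affine[of 1 "\<lambda>s. indicator {x<..} s * std_normal_density s" x] by simp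
  also have "\<dots> \<le> (\<integral>v. exp (- x\<^sup>2 / 2) / x * exponential_density x v \<partial>lborel)"
  proof (rule integral_mono')
    show "integrable lborel (\<lambda>v. exp (- x\<^sup>2 / 2) / x * exponential_density x v)" using integrable_exponential_density[OF assms] by simp
    fix v
    show "indicator {x<..} (x + v) * std_normal_density (x + v) \<le> exp (- x\<^sup>2 / 2) / x * exponential_density x v"
    proof (cases "v > 0")
      case True
      have "std_normal_density (x + v) \<le> exp (- (x + v)\<^sup>2 / 2)" by (rule std_normal_density_le)
      also have "\<dots> \<le> exp (- x\<^sup>2 / 2 - v * x)"
        using zero_le_square[of v] by (simp add: power2_eq_square algebra_simps add_divide_distrib diff_divide_distrib)
      also have "\<dots> = exp (- x\<^sup>2 / 2) / x * exponential_density x v"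
      proof -
        have "exp (- x\<^sup>2 / 2 - v * x) = exp (- x\<^sup>2 / 2) * exp (- v * x)"
          by (simp only: exp_add[symmetric]) simp
        then show ?thesis using True assms by (simp add: exponential_density_def)
      qed
      finally show ?thesis using True by simp
    qed (use assms in \<open>auto simp: exponential_density_def\<close>)
    show "0 \<le> exp (- x\<^sup>2 / 2) / x * exponential_density x v"
      using assms by (simp add: exponential_density_nonneg)
  qed
  finally show ?thesis by (simp add: integral_exponential_density[OF assms])
qed

lemma measure_std_normal_interval_le:
  assumes "a \<le> b" "\<And>s. a < s \<Longrightarrow> s \<le> b \<Longrightarrow> std_normal_density s \<le> C"
  shows "normal_tail a - normal_tail b \<le> (b - a) * C"
proof -
  interpret prob_space std_normal_distribution by (rule prob_space_std_normal)
  have "normal_tail a - normal_tail b = measure std_normal_distribution ({a<..} - {b<..})"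
    unfolding normal_tail_def using assms by (subst finite_measure_Diff) auto
  also have "{a<..} - {b<..} = {a<..b}" by auto
  also have "measure std_normal_distribution {a<..b} = (\<integral>s. indicator {a<..b} s * std_normal_density s \<partial>lborel)"
    by (rule measure_std_normal_eq) auto
  also have "\<dots> \<le> (\<integral>s. C * indicator {a<..b} s \<partial>lborel)"
  proof (rule integral_mono)
    show "integrable lborel (\<lambda>s. C * indicator {a<..b} s)"
      using assms by (intro integrable_mult_right integrable_real_indicator) auto
    show "integrable lborel (\<lambda>s. indicator {a<..b} s * std_normal_density s)"
      by (intro integrable_indicator_normal) auto
  qed (use assms in \<open>auto simp: indicator_def\<close>)
  also have "\<dots> = (b - a) * C" using assms by simp
  finally show ?thesis .
qed

text \<open>
  Moving the threshold by \<open>e\<close> changes the tail by at most \<open>e\<close> times the supremum of the density; by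
  \<open>normal_tail_lower\<close> this is a small relative change when \<open>(1 + x) * e\<close> is small.
\<close>

lemma normal_tail_diff_left:
  assumes "x \<ge> 0" "e \<ge> 0"
  shows "normal_tail (x - e) \<le> normal_tail x + e * (exp (x * e) * exp (- x\<^sup>2 / 2))"
proof -
  have "normal_tail (x - e) - normal_tail x \<le> (x - (x - e)) * (exp (x * e) * exp (- x\<^sup>2 / 2))"
  proof (rule measure_std_normal_interval_le)
    fix s assume s: "x - e < s" "s \<le> x"
    have "std_normal_density s \<le> exp (- s\<^sup>2 / 2)" by (rule std_normal_density_le)
    also have "\<dots> \<le> exp (x * e + - x\<^sup>2 / 2)"
    proof -
      have "0 \<le> (x - s)\<^sup>2" by simp
      moreover have "x * (x - s) \<le> x * e" using s assms by (intro mult_left_mono) auto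
      ultimately show ?thesis by (simp add: power2_eq_square algebra_simps)
    qed
    finally show "std_normal_density s \<le> exp (x * e) * exp (- x\<^sup>2 / 2)" by (simp only: exp_add)
  qed (use assms in auto)
  then show ?thesis by simp
qed

lemma normal_tail_diff_right:
  assumes "x \<ge> 0" "e \<ge> 0"
  shows "normal_tail x \<le> normal_tail (x + e) + e * exp (- x\<^sup>2 / 2)"
proof -
  have "normal_tail x - normal_tail (x + e) \<le> (x + e - x) * exp (- x\<^sup>2 / 2)"
  proof (rule measure_std_normal_interval_le)
    fix s assume s: "x < s" "s \<le> x + e"
    have "std_normal_density s \<le> exp (- s\<^sup>2 / 2)" by (rule std_normal_density_le)
    also have "\<dots> \<le> exp (- x\<^sup>2 / 2)" using s assms by (simp add: power_mono)
    finally show "std_normal_density s \<le> exp (- x\<^sup>2 / 2)" .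
  qed (use assms in auto)
  then show ?thesis by simp
qed

text \<open>
  A constant in the lower Mills bound \<open>normal_tail_lower\<close>, obtained by integrating the density over the
  interval from \<open>x\<close> to \<open>x + 1 / (1 + x)\<close>, on which \<open>s\<^sup>2 \<le> x\<^sup>2 + 3\<close>.
\<close>

definition "mills_const = exp (- 3 / 2) / sqrt (2 * pi)"

lemma mills_const_pos: "mills_const > 0" by (simp add: mills_const_def)

lemma normal_tail_lower:
  assumes "x \<ge> 0"
  shows "mills_const * exp (- x\<^sup>2 / 2) / (1 + x) \<le> normal_tail x"
proof -
  define e where "e = 1 / (1 + x)"
  have e: "0 < e" "e \<le> 1" "x * e \<le> 1" using assms by (auto simp: e_def field_simps)
  interpret prob_space std_normal_distribution by (rule prob_space_std_normal)
  have "mills_const * exp (- x\<^sup>2 / 2) / (1 + x) = (\<integral>s. (mills_const * exp (- x\<^sup>2 / 2)) * indicator {x<..x+e} s \<partial>lborel)"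
    using e by (simp add: e_def)
  also have "\<dots> \<le> (\<integral>s. indicator {x<..x+e} s * std_normal_density s \<partial>lborel)"
  proof (rule integral_mono)
    fix s
    show "(mills_const * exp (- x\<^sup>2 / 2)) * indicator {x<..x+e} s \<le> indicator {x<..x+e} s * std_normal_density s"
    proof (cases "s \<in> {x<..x+e}")
      case True
      have "s\<^sup>2 \<le> (x + e)\<^sup>2" using True assms by (intro power_mono) auto
      also have "\<dots> = x\<^sup>2 + 2 * (x * e) + e * e" by (simp add: power2_eq_square algebra_simps)
      also have "\<dots> \<le> x\<^sup>2 + 3" using e mult_mono[of e 1 e 1] by auto
      finally have "exp (- 3 / 2 + - x\<^sup>2 / 2) \<le> exp (- s\<^sup>2 / 2)" by simp
      then have "exp (- 3 / 2) * exp (- x\<^sup>2 / 2) / sqrt (2 * pi) \<le> exp (- s\<^sup>2 / 2) / sqrt (2 * pi)"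
        by (intro divide_right_mono) (auto simp only: exp_add, simp)
      then show ?thesis using True by (simp add: mills_const_def std_normal_density_def)
    qed auto
  next
    show "integrable lborel (\<lambda>s. (mills_const * exp (- x\<^sup>2 / 2)) * indicator {x<..x+e} s)"
      using e by (intro integrable_mult_right integrable_real_indicator) auto
  qed (auto intro!: integrable_indicator_normal)
  also have "\<dots> = measure std_normal_distribution {x<..x+e}"
    by (rule measure_std_normal_eq[symmetric]) auto
  also have "\<dots> \<le> normal_tail x"
    unfolding normal_tail_def by (rule finite_measure_mono) auto
  finally show ?thesis .
qed

lemma normal_tail_pos: assumes "x \<ge> 0" shows "normal_tail x > 0"
  using normal_tail_lower[OF assms] mills_const_pos assms
  by (smt (verit) divide_pos_pos exp_gt_zero mult_pos_pos)

lemma normal_tail_mono: "x \<le> y \<Longrightarrow> normal_tail y \<le> normal_tail x"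
proof -
  assume "x \<le> y"
  interpret prob_space std_normal_distribution by (rule prob_space_std_normal)
  show ?thesis unfolding normal_tail_def using \<open>x \<le> y\<close> by (intro finite_measure_mono) auto
qed

lemma exp_mult_std_normal_density:
  "exp (\<theta> * s) * std_normal_density s = exp (\<theta>\<^sup>2 / 2) * std_normal_density (s - \<theta>)"
proof -
  have "exp (\<theta> * s) * exp (- s\<^sup>2 / 2) = exp (\<theta>\<^sup>2 / 2) * exp (- (s - \<theta>)\<^sup>2 / 2)"
    unfolding exp_add[symmetric] by (simp add: power2_eq_square field_simps)
  then show ?thesis unfolding std_normal_density_def by (simp add: field_simps)
qed

lemma integrable_shift: 
  fixes f :: "real \<Rightarrow> real"
  assumes "integrable lborel f"
  shows "integrable lborel (\<lambda>s. f (s - \<theta>))"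
  using lborel_integrable_real_affine[OF assms, of 1 "-\<theta>"] by simp

lemma integrable_exp_std_normal: "integrable std_normal_distribution (\<lambda>s. exp (\<theta> * s))"
proof -
  have "integrable lborel (\<lambda>s. exp (\<theta>\<^sup>2 / 2) * std_normal_density (s - \<theta>))"
    by (intro integrable_mult_right integrable_shift) auto
  then have "integrable lborel (\<lambda>s. std_normal_density s * exp (\<theta> * s))"
    by (subst mult.commute) (simp only: exp_mult_std_normal_density)
  then show ?thesis by (subst integrable_density) auto
qed

lemma normal_laplace:
  "(\<integral>s. exp ((complex_of_real \<theta> + \<i> * complex_of_real t) * complex_of_real s) \<partial>std_normal_distribution)
    = exp ((complex_of_real \<theta> + \<i> * complex_of_real t)\<^sup>2 / 2)"
proof -
  have c: "(\<integral>s. iexp (t * s) \<partial>std_normal_distribution) = exp (- (t\<^sup>2) / 2)"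
    using fun_cong[OF char_std_normal_distribution, of t] by (simp add: char_def)
  have c2: "(\<integral>s. std_normal_density s *\<^sub>R iexp (t * s) \<partial>lborel) = exp (- (t\<^sup>2) / 2)"
    using c by (subst (asm) integral_density) auto
  have "(\<integral>s. exp ((complex_of_real \<theta> + \<i> * complex_of_real t) * complex_of_real s) \<partial>std_normal_distribution)
     = (\<integral>s. std_normal_density s *\<^sub>R exp ((complex_of_real \<theta> + \<i> * complex_of_real t) * complex_of_real s) \<partial>lborel)"
    by (subst integral_density) auto
  also have "\<dots> = (\<integral>s. complex_of_real (exp (\<theta>\<^sup>2 / 2)) * (std_normal_density (s - \<theta>) *\<^sub>R iexp (t * s)) \<partial>lborel)"
  proof (rule Bochner_Integration.integral_cong[OF refl])
    fix s
    have "std_normal_density s *\<^sub>R exp ((complex_of_real \<theta> + \<i> * complex_of_real t) * complex_of_real s)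
        = complex_of_real (exp (\<theta> * s) * std_normal_density s) * iexp (t * s)"
    proof -
      have "(complex_of_real \<theta> + \<i> * complex_of_real t) * complex_of_real s = complex_of_real (\<theta> * s) + \<i> * (t * s)"
        by (simp add: algebra_simps)
      then have "exp ((complex_of_real \<theta> + \<i> * complex_of_real t) * complex_of_real s) = complex_of_real (exp (\<theta> * s)) * iexp (t * s)"
        by (simp only: exp_add exp_of_real)
      then show ?thesis by (simp add: scaleR_conv_of_real)
    qed
    also have "\<dots> = complex_of_real (exp (\<theta>\<^sup>2 / 2)) * (std_normal_density (s - \<theta>) *\<^sub>R iexp (t * s))"
      unfolding exp_mult_std_normal_density by (simp add: scaleR_conv_of_real mult_ac)
    finally show "std_normal_density s *\<^sub>R exp ((complex_of_real \<theta> + \<i> * complex_of_real t) * complex_of_real s) = \<dots>" .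
  qed
  also have "\<dots> = complex_of_real (exp (\<theta>\<^sup>2 / 2)) * (\<integral>s. std_normal_density (s - \<theta>) *\<^sub>R iexp (t * s) \<partial>lborel)"
    by (rule integral_mult_right_zero)
  also have "(\<integral>s. std_normal_density (s - \<theta>) *\<^sub>R iexp (t * s) \<partial>lborel)
     = (\<integral>s. std_normal_density s *\<^sub>R iexp (t * (\<theta> + s)) \<partial>lborel)"
    using lborel_integral_real_affine[of 1 "\<lambda>s. std_normal_density (s - \<theta>) *\<^sub>R iexp (t * s)" \<theta>] by simp
  also have "\<dots> = (\<integral>s. iexp (t * \<theta>) * (std_normal_density s *\<^sub>R iexp (t * s)) \<partial>lborel)"
    by (intro Bochner_Integration.integral_cong) (simp_all add: distrib_left exp_add scaleR_conv_of_real mult_ac)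
  also have "\<dots> = iexp (t * \<theta>) * exp (- (t\<^sup>2) / 2)"
    by (subst integral_mult_right_zero) (simp only: c2)
  also have "complex_of_real (exp (\<theta>\<^sup>2 / 2)) * \<dots> = exp ((complex_of_real \<theta> + \<i> * complex_of_real t)\<^sup>2 / 2)"
    unfolding exp_of_real[symmetric] exp_add[symmetric]
    by (simp add: power2_eq_square field_simps)
  finally show ?thesis .
qed

section \<open>Gaussian smoothing of exponentially weighted tails\<close>

text \<open>
  With \<open>V\<close> a centred normal variable of standard deviation \<open>\<delta>\<close>, this is the expectation of
  \<open>exp (- \<theta> * V)\<close> on the event \<open>s + V > y\<close>: a smooth version of the indicator of \<open>s > y\<close>. The integration
  variable is \<open>w = s + V\<close>. The weight is chosen so that \<open>exp (- \<theta> * s)\<close> times the function is the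
  smoothing of \<open>exp (- \<theta> * w)\<close> restricted to \<open>w > y\<close>, which makes it compatible with Laplace transforms on the
  line \<open>Re z = \<theta>\<close>.
\<close>

definition smooth_tail :: "real \<Rightarrow> real \<Rightarrow> real \<Rightarrow> real \<Rightarrow> real" where
  "smooth_tail \<theta> \<delta> y s = (\<integral>w. indicator {y<..} w * (exp (\<theta> * (s - w)) * normal_density 0 \<delta> (w - s)) \<partial>lborel)"

lemma exp_mult_normal_density:
  assumes "\<delta> > 0"
  shows "exp (\<theta> * (s - w)) * normal_density 0 \<delta> (w - s)
    = exp (\<theta>\<^sup>2 * \<delta>\<^sup>2 / 2) * normal_density (s - \<theta> * \<delta>\<^sup>2) \<delta> w"
proof -
  have "exp (\<theta> * (s - w)) * exp (- (w - s - 0)\<^sup>2 / (2 * \<delta>\<^sup>2))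
     = exp (\<theta>\<^sup>2 * \<delta>\<^sup>2 / 2) * exp (- (w - (s - \<theta> * \<delta>\<^sup>2))\<^sup>2 / (2 * \<delta>\<^sup>2))"
    unfolding exp_add[symmetric] using assms by (simp add: power2_eq_square field_simps)
  then show ?thesis unfolding normal_density_def by (simp add: field_simps)
qed

lemma integrable_smooth:
  assumes "\<delta> > 0" "A \<in> sets borel"
  shows "integrable lborel (\<lambda>w. indicator A w * (exp (\<theta> * (s - w)) * normal_density 0 \<delta> (w - s)))"
  unfolding exp_mult_normal_density[OF assms(1)]
  using integrable_mult_right[OF integrable_indicator_normal[OF assms(2) assms(1), of "s - \<theta> * \<delta>\<^sup>2"], of "exp (\<theta>\<^sup>2 * \<delta>\<^sup>2 / 2)"]
  by (simp add: mult_ac)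

lemma smooth_tail_nonneg: "smooth_tail \<theta> \<delta> y s \<ge> 0"
  unfolding smooth_tail_def by (intro integral_nonneg_AE) auto

lemma smooth_tail_le:
  assumes "\<delta> > 0" shows "smooth_tail \<theta> \<delta> y s \<le> exp (\<theta>\<^sup>2 * \<delta>\<^sup>2 / 2)"
proof -
  have "smooth_tail \<theta> \<delta> y s \<le> (\<integral>w. exp (\<theta>\<^sup>2 * \<delta>\<^sup>2 / 2) * normal_density (s - \<theta> * \<delta>\<^sup>2) \<delta> w \<partial>lborel)"
    unfolding smooth_tail_def exp_mult_normal_density[OF assms]
    using assms by (intro integral_mono') (auto simp: indicator_def)
  then show ?thesis using assms by simp
qed

lemma normal_tail_eighth_moment:
  assumes "\<delta> > 0"
  shows "integrable lborel (\<lambda>v. normal_density 0 \<delta> v * v ^ 8)"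
    "(\<integral>v. normal_density 0 \<delta> v * v ^ 8 \<partial>lborel) = 105 * \<delta> ^ 8"
proof -
  show "integrable lborel (\<lambda>v. normal_density 0 \<delta> v * v ^ 8)"
    using integrable_normal_moment[OF assms, of 0 8] by simp
  show "(\<integral>v. normal_density 0 \<delta> v * v ^ 8 \<partial>lborel) = 105 * \<delta> ^ 8"
    using integral_normal_moment_even[OF assms, of 0 4] assms
    by (simp add: fact_numeral power_divide field_simps power_mult[symmetric])
qed

text \<open>
  The two bounds that sandwich the indicator of a half-line between smoothed tails with thresholds
  shifted by \<open>\<kappa>\<close>. The probability that the noise exceeds \<open>\<kappa>\<close> is estimated by its eighth moment.
\<close>

lemma smooth_tail_lower:
  assumes "\<delta> > 0" "\<kappa> > 0" "\<theta> \<ge> 0" "x \<le> s"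
  shows "exp (- \<theta> * \<kappa>) * (1 - 105 * \<delta>^8 / \<kappa>^8) \<le> smooth_tail \<theta> \<delta> (x - \<kappa>) s"
proof -
  let ?n = "normal_density 0 \<delta>"
  have int: "integrable lborel (\<lambda>v. ?n v - ?n v * v ^ 8 / \<kappa> ^ 8)"
    using assms normal_tail_eighth_moment[of \<delta>] by auto
  have "exp (- \<theta> * \<kappa>) * (1 - 105 * \<delta>^8 / \<kappa>^8) = (\<integral>v. exp (- \<theta> * \<kappa>) * (?n v - ?n v * v ^ 8 / \<kappa> ^ 8) \<partial>lborel)"
    using assms normal_tail_eighth_moment[of \<delta>] by simp
  also have "\<dots> \<le> (\<integral>v. indicator {x-\<kappa><..} (s + v) * (exp (\<theta> * (s - (s + v))) * ?n (s + v - s)) \<partial>lborel)"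
  proof (rule integral_mono)
    show "integrable lborel (\<lambda>v. exp (- \<theta> * \<kappa>) * (?n v - ?n v * v ^ 8 / \<kappa> ^ 8))"
      using int by simp
    show "integrable lborel (\<lambda>v. indicator {x-\<kappa><..} (s + v) * (exp (\<theta> * (s - (s + v))) * ?n (s + v - s)))"
      using lborel_integrable_real_affine[OF integrable_smooth[OF assms(1), of "{x-\<kappa><..}" \<theta> s], of 1 s] by simp
    fix v :: real
    show "exp (- \<theta> * \<kappa>) * (?n v - ?n v * v ^ 8 / \<kappa> ^ 8) \<le> indicator {x-\<kappa><..} (s + v) * (exp (\<theta> * (s - (s + v))) * ?n (s + v - s))"
    proof (cases "\<bar>v\<bar> < \<kappa>")
      case True
      have "?n v - ?n v * v ^ 8 / \<kappa> ^ 8 \<le> ?n v" using assms by (simp add: zero_le_power_eq)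
      moreover have "exp (- \<theta> * \<kappa>) \<le> exp (\<theta> * - v)" using True assms by (simp add: mult_left_mono)
      ultimately have "exp (- \<theta> * \<kappa>) * (?n v - ?n v * v ^ 8 / \<kappa> ^ 8) \<le> exp (\<theta> * - v) * ?n v"
        by (smt (verit) exp_gt_zero mult_left_mono mult_right_mono normal_density_nonneg)
      then show ?thesis using True assms by (auto simp: indicator_def)
    next
      case False
      then have "\<kappa> ^ 8 \<le> \<bar>v\<bar> ^ 8" using assms by (intro power_mono) auto
      then have "?n v * \<kappa> ^ 8 \<le> ?n v * v ^ 8" by (intro mult_left_mono) auto
      then have "?n v - ?n v * v ^ 8 / \<kappa> ^ 8 \<le> 0" using assms by (simp add: field_simps)
      then have "exp (- \<theta> * \<kappa>) * (?n v - ?n v * v ^ 8 / \<kappa> ^ 8) \<le> 0" by (intro mult_nonneg_nonpos) auto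
      then show ?thesis by (rule order_trans) simp
    qed
  qed
  also have "\<dots> = smooth_tail \<theta> \<delta> (x - \<kappa>) s"
    unfolding smooth_tail_def
    using lborel_integral_real_affine[of 1 "\<lambda>w. indicator {x-\<kappa><..} w * (exp (\<theta> * (s - w)) * ?n (w - s))" s] by simp
  finally show ?thesis .
qed

lemma smooth_tail_upper:
  assumes "\<delta> > 0" "\<kappa> > 0" "\<theta> \<ge> 0"
  shows "smooth_tail \<theta> \<delta> (x + \<kappa>) s \<le> indicator {x<..} s * exp (\<theta>\<^sup>2 * \<delta>\<^sup>2 / 2) + exp (\<theta> * (s - x)) * (105 * \<delta>^8 / \<kappa>^8)"
proof (cases "s > x")
  case True
  have "0 \<le> exp (\<theta> * (s - x)) * (105 * \<delta>^8 / \<kappa>^8)" using assms by simp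
  moreover have "indicator {x<..} s = (1::real)" using True by simp
  ultimately show ?thesis using smooth_tail_le[OF assms(1), of \<theta> "x + \<kappa>" s] by (simp only: mult_1)
next
  case False
  let ?n = "normal_density 0 \<delta>"
  have "smooth_tail \<theta> \<delta> (x + \<kappa>) s = (\<integral>v. indicator {x+\<kappa><..} (s + v) * (exp (\<theta> * (s - (s + v))) * ?n (s + v - s)) \<partial>lborel)"
    unfolding smooth_tail_def
    using lborel_integral_real_affine[of 1 "\<lambda>w. indicator {x+\<kappa><..} w * (exp (\<theta> * (s - w)) * ?n (w - s))" s] by simp
  also have "\<dots> \<le> (\<integral>v. exp (\<theta> * (s - x)) * (?n v * v ^ 8 / \<kappa> ^ 8) \<partial>lborel)"
  proof (rule integral_mono')
    show "integrable lborel (\<lambda>v. exp (\<theta> * (s - x)) * (?n v * v ^ 8 / \<kappa> ^ 8))"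
      using assms normal_tail_eighth_moment[of \<delta>] by auto
    fix v :: real
    show "0 \<le> exp (\<theta> * (s - x)) * (?n v * v ^ 8 / \<kappa> ^ 8)" using assms by (simp add: zero_le_power_eq)
    show "indicator {x+\<kappa><..} (s + v) * (exp (\<theta> * (s - (s + v))) * ?n (s + v - s)) \<le> exp (\<theta> * (s - x)) * (?n v * v ^ 8 / \<kappa> ^ 8)"
    proof (cases "s + v > x + \<kappa>")
      case True
      then have "v > \<kappa>" using False by auto
      then have "\<kappa> ^ 8 \<le> v ^ 8" using assms by (intro power_mono) auto
      then have "?n v * \<kappa> ^ 8 \<le> ?n v * v ^ 8" by (intro mult_left_mono) auto
      then have "?n v \<le> ?n v * v ^ 8 / \<kappa> ^ 8" using assms by (simp add: field_simps)
      moreover have "exp (\<theta> * (s - (s + v))) \<le> exp (\<theta> * (s - x))"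
        using True assms mult_left_mono[of "s - (s + v)" "s - x" \<theta>] by auto
      ultimately have "exp (\<theta> * (s - (s + v))) * ?n v \<le> exp (\<theta> * (s - x)) * (?n v * v ^ 8 / \<kappa> ^ 8)"
        by (intro mult_mono) auto
      then show ?thesis using True by simp
    qed (use assms in \<open>simp add: zero_le_power_eq\<close>)
  qed
  also have "\<dots> = exp (\<theta> * (s - x)) * (105 * \<delta>^8 / \<kappa>^8)"
    using assms normal_tail_eighth_moment[of \<delta>] by simp
  finally show ?thesis using False by simp
qed

text \<open>
  The Fourier transform of the centred normal density with standard deviation \<open>\<delta>\<close>, divided by \<open>2 * pi\<close>.
\<close>

definition gauss_weight :: "real \<Rightarrow> real \<Rightarrow> real" where
  "gauss_weight \<delta> t = exp (- (\<delta> * t)\<^sup>2 / 2) / (2 * pi)"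

text \<open>
  The two-sided Laplace transform, with the sign convention of a moment generating function.
\<close>

definition laplace :: "real measure \<Rightarrow> complex \<Rightarrow> complex" where
  "laplace G z = (\<integral>s. exp (z * complex_of_real s) \<partial>G)"

lemma gauss_weight_nonneg [simp]: "0 \<le> gauss_weight \<delta> t"
  by (simp add: gauss_weight_def)

lemma gauss_weight_measurable [measurable]: "gauss_weight \<delta> \<in> borel_measurable borel"
  unfolding gauss_weight_def[abs_def] by measurable

lemma gauss_weight_eq: "gauss_weight \<delta> t = std_normal_density (0 + \<delta> * t) / sqrt (2 * pi)"
  by (simp add: gauss_weight_def std_normal_density_def)

lemma gauss_weight_integrable: assumes "\<delta> > 0" shows "integrable lborel (gauss_weight \<delta>)"
  unfolding gauss_weight_eq[abs_def]
  using lborel_integrable_real_affine[of std_normal_density \<delta> 0] assms by auto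

lemma normal_density_fourier:
  assumes "\<delta> > 0"
  shows "complex_of_real (normal_density 0 \<delta> v)
    = (\<integral>t. complex_of_real (gauss_weight \<delta> t) * iexp (- (v * t)) \<partial>lborel)"
proof -
  have "(\<integral>s. iexp (- (v / \<delta>) * s) \<partial>std_normal_distribution) = exp (- ((- (v / \<delta>))\<^sup>2) / 2)"
    using fun_cong[OF char_std_normal_distribution, of "- (v / \<delta>)"] by (simp add: char_def)
  then have "exp (- ((- (v / \<delta>))\<^sup>2) / 2) = (\<integral>s. std_normal_density s *\<^sub>R iexp (- (v / \<delta>) * s) \<partial>lborel)"
    by (subst (asm) integral_density) auto
  also have "\<dots> = \<bar>\<delta>\<bar> *\<^sub>R (\<integral>t. std_normal_density (0 + \<delta> * t) *\<^sub>R iexp (- (v / \<delta>) * (0 + \<delta> * t)) \<partial>lborel)"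
    using assms by (intro lborel_integral_real_affine) auto
  also have "\<dots> = \<bar>\<delta>\<bar> *\<^sub>R (\<integral>t. complex_of_real (sqrt (2 * pi)) * (complex_of_real (gauss_weight \<delta> t) * iexp (- (v * t))) \<partial>lborel)"
    using assms by (intro arg_cong[where f="\<lambda>x. _ *\<^sub>R x"] Bochner_Integration.integral_cong)
      (simp_all add: gauss_weight_eq scaleR_conv_of_real)
  also have "\<dots> = complex_of_real (\<delta> * sqrt (2 * pi)) * (\<integral>t. complex_of_real (gauss_weight \<delta> t) * iexp (- (v * t)) \<partial>lborel)"
    using assms by (subst integral_mult_right_zero) (simp add: scaleR_conv_of_real)
  finally have "(\<integral>t. complex_of_real (gauss_weight \<delta> t) * iexp (- (v * t)) \<partial>lborel)
      = complex_of_real (exp (- ((- (v / \<delta>))\<^sup>2) / 2) / (\<delta> * sqrt (2 * pi)))"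
    using assms by (simp add: field_simps)
  also have "exp (- ((- (v / \<delta>))\<^sup>2) / 2) / (\<delta> * sqrt (2 * pi)) = normal_density 0 \<delta> v"
    using assms by (simp add: normal_density_def real_sqrt_mult power_divide field_simps)
  finally show ?thesis by simp
qed

text \<open>
  A finite Borel measure whose Laplace transform exists on the line \<open>Re z = \<theta>\<close>.
\<close>

locale laplace_measure = finite_measure G for G :: "real measure" +
  fixes \<theta> :: real
  assumes sets_G [measurable_cong, simp]: "sets G = sets borel"
    and exp_integrable: "integrable G (\<lambda>s. exp (\<theta> * s))"
begin

lemma space_G [simp]: "space G = UNIV"
  using sets_eq_imp_space_eq[OF sets_G] by simp

sublocale pair_sigma_finite lborel G ..

text \<open>
  The density of the measure \<open>exp (\<theta> * s) dG s\<close> convolved with a centred normal law. It is recovered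
  from the Laplace transform of \<open>G\<close> by Fourier inversion, which is elementary here because the
  normal density is itself a Fourier integral.
\<close>

definition smooth_density :: "real \<Rightarrow> real \<Rightarrow> real" where
  "smooth_density \<delta> w = (\<integral>s. exp (\<theta> * s) * normal_density 0 \<delta> (w - s) \<partial>G)"

lemma complex_exp_integrable:
  "integrable G (\<lambda>s. exp ((complex_of_real \<theta> + \<i> * complex_of_real t) * complex_of_real s))"
  by (rule Bochner_Integration.integrable_bound[OF exp_integrable]) auto

lemma exp_split: "exp ((complex_of_real \<theta> + \<i> * complex_of_real t) * complex_of_real s)
   = complex_of_real (exp (\<theta> * s)) * iexp (t * s)"
proof -
  have "(complex_of_real \<theta> + \<i> * complex_of_real t) * complex_of_real s = complex_of_real (\<theta> * s) + \<i> * (t * s)"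
    by (simp add: algebra_simps)
  then show ?thesis by (simp only: exp_add exp_of_real)
qed

lemma
  assumes "\<delta> > 0"
  shows smooth_density_integrable: "integrable lborel (\<lambda>t. complex_of_real (gauss_weight \<delta> t) * iexp (- (w * t)) * laplace G (\<theta> + \<i> * t))" (is ?A)
    and smooth_density_eq: "complex_of_real (smooth_density \<delta> w)
      = (\<integral>t. complex_of_real (gauss_weight \<delta> t) * iexp (- (w * t)) * laplace G (\<theta> + \<i> * t) \<partial>lborel)" (is ?B)
proof -
  let ?f = "\<lambda>t s. complex_of_real (gauss_weight \<delta> t) * iexp (- (w * t)) * exp ((complex_of_real \<theta> + \<i> * complex_of_real t) * complex_of_real s)"
  have int: "integrable (lborel \<Otimes>\<^sub>M G) (case_prod ?f)"
  proof (rule Fubini_integrable)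
    show "case_prod ?f \<in> borel_measurable (lborel \<Otimes>\<^sub>M G)" by measurable
    have "(\<integral>s. norm (case_prod ?f (t, s)) \<partial>G) = gauss_weight \<delta> t * (\<integral>s. exp (\<theta> * s) \<partial>G)" for t
      by (simp add: norm_mult)
    then show "integrable lborel (\<lambda>t. \<integral>s. norm (case_prod ?f (t, s)) \<partial>G)"
      using gauss_weight_integrable[OF assms] by simp
    show "AE t in lborel. integrable G (\<lambda>s. case_prod ?f (t, s))"
      using complex_exp_integrable by auto
  qed
  have eq: "(\<integral>s. ?f t s \<partial>G) = complex_of_real (gauss_weight \<delta> t) * iexp (- (w * t)) * laplace G (\<theta> + \<i> * t)" for t
    unfolding laplace_def by simp
  show ?A using integrable_fst'[OF int] by (simp add: laplace_def)
  have "(\<integral>t. complex_of_real (gauss_weight \<delta> t) * iexp (- (w * t)) * laplace G (\<theta> + \<i> * t) \<partial>lborel) = (\<integral>t. (\<integral>s. ?f t s \<partial>G) \<partial>lborel)"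
    by (simp only: eq)
  also have "\<dots> = (\<integral>s. (\<integral>t. ?f t s \<partial>lborel) \<partial>G)" by (rule Fubini_integral[OF int, symmetric])
  also have "\<dots> = (\<integral>s. complex_of_real (exp (\<theta> * s) * normal_density 0 \<delta> (w - s)) \<partial>G)"
  proof (rule Bochner_Integration.integral_cong[OF refl])
    fix s
    have "(\<integral>t. ?f t s \<partial>lborel) = (\<integral>t. complex_of_real (exp (\<theta> * s)) * (complex_of_real (gauss_weight \<delta> t) * iexp (- ((w - s) * t))) \<partial>lborel)"
    proof (rule Bochner_Integration.integral_cong[OF refl])
      fix t :: real
      have "iexp (- (w * t)) * iexp (t * s) = iexp (- ((w - s) * t))"
        unfolding exp_add[symmetric] by (simp add: algebra_simps)
      then show "?f t s = complex_of_real (exp (\<theta> * s)) * (complex_of_real (gauss_weight \<delta> t) * iexp (- ((w - s) * t)))"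
        unfolding exp_split by (simp only: mult_ac)
    qed
    also have "\<dots> = complex_of_real (exp (\<theta> * s)) * (\<integral>t. complex_of_real (gauss_weight \<delta> t) * iexp (- ((w - s) * t)) \<partial>lborel)"
      by (rule integral_mult_right_zero)
    finally show "(\<integral>t. ?f t s \<partial>lborel) = complex_of_real (exp (\<theta> * s) * normal_density 0 \<delta> (w - s))"
      by (simp only: normal_density_fourier[OF assms, symmetric] of_real_mult)
  qed
  also have "\<dots> = complex_of_real (smooth_density \<delta> w)"
    unfolding smooth_density_def by (rule integral_complex_of_real)
  finally show ?B by simp
qed

lemma
  assumes "\<delta> > 0"
  shows smooth_tail_measurable [measurable]: "smooth_tail \<theta> \<delta> y \<in> borel_measurable borel"
    and smooth_tail_integrable: "integrable G (smooth_tail \<theta> \<delta> y)"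
    and integral_smooth_tail_integrable: "integrable lborel (\<lambda>w. indicator {y<..} w * (exp (- \<theta> * w) * smooth_density \<delta> w))"
    and integral_smooth_tail: "(\<integral>s. smooth_tail \<theta> \<delta> y s \<partial>G)
      = (\<integral>w. indicator {y<..} w * (exp (- \<theta> * w) * smooth_density \<delta> w) \<partial>lborel)"
proof -
  let ?f = "\<lambda>w s. indicator {y<..} w * (exp (\<theta> * (s - w)) * normal_density 0 \<delta> (w - s))"
  show m [measurable]: "smooth_tail \<theta> \<delta> y \<in> borel_measurable borel"
    unfolding smooth_tail_def[abs_def] normal_density_def by measurable
  show i: "integrable G (smooth_tail \<theta> \<delta> y)"
    by (rule integrable_const_bound[where B="exp (\<theta>\<^sup>2 * \<delta>\<^sup>2 / 2)"])
       (use smooth_tail_nonneg smooth_tail_le[OF assms] m in auto)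
  have GL: "pair_sigma_finite G lborel" ..
  have int: "integrable (G \<Otimes>\<^sub>M lborel) (\<lambda>(s, w). ?f w s)"
  proof (rule pair_sigma_finite.Fubini_integrable[OF GL])
    show "(\<lambda>(s, w). ?f w s) \<in> borel_measurable (G \<Otimes>\<^sub>M lborel)"
      unfolding normal_density_def by measurable
    show "integrable G (\<lambda>s. \<integral>w. norm (case (s, w) of (s, w) \<Rightarrow> ?f w s) \<partial>lborel)"
      using i by (simp add: smooth_tail_def[abs_def])
    show "AE s in G. integrable lborel (\<lambda>w. case (s, w) of (s, w) \<Rightarrow> ?f w s)"
      using integrable_smooth[OF assms] by auto
  qed
  then have int': "integrable (lborel \<Otimes>\<^sub>M G) (\<lambda>(w, s). ?f w s)"
    using pair_sigma_finite.integrable_product_swap[OF GL int] by simp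
  have eq: "(\<integral>s. ?f w s \<partial>G) = indicator {y<..} w * (exp (- \<theta> * w) * smooth_density \<delta> w)" for w
  proof -
    have "?f w s = (indicator {y<..} w * exp (- \<theta> * w)) * (exp (\<theta> * s) * normal_density 0 \<delta> (w - s))" for s
    proof -
      have "exp (\<theta> * (s - w)) = exp (- \<theta> * w) * exp (\<theta> * s)"
        unfolding exp_add[symmetric] by (simp add: algebra_simps)
      then show ?thesis by (simp only: mult_ac)
    qed
    then have "(\<integral>s. ?f w s \<partial>G) = (\<integral>s. (indicator {y<..} w * exp (- \<theta> * w)) * (exp (\<theta> * s) * normal_density 0 \<delta> (w - s)) \<partial>G)"
      by (intro Bochner_Integration.integral_cong) auto
    also have "\<dots> = (indicator {y<..} w * exp (- \<theta> * w)) * smooth_density \<delta> w"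
      unfolding smooth_density_def by (rule integral_mult_right_zero)
    finally show ?thesis by (simp only: mult.assoc)
  qed
  show "integrable lborel (\<lambda>w. indicator {y<..} w * (exp (- \<theta> * w) * smooth_density \<delta> w))"
    using integrable_fst'[OF int'] by (simp only: prod.case eq)
  show "(\<integral>s. smooth_tail \<theta> \<delta> y s \<partial>G)
      = (\<integral>w. indicator {y<..} w * (exp (- \<theta> * w) * smooth_density \<delta> w) \<partial>lborel)"
    unfolding smooth_tail_def using Fubini_integral[OF int'] by (simp only: eq)
qed

end

lemma integral_exp_tail:
  fixes \<theta> y :: real
  assumes "\<theta> > 0"
  shows "integrable lborel (\<lambda>w. indicator {y<..} w * exp (- \<theta> * w))"
    and "(\<integral>w. indicator {y<..} w * exp (- \<theta> * w) \<partial>lborel) = exp (- \<theta> * y) / \<theta>"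
proof -
  have eq: "AE w in lborel. exp (- \<theta> * y) / \<theta> * exponential_density \<theta> (w - y) = indicator {y<..} w * exp (- \<theta> * w)"
    using AE_lborel_singleton[of y]
  proof eventually_elim
    case (elim w)
    have "exp (- \<theta> * y) * exp (- (w - y) * \<theta>) = exp (- \<theta> * w)"
      unfolding exp_add[symmetric] by (simp add: algebra_simps)
    then show ?case using elim assms by (auto simp: exponential_density_def indicator_def)
  qed
  have i: "integrable lborel (\<lambda>w. exp (- \<theta> * y) / \<theta> * exponential_density \<theta> (w - y))"
    using integrable_exponential_density[OF assms] by (intro integrable_mult_right integrable_shift)
  show "integrable lborel (\<lambda>w. indicator {y<..} w * exp (- \<theta> * w))"
    using i integrable_cong_AE[OF _ _ eq] by simp
  have "(\<integral>w. indicator {y<..} w * exp (- \<theta> * w) \<partial>lborel) = (\<integral>w. exp (- \<theta> * y) / \<theta> * exponential_density \<theta> (w - y) \<partial>lborel)"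
    by (rule integral_cong_AE) (use eq in \<open>auto elim: eventually_mono\<close>)
  also have "\<dots> = exp (- \<theta> * y) / \<theta> * (\<integral>w. exponential_density \<theta> (w - y) \<partial>lborel)"
    by (rule integral_mult_right_zero)
  also have "(\<integral>w. exponential_density \<theta> (w - y) \<partial>lborel) = 1"
    using lborel_integral_real_affine[of 1 "exponential_density \<theta>" "- y"] integral_exponential_density[OF assms] by simp
  finally show "(\<integral>w. indicator {y<..} w * exp (- \<theta> * w) \<partial>lborel) = exp (- \<theta> * y) / \<theta>" by simp
qed

text \<open>
  Two measures whose Laplace transforms are close on the line \<open>Re z = \<theta>\<close> have close smoothed densities,
  uniformly, and hence close smoothed tails beyond \<open>y\<close>, with a gain of the factor \<open>exp (- \<theta> * y) / \<theta>\<close>.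
\<close>

lemma smooth_tail_comparison:
  fixes B :: "real \<Rightarrow> real"
  assumes G: "laplace_measure G \<theta>" and H: "laplace_measure H \<theta>" and "\<delta> > 0" "\<theta> > 0"
    and B: "integrable lborel B"
    and le: "\<And>t. gauss_weight \<delta> t * norm (laplace G (\<theta> + \<i> * t) - laplace H (\<theta> + \<i> * t)) \<le> B t"
  shows "\<bar>(\<integral>s. smooth_tail \<theta> \<delta> y s \<partial>G) - (\<integral>s. smooth_tail \<theta> \<delta> y s \<partial>H)\<bar> \<le> (\<integral>t. B t \<partial>lborel) * (exp (- \<theta> * y) / \<theta>)"
proof -
  interpret G: laplace_measure G \<theta> by fact
  interpret H: laplace_measure H \<theta> by fact
  let ?g = "\<lambda>G t w. complex_of_real (gauss_weight \<delta> t) * iexp (- (w * t)) * laplace G (\<theta> + \<i> * complex_of_real t)"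
  have dens: "\<bar>G.smooth_density \<delta> w - H.smooth_density \<delta> w\<bar> \<le> (\<integral>t. B t \<partial>lborel)" for w
  proof -
    have "\<bar>G.smooth_density \<delta> w - H.smooth_density \<delta> w\<bar> = norm (complex_of_real (G.smooth_density \<delta> w) - complex_of_real (H.smooth_density \<delta> w))"
      by (metis norm_of_real of_real_diff)
    also have "\<dots> = norm (\<integral>t. ?g G t w - ?g H t w \<partial>lborel)"
      unfolding G.smooth_density_eq[OF \<open>\<delta> > 0\<close>] H.smooth_density_eq[OF \<open>\<delta> > 0\<close>]
      by (subst Bochner_Integration.integral_diff)
        (auto simp only: intro!: G.smooth_density_integrable[OF \<open>\<delta> > 0\<close>] H.smooth_density_integrable[OF \<open>\<delta> > 0\<close>])
    also have "\<dots> \<le> (\<integral>t. B t \<partial>lborel)"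
    proof (rule Bochner_Integration.integral_norm_bound_integral)
      show "integrable lborel (\<lambda>t. ?g G t w - ?g H t w)"
        by (intro Bochner_Integration.integrable_diff G.smooth_density_integrable[OF \<open>\<delta> > 0\<close>] H.smooth_density_integrable[OF \<open>\<delta> > 0\<close>])
      fix t
      have "norm (?g G t w - ?g H t w) = gauss_weight \<delta> t * norm (laplace G (\<theta> + \<i> * t) - laplace H (\<theta> + \<i> * t))"
        unfolding right_diff_distrib[symmetric] norm_mult by simp
      then show "norm (?g G t w - ?g H t w) \<le> B t" using le[of t] by simp
    qed (rule B)
    finally show ?thesis .
  qed
  let ?e = "\<lambda>w. indicator {y<..} w * exp (- \<theta> * w)"
  have "\<bar>(\<integral>s. smooth_tail \<theta> \<delta> y s \<partial>G) - (\<integral>s. smooth_tail \<theta> \<delta> y s \<partial>H)\<bar>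
     = norm (\<integral>w. ?e w * (G.smooth_density \<delta> w - H.smooth_density \<delta> w) \<partial>lborel)"
    unfolding G.integral_smooth_tail[OF \<open>\<delta> > 0\<close>] H.integral_smooth_tail[OF \<open>\<delta> > 0\<close>]
      Bochner_Integration.integral_diff[OF G.integral_smooth_tail_integrable[OF \<open>\<delta> > 0\<close>] H.integral_smooth_tail_integrable[OF \<open>\<delta> > 0\<close>], symmetric]
    by (auto simp: algebra_simps intro!: arg_cong[where f=abs] Bochner_Integration.integral_cong)
  also have "\<dots> \<le> (\<integral>w. ?e w * (\<integral>t. B t \<partial>lborel) \<partial>lborel)"
  proof (rule Bochner_Integration.integral_norm_bound_integral)
    show "integrable lborel (\<lambda>w. ?e w * (G.smooth_density \<delta> w - H.smooth_density \<delta> w))"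
      using Bochner_Integration.integrable_diff[OF G.integral_smooth_tail_integrable[OF \<open>\<delta> > 0\<close>, of y] H.integral_smooth_tail_integrable[OF \<open>\<delta> > 0\<close>, of y]]
      by (simp add: algebra_simps)
    show "integrable lborel (\<lambda>w. ?e w * (\<integral>t. B t \<partial>lborel))"
      using integral_exp_tail[OF \<open>\<theta> > 0\<close>] by (intro integrable_mult_left)
    show "norm (?e w * (G.smooth_density \<delta> w - H.smooth_density \<delta> w)) \<le> ?e w * (\<integral>t. B t \<partial>lborel)" for w
      using dens[of w] unfolding norm_mult by (auto intro!: mult_mono)
  qed
  also have "\<dots> = (\<integral>t. B t \<partial>lborel) * (exp (- \<theta> * y) / \<theta>)"
    using integral_exp_tail[OF \<open>\<theta> > 0\<close>, of y] by simp
  finally show ?thesis .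
qed

lemma laplace_measure_std_normal: "laplace_measure std_normal_distribution \<theta>"
proof -
  interpret prob_space std_normal_distribution by (rule prob_space_std_normal)
  show ?thesis by unfold_locales (auto intro: integrable_exp_std_normal)
qed

section \<open>The Laplace transform of a truncated distribution\<close>

lemma norm_power_diff_le:
  fixes z w :: complex
  assumes "norm z \<le> M" "norm w \<le> M" "M > 0"
  shows "norm (z ^ n - w ^ n) \<le> real n * norm (z - w) * M ^ n / M"
proof -
  let ?z = "z / complex_of_real M" and ?w = "w / complex_of_real M"
  have "norm (?z ^ n - ?w ^ n) \<le> real n * norm (?z - ?w)"
    using assms by (intro norm_power_diff) (auto simp: norm_divide)
  moreover have "?z ^ n - ?w ^ n = (z ^ n - w ^ n) / complex_of_real M ^ n"
    by (simp add: power_divide diff_divide_distrib)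
  moreover have "?z - ?w = (z - w) / complex_of_real M" by (simp add: diff_divide_distrib)
  ultimately have "norm (z ^ n - w ^ n) / M ^ n \<le> real n * (norm (z - w) / M)"
    using assms by (simp add: norm_divide norm_power)
  then show ?thesis using assms by (simp add: field_simps)
qed

text \<open>
  If \<open>m\<close> is close to \<open>exp (z\<^sup>2 / 2)\<close> at \<open>z = (\<theta> + \<i> * t) / sqrt n\<close>, then the \<open>n\<close>-th powers are close, with a
  bound that decays like a Gaussian in \<open>t\<close>. The restriction on \<open>t\<close> lets the cubic error be absorbed
  into the quadratic exponent.
\<close>

lemma power_close_to_gaussian:
  fixes m :: complex and \<theta> t K :: real
  assumes n: "n \<ge> 1" and \<theta>: "\<theta> \<ge> 1" and K: "K \<ge> 1"
    and close: "norm (m - exp (((\<theta> + \<i> * t) / sqrt n)\<^sup>2 / 2)) \<le> K * (\<theta> + \<bar>t\<bar>) ^ 3 / (n * sqrt n)"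
    and t: "\<bar>t\<bar> \<le> sqrt n / (64 * K)" and small: "16 * K * \<theta> ^ 3 \<le> sqrt n"
  shows "norm (m ^ n - exp ((\<theta> + \<i> * t)\<^sup>2 / 2)) \<le> 6 * K * \<theta> ^ 3 / sqrt n * ((1 + \<bar>t\<bar>) ^ 3 * exp (\<theta>\<^sup>2 / 2 - t\<^sup>2 / 4))"
proof -
  define r where "r = sqrt (real n)"
  have r: "r \<ge> 1" "r\<^sup>2 = real n" using n by (auto simp: r_def)
  define z where "z = (\<theta> + \<i> * t) / sqrt n"
  define E where "E = K * (\<theta> + \<bar>t\<bar>) ^ 3 / (n * r)"
  define a where "a = (\<theta>\<^sup>2 - t\<^sup>2) / (2 * n)"
  \<comment> \<open>A common bound for both bases; its \<open>n\<close>-th power costs only a constant factor and half of the Gaussian decay.\<close>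
  define M where "M = exp (a + 2 * E)"
  have E0: "E \<ge> 0" unfolding E_def using K \<theta> r by simp
  have z2: "z\<^sup>2 = (\<theta> + \<i> * t)\<^sup>2 / n"
    unfolding z_def power_divide using n by (simp flip: of_real_power)
  have Rez: "Re (z\<^sup>2 / 2) = a"
  proof -
    have "(\<theta> + \<i> * t)\<^sup>2 = complex_of_real (\<theta>\<^sup>2 - t\<^sup>2) + \<i> * complex_of_real (2 * \<theta> * t)"
      by (simp add: power2_eq_square algebra_simps)
    then have "Re ((\<theta> + \<i> * t)\<^sup>2) = \<theta>\<^sup>2 - t\<^sup>2" by simp
    then show ?thesis unfolding z2 a_def by (simp only: Re_divide_of_nat Re_divide_numeral) simp
  qed
  have ne: "norm (exp (z\<^sup>2 / 2)) = exp a" by (simp only: norm_exp_eq_Re Rez)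
  have tr: "\<bar>t\<bar> \<le> r / 64"
  proof -
    have "r / (64 * K) \<le> r / 64" using K r by (intro divide_left_mono) auto
    then show ?thesis using t r_def by simp
  qed
  have "t\<^sup>2 \<le> (r / 64)\<^sup>2" using tr by (metis abs_le_square_iff abs_of_nonneg abs_ge_zero order_trans)
  then have tn: "t\<^sup>2 / (2 * n) \<le> 1 / 8" using r n by (simp add: power_divide field_simps)
  have "- (1/8) \<le> a"
  proof -
    have "- (t\<^sup>2 / (2 * n)) \<le> a" unfolding a_def using n by (simp add: field_simps)
    then show ?thesis using tn by simp
  qed
  then have ea: "exp a \<ge> 1 / 2" using exp_ge_add_one_self[of a] by linarith
  have close': "norm (m - exp (z\<^sup>2 / 2)) \<le> E" using close unfolding z_def E_def r_def .
  have M1: "norm (exp (z\<^sup>2 / 2)) \<le> M" unfolding ne M_def using E0 by simp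
  have "norm m \<le> norm (exp (z\<^sup>2 / 2)) + norm (m - exp (z\<^sup>2 / 2))"
    by (metis norm_triangle_sub)
  also have "\<dots> \<le> exp a + E" using close' ne by simp
  also have "\<dots> \<le> exp a * (1 + 2 * E)" using mult_right_mono[OF ea, of E] E0 by (simp add: algebra_simps)
  also have "\<dots> \<le> exp a * exp (2 * E)" by (intro mult_left_mono exp_ge_add_one_self) auto
  finally have M2: "norm m \<le> M" by (simp add: M_def exp_add)
  have Mpos: "M > 0" by (simp add: M_def)
  have "exp a \<le> M" unfolding M_def using E0 by simp
  then have Mhalf: "1 / 2 \<le> M" using ea by linarith
  have nE: "n * E = K * (\<theta> + \<bar>t\<bar>) ^ 3 / r" unfolding E_def using n by simp
  have cube: "(\<theta> + \<bar>t\<bar>) ^ 3 \<le> 4 * (\<theta> ^ 3 + \<bar>t\<bar> ^ 3)"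
  proof -
    have "0 \<le> 3 * (\<theta> + \<bar>t\<bar>) * (\<theta> - \<bar>t\<bar>)\<^sup>2" using \<theta> by simp
    also have "\<dots> = 4 * (\<theta> ^ 3 + \<bar>t\<bar> ^ 3) - (\<theta> + \<bar>t\<bar>) ^ 3"
      by (simp add: power2_eq_square power3_eq_cube algebra_simps)
    finally show ?thesis by simp
  qed
  have nE2: "2 * (n * E) \<le> 1 / 2 + t\<^sup>2 / 8"
  proof -
    have "2 * (n * E) \<le> 2 * (K * (4 * (\<theta> ^ 3 + \<bar>t\<bar> ^ 3)) / r)"
      unfolding nE using cube K r by (intro mult_left_mono divide_right_mono) auto
    also have "\<dots> = 8 * K * \<theta> ^ 3 / r + 8 * K * \<bar>t\<bar> * t\<^sup>2 / r"
      by (simp add: power2_eq_square power3_eq_cube algebra_simps add_divide_distrib abs_mult_self_eq)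
    also have "8 * K * \<theta> ^ 3 / r \<le> 1 / 2" using small r by (simp add: r_def[symmetric] field_simps)
    also have "8 * K * \<bar>t\<bar> * t\<^sup>2 / r \<le> t\<^sup>2 / 8"
    proof -
      have "64 * K * \<bar>t\<bar> \<le> r" using t K by (simp add: r_def[symmetric] field_simps)
      then have "8 * K * \<bar>t\<bar> / r \<le> 1 / 8" using r by (simp add: field_simps)
      then have "8 * K * \<bar>t\<bar> / r * t\<^sup>2 \<le> 1 / 8 * t\<^sup>2" by (intro mult_right_mono) auto
      then show ?thesis by simp
    qed
    finally show ?thesis by simp
  qed
  have Mn: "M ^ n \<le> 3 * exp (\<theta>\<^sup>2 / 2 - t\<^sup>2 / 4)"
  proof -
    have "M ^ n = exp (n * (a + 2 * E))" unfolding M_def by (rule exp_of_nat_mult[symmetric])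
    also have "n * (a + 2 * E) = \<theta>\<^sup>2 / 2 - t\<^sup>2 / 2 + 2 * (n * E)"
      unfolding a_def using n by (simp add: field_simps)
    also have "exp \<dots> \<le> exp (1 + (\<theta>\<^sup>2 / 2 - t\<^sup>2 / 4))" using nE2 zero_le_power2[of t] by (simp only: exp_le_cancel_iff)
    also have "\<dots> = exp 1 * exp (\<theta>\<^sup>2 / 2 - t\<^sup>2 / 4)" by (rule exp_add)
    also have "\<dots> \<le> 3 * exp (\<theta>\<^sup>2 / 2 - t\<^sup>2 / 4)" using exp_le by (intro mult_right_mono) auto
    finally show ?thesis .
  qed
  have "exp ((\<theta> + \<i> * t)\<^sup>2 / 2) = exp (z\<^sup>2 / 2) ^ n"
    unfolding z2 exp_of_nat_mult[symmetric] using n by simp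
  then have "norm (m ^ n - exp ((\<theta> + \<i> * t)\<^sup>2 / 2)) = norm (m ^ n - exp (z\<^sup>2 / 2) ^ n)" by simp
  also have "\<dots> \<le> real n * norm (m - exp (z\<^sup>2 / 2)) * M ^ n / M"
    by (rule norm_power_diff_le[OF M2 M1 Mpos])
  also have "\<dots> \<le> real n * E * M ^ n / (1 / 2)"
    using Mhalf Mpos close' E0 by (intro frac_le mult_right_mono mult_left_mono mult_nonneg_nonneg) auto
  also have "\<dots> = 2 * (n * E) * M ^ n" by simp
  also have "\<dots> \<le> 2 * (n * E) * (3 * exp (\<theta>\<^sup>2 / 2 - t\<^sup>2 / 4))"
    using Mn E0 by (intro mult_left_mono) auto
  also have "\<dots> = 6 * K / r * ((\<theta> + \<bar>t\<bar>) ^ 3 * exp (\<theta>\<^sup>2 / 2 - t\<^sup>2 / 4))"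
    unfolding nE by simp
  also have "\<dots> \<le> 6 * K / r * ((\<theta> * (1 + \<bar>t\<bar>)) ^ 3 * exp (\<theta>\<^sup>2 / 2 - t\<^sup>2 / 4))"
  proof -
    have "\<theta> + \<bar>t\<bar> \<le> \<theta> * (1 + \<bar>t\<bar>)" using \<theta> mult_right_mono[of 1 \<theta> "\<bar>t\<bar>"] by (simp add: algebra_simps)
    then have "(\<theta> + \<bar>t\<bar>) ^ 3 \<le> (\<theta> * (1 + \<bar>t\<bar>)) ^ 3" using \<theta> by (intro power_mono) auto
    then show ?thesis using K r by (intro mult_left_mono mult_right_mono) auto
  qed
  also have "\<dots> = 6 * K * \<theta> ^ 3 / r * ((1 + \<bar>t\<bar>) ^ 3 * exp (\<theta>\<^sup>2 / 2 - t\<^sup>2 / 4))"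
    by (simp add: power_mult_distrib)
  finally show ?thesis by (simp add: r_def)
qed

text \<open>
  A probability distribution on the real line with mean \<open>0\<close> and variance \<open>1\<close>.
\<close>

locale standardized_distribution = real_distribution F for F :: "real measure" +
  assumes mean_integrable: "integrable F (\<lambda>x. x)" and mean_zero: "(\<integral>x. x \<partial>F) = 0"
    and var_integrable: "integrable F (\<lambda>x. x\<^sup>2)" and var_one: "(\<integral>x. x\<^sup>2 \<partial>F) = 1"
begin

text \<open>
  The Laplace transform of the restriction of \<open>F\<close> to \<open>{-b..b}\<close>. The restriction is not normalized, so
  it is a subprobability.
\<close>

definition trunc_laplace :: "real \<Rightarrow> complex \<Rightarrow> complex" where
  "trunc_laplace b z = (\<integral>x. indicator {-b..b} x *\<^sub>R exp (z * complex_of_real x) \<partial>F)"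

lemma integrable_trunc_exp: "integrable F (\<lambda>x. indicator {-b..b} x *\<^sub>R exp (z * complex_of_real x))"
proof (rule integrable_const_bound[where B="exp (norm z * \<bar>b\<bar>)"])
  show "AE x in F. norm (indicator {-b..b} x *\<^sub>R exp (z * complex_of_real x)) \<le> exp (norm z * \<bar>b\<bar>)"
  proof (rule AE_I2)
    fix x
    show "norm (indicator {-b..b} x *\<^sub>R exp (z * complex_of_real x)) \<le> exp (norm z * \<bar>b\<bar>)"
    proof (cases "x \<in> {-b..b}")
      case True
      have "norm (exp (z * complex_of_real x)) \<le> exp (norm (z * complex_of_real x))" by (rule norm_exp)
      also have "\<dots> \<le> exp (norm z * \<bar>b\<bar>)" using True by (auto simp: norm_mult intro!: mult_left_mono)
      finally show ?thesis using True by simp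
    qed auto
  qed
qed measurable

lemma integrable_trunc_bounded:
  fixes f :: "real \<Rightarrow> real"
  assumes [measurable]: "f \<in> borel_measurable borel" and "\<And>x. x \<in> {-b..b} \<Longrightarrow> \<bar>f x\<bar> \<le> B"
  shows "integrable F (\<lambda>x. indicator {-b..b} x * f x)"
proof (rule integrable_const_bound[where B="max B 0"])
  show "AE x in F. norm (indicator {-b..b} x * f x) \<le> max B 0"
    using assms(2) by (intro AE_I2) (auto simp: indicator_def le_max_iff_disj)
qed measurable

text \<open>
  On the truncation interval the exponential is replaced by its second-order Taylor polynomial, whose
  full integral is \<open>1 + z\<^sup>2 / 2\<close>; outside the polynomial itself is the error.
\<close>

lemma trunc_laplace_taylor:
  assumes z: "norm z \<le> 1"
    and C: "(\<integral>x. indicator {-b..b} x * (\<bar>x\<bar> ^ 3 * exp (\<bar>Re z\<bar> * \<bar>x\<bar>)) \<partial>F) \<le> C"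
    and \<tau>: "(\<integral>x. indicator (- {-b..b}) x * (1 + \<bar>x\<bar> + x\<^sup>2) \<partial>F) \<le> \<tau>"
  shows "norm (trunc_laplace b z - (1 + z\<^sup>2 / 2)) \<le> C * norm z ^ 3 + \<tau>"
proof -
  let ?p = "\<lambda>x. 1 + z * complex_of_real x + z\<^sup>2 / 2 * complex_of_real (x\<^sup>2)"
  let ?f = "\<lambda>x. indicator {-b..b} x *\<^sub>R exp (z * complex_of_real x) - ?p x"
  let ?g1 = "\<lambda>x. indicator {-b..b} x * (\<bar>x\<bar> ^ 3 * exp (\<bar>Re z\<bar> * \<bar>x\<bar>))"
  let ?g2 = "\<lambda>x. indicator (- {-b..b}) x * (1 + \<bar>x\<bar> + x\<^sup>2)"
  have ip: "integrable F ?p"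
    using mean_integrable var_integrable by (intro Bochner_Integration.integrable_add integrable_mult_right integrable_of_real) auto
  have g1: "integrable F ?g1"
    by (rule integrable_trunc_bounded[where B="\<bar>b\<bar> ^ 3 * exp (\<bar>Re z\<bar> * \<bar>b\<bar>)"])
      (auto simp: abs_mult intro!: mult_mono power_mono mult_left_mono)
  have g2: "integrable F ?g2"
  proof (rule Bochner_Integration.integrable_bound)
    show "integrable F (\<lambda>x. 1 + \<bar>x\<bar> + x\<^sup>2)"
      using mean_integrable var_integrable by (intro Bochner_Integration.integrable_add integrable_abs) auto
  qed (auto simp: indicator_def)
  have "(\<integral>x. ?p x \<partial>F) = 1 + z\<^sup>2 / 2"
    using mean_integrable var_integrable prob_space
    by (simp add: mean_zero var_one Bochner_Integration.integral_add integrable_of_real del: of_real_power)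
  then have eq: "trunc_laplace b z - (1 + z\<^sup>2 / 2) = (\<integral>x. ?f x \<partial>F)"
    unfolding trunc_laplace_def using Bochner_Integration.integral_diff[OF integrable_trunc_exp ip] by simp
  have "norm (\<integral>x. ?f x \<partial>F) \<le> (\<integral>x. norm z ^ 3 * ?g1 x + ?g2 x \<partial>F)"
  proof (rule Bochner_Integration.integral_norm_bound_integral)
    show "integrable F ?f" by (intro Bochner_Integration.integrable_diff integrable_trunc_exp ip)
    show "integrable F (\<lambda>x. norm z ^ 3 * ?g1 x + ?g2 x)"
      by (intro Bochner_Integration.integrable_add integrable_mult_right g1 g2)
    fix x
    show "norm (?f x) \<le> norm z ^ 3 * ?g1 x + ?g2 x"
    proof (cases "x \<in> {-b..b}")
      case True
      have s: "(\<Sum>k\<le>2. (z * complex_of_real x) ^ k / fact k) = ?p x"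
        by (simp add: eval_nat_numeral field_simps)
      have "norm (exp (z * complex_of_real x) - ?p x) \<le> exp \<bar>Re (z * complex_of_real x)\<bar> * norm (z * complex_of_real x) ^ Suc 2 / fact 2"
        using Taylor_exp[of "z * complex_of_real x" 2] unfolding s .
      also have "\<dots> \<le> exp \<bar>Re (z * complex_of_real x)\<bar> * norm (z * complex_of_real x) ^ 3"
        by (simp add: eval_nat_numeral)
      also have "\<dots> = norm z ^ 3 * (\<bar>x\<bar> ^ 3 * exp (\<bar>Re z\<bar> * \<bar>x\<bar>))"
        by (simp add: norm_mult power_mult_distrib abs_mult)
      finally show ?thesis using True by simp
    next
      case False
      have "norm (?p x) \<le> norm (1 + z * complex_of_real x) + norm (z\<^sup>2 / 2 * complex_of_real (x\<^sup>2))" by (rule norm_triangle_ineq)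
      also have "norm (1 + z * complex_of_real x) \<le> 1 + norm z * \<bar>x\<bar>"
        using norm_triangle_ineq[of 1 "z * complex_of_real x"] by (simp add: norm_mult)
      also have "norm (z\<^sup>2 / 2 * complex_of_real (x\<^sup>2)) = norm z ^ 2 / 2 * x\<^sup>2"
        by (simp add: norm_mult norm_divide norm_power)
      also have "norm z * \<bar>x\<bar> \<le> \<bar>x\<bar>" using z by (intro mult_left_le_one_le) auto
      also have "norm z ^ 2 / 2 * x\<^sup>2 \<le> 1 * x\<^sup>2"
        using z power_mono[of "norm z" 1 2] by (intro mult_right_mono) auto
      finally have n1: "norm (?p x) \<le> 1 + \<bar>x\<bar> + 1 * x\<^sup>2" by simp
      have i: "indicator {-b..b} x = (0::real)" "indicator (- {-b..b}) x = (1::real)"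
        using False by auto
      have n2: "norm (?f x) = norm (?p x)"
        by (simp only: i scaleR_zero_left diff_0 norm_minus_cancel)
      have n3: "norm z ^ 3 * ?g1 x + ?g2 x = 1 + \<bar>x\<bar> + 1 * x\<^sup>2"
        by (simp only: i mult_zero_left mult_zero_right add_0 mult_1)
      show ?thesis unfolding n2 n3 by (rule n1)
    qed
  qed
  also have "\<dots> = norm z ^ 3 * (\<integral>x. ?g1 x \<partial>F) + (\<integral>x. ?g2 x \<partial>F)"
    unfolding integral_mult_right_zero[symmetric]
    by (intro Bochner_Integration.integral_add integrable_mult_right g1 g2)
  also have "\<dots> \<le> norm z ^ 3 * C + \<tau>" using C \<tau> by (intro add_mono mult_left_mono) auto
  finally show ?thesis unfolding eq by (simp only: mult.commute)
qed

lemma trunc_laplace_gaussian: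
  assumes z: "norm z \<le> 1"
    and C: "(\<integral>x. indicator {-b..b} x * (\<bar>x\<bar> ^ 3 * exp (\<bar>Re z\<bar> * \<bar>x\<bar>)) \<partial>F) \<le> C"
    and \<tau>: "(\<integral>x. indicator (- {-b..b}) x * (1 + \<bar>x\<bar> + x\<^sup>2) \<partial>F) \<le> \<tau>"
  shows "norm (trunc_laplace b z - exp (z\<^sup>2 / 2)) \<le> (C + 1) * norm z ^ 3 + \<tau>"
proof -
  define u where "u = z\<^sup>2 / 2"
  have nu: "norm u = norm z ^ 2 / 2" by (simp add: u_def norm_divide norm_power)
  have u1: "norm u \<le> 1 / 2" using nu power_mono[OF z, of 2] by simp
  have "norm (exp u - (\<Sum>k\<le>1. u ^ k / fact k)) \<le> exp \<bar>Re u\<bar> * norm u ^ Suc 1 / fact 1" by (rule Taylor_exp)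
  then have "norm (exp u - (1 + u)) \<le> exp \<bar>Re u\<bar> * norm u ^ 2" by (simp add: numeral_2_eq_2)
  also have "\<dots> \<le> exp 1 * norm u ^ 2"
    using abs_Re_le_cmod[of u] u1 by (intro mult_right_mono) auto
  also have "\<dots> \<le> 3 * norm u ^ 2" using exp_le by (intro mult_right_mono) auto
  also have "\<dots> = 3 / 4 * (norm z * norm z ^ 3)" unfolding nu by (simp add: power_divide power2_eq_square power3_eq_cube)
  also have "\<dots> \<le> 3 / 4 * (1 * norm z ^ 3)" using z by (intro mult_left_mono mult_right_mono) auto
  also have "\<dots> \<le> norm z ^ 3" by simp
  finally have 1: "norm (exp u - (1 + u)) \<le> norm z ^ 3" .
  have "norm (trunc_laplace b z - exp u) \<le> norm (trunc_laplace b z - (1 + u)) + norm (exp u - (1 + u))"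
    using norm_triangle_ineq4[of "trunc_laplace b z - (1 + u)" "exp u - (1 + u)"] by simp
  also have "\<dots> \<le> (C * norm z ^ 3 + \<tau>) + norm z ^ 3"
    using trunc_laplace_taylor[OF z C \<tau>] 1 unfolding u_def by (intro add_mono) auto
  finally show ?thesis unfolding u_def by (simp add: algebra_simps)
qed

lemma norm_trunc_laplace_le: "norm (trunc_laplace b z) \<le> norm (trunc_laplace b (Re z))"
proof -
  have "norm (trunc_laplace b z) \<le> (\<integral>x. norm (indicator {-b..b} x *\<^sub>R exp (z * complex_of_real x)) \<partial>F)"
    unfolding trunc_laplace_def by (rule integral_norm_bound)
  also have "\<dots> = (\<integral>x. indicator {-b..b} x * exp (Re z * x) \<partial>F)" by simp
  also have "\<dots> \<le> norm (complex_of_real (\<integral>x. indicator {-b..b} x * exp (Re z * x) \<partial>F))" by simp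
  also have "complex_of_real (\<integral>x. indicator {-b..b} x * exp (Re z * x) \<partial>F) = trunc_laplace b (Re z)"
    unfolding trunc_laplace_def integral_complex_of_real[symmetric]
  proof (rule Bochner_Integration.integral_cong[OF refl])
    fix x
    have "exp (complex_of_real (Re z) * complex_of_real x) = complex_of_real (exp (Re z * x))"
      by (simp only: of_real_mult[symmetric] exp_of_real)
    then show "complex_of_real (indicator {-b..b} x * exp (Re z * x)) = indicator {-b..b} x *\<^sub>R exp (complex_of_real (Re z) * complex_of_real x)"
      by (simp only: scaleR_conv_of_real of_real_mult)
  qed
  finally show ?thesis .
qed

text \<open>
  The quantitative conditions under which a tilt by \<open>\<theta> / sqrt n\<close> of \<open>F\<close> truncated at \<open>b\<close> is nearly
  Gaussian: the tilted third absolute moment is at most \<open>C\<close>, the mass and first two moments beyond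
  \<open>b\<close> are negligible, and \<open>\<theta> ^ 3\<close> is small compared with \<open>sqrt n\<close>.
\<close>

definition truncation_good :: "real \<Rightarrow> nat \<Rightarrow> real \<Rightarrow> real \<Rightarrow> bool" where
  "truncation_good b n \<theta> C \<longleftrightarrow> n \<ge> 1 \<and> \<theta> \<ge> 1 \<and> C \<ge> 0 \<and>
     (\<integral>x. indicator {-b..b} x * (\<bar>x\<bar> ^ 3 * exp (\<theta> / sqrt n * \<bar>x\<bar>)) \<partial>F) \<le> C \<and>
     (\<integral>x. indicator (- {-b..b}) x * (1 + \<bar>x\<bar> + x\<^sup>2) \<partial>F) \<le> 1 / (n * sqrt n) \<and>
     16 * (C + 2) * \<theta> ^ 3 \<le> sqrt n"

lemma truncation_goodD:
  assumes "truncation_good b n \<theta> C"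
  shows "n \<ge> 1" "\<theta> \<ge> 1" "C \<ge> 0"
    "(\<integral>x. indicator {-b..b} x * (\<bar>x\<bar> ^ 3 * exp (\<theta> / sqrt n * \<bar>x\<bar>)) \<partial>F) \<le> C"
    "(\<integral>x. indicator (- {-b..b}) x * (1 + \<bar>x\<bar> + x\<^sup>2) \<partial>F) \<le> 1 / (n * sqrt n)"
    "16 * (C + 2) * \<theta> ^ 3 \<le> sqrt n"
  using assms unfolding truncation_good_def by simp_all

text \<open>
  The first term is the bound of \<open>power_close_to_gaussian\<close> for \<open>\<bar>t\<bar>\<close> up to a small multiple of
  \<open>sqrt n\<close>. For larger \<open>t\<close> both transforms are at most a constant times \<open>exp (\<theta>\<^sup>2 / 2)\<close>, and the second
  term exceeds this.
\<close>

lemma trunc_laplace_power_bound: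
  fixes \<theta> t C :: real
  assumes good: "truncation_good b n \<theta> C"
  shows "norm (trunc_laplace b ((\<theta> + \<i> * t) / sqrt n) ^ n - exp ((\<theta> + \<i> * t)\<^sup>2 / 2))
     \<le> exp (\<theta>\<^sup>2 / 2) * (6 * (C + 2) * \<theta> ^ 3 / sqrt n * ((1 + \<bar>t\<bar>) ^ 3 * exp (- t\<^sup>2 / 4)) + 3 * (64 * (C + 2))\<^sup>2 / n * t\<^sup>2)"
proof -
  note n = truncation_goodD(1)[OF good] and \<theta> = truncation_goodD(2)[OF good] and C0 = truncation_goodD(3)[OF good]
    and C = truncation_goodD(4)[OF good] and \<tau> = truncation_goodD(5)[OF good] and small = truncation_goodD(6)[OF good]
  define K where "K = C + 2"
  have K: "K \<ge> 1" using C0 by (simp add: K_def)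
  have r: "sqrt n \<ge> 1" "sqrt n > 0" using n by auto
  have 1: "norm (trunc_laplace b ((\<theta> + \<i> * t) / sqrt n) ^ n - exp ((\<theta> + \<i> * t)\<^sup>2 / 2))
     \<le> 6 * K * \<theta> ^ 3 / sqrt n * ((1 + \<bar>t\<bar>) ^ 3 * exp (\<theta>\<^sup>2 / 2 - t\<^sup>2 / 4))"
    if t: "\<bar>t\<bar> \<le> sqrt n / (64 * K)" for t :: real
  proof (rule power_close_to_gaussian[OF n \<theta> K _ t])
    show "16 * K * \<theta> ^ 3 \<le> sqrt n" using small by (simp add: K_def)
    let ?z = "(\<theta> + \<i> * t) / sqrt n"
    have "norm (\<theta> + \<i> * t) \<le> \<theta> + \<bar>t\<bar>"
      using norm_triangle_ineq[of "complex_of_real \<theta>" "\<i> * t"] \<theta> by (simp add: norm_mult)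
    then have nz: "norm ?z \<le> (\<theta> + \<bar>t\<bar>) / sqrt n" using n by (simp add: norm_divide divide_right_mono)
    have "\<theta> \<le> \<theta> ^ 3" using \<theta> self_le_power[of \<theta> 3] by simp
    also have "\<dots> \<le> K * \<theta> ^ 3" using K \<theta> by simp
    finally have "\<theta> \<le> K * \<theta> ^ 3" .
    moreover have "16 * (K * \<theta> ^ 3) \<le> sqrt n" using small by (simp add: K_def mult.assoc[symmetric])
    ultimately have "\<theta> \<le> sqrt n / 16" by linarith
    moreover have "sqrt n / (64 * K) \<le> sqrt n / 64" using K by (intro divide_left_mono) auto
    ultimately have "\<theta> + \<bar>t\<bar> \<le> sqrt n" using t r by linarith
    then have "(\<theta> + \<bar>t\<bar>) / sqrt n \<le> 1" using r by simp
    then have z1: "norm ?z \<le> 1" using nz by linarith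
    have Re: "\<bar>Re ?z\<bar> = \<theta> / sqrt n"
      using \<theta> by (simp add: Re_divide_of_real)
    have "norm (trunc_laplace b ?z - exp (?z\<^sup>2 / 2)) \<le> (C + 1) * norm ?z ^ 3 + 1 / (n * sqrt n)"
      by (rule trunc_laplace_gaussian[OF z1 _ \<tau>], unfold Re, rule C)
    also have "(C + 1) * norm ?z ^ 3 \<le> (C + 1) * ((\<theta> + \<bar>t\<bar>) / sqrt n) ^ 3"
      using C0 nz by (intro mult_left_mono power_mono) auto
    also have "((\<theta> + \<bar>t\<bar>) / sqrt n) ^ 3 = (\<theta> + \<bar>t\<bar>) ^ 3 / (n * sqrt n)"
      by (simp add: power_divide power3_eq_cube)
    also have "1 / (n * sqrt n) \<le> (\<theta> + \<bar>t\<bar>) ^ 3 / (n * sqrt n)"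
      using \<theta> n by (intro divide_right_mono one_le_power) auto
    finally show "norm (trunc_laplace b ?z - exp (?z\<^sup>2 / 2)) \<le> K * (\<theta> + \<bar>t\<bar>) ^ 3 / (n * sqrt n)"
      by (simp add: K_def algebra_simps add_divide_distrib)
  qed
  have e: "exp (\<theta>\<^sup>2 / 2 - t\<^sup>2 / 4) = exp (\<theta>\<^sup>2 / 2) * exp (- t\<^sup>2 / 4)" for t :: real
    by (simp flip: exp_add)
  show ?thesis
  proof (cases "\<bar>t\<bar> \<le> sqrt n / (64 * K)")
    case True
    have "norm (trunc_laplace b ((\<theta> + \<i> * t) / sqrt n) ^ n - exp ((\<theta> + \<i> * t)\<^sup>2 / 2))
        \<le> exp (\<theta>\<^sup>2 / 2) * (6 * K * \<theta> ^ 3 / sqrt n * ((1 + \<bar>t\<bar>) ^ 3 * exp (- t\<^sup>2 / 4)))"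
      using 1[OF True] unfolding e by (simp only: mult_ac)
    also have "\<dots> \<le> exp (\<theta>\<^sup>2 / 2) * (6 * K * \<theta> ^ 3 / sqrt n * ((1 + \<bar>t\<bar>) ^ 3 * exp (- t\<^sup>2 / 4)) + 3 * (64 * K)\<^sup>2 / n * t\<^sup>2)"
      by (intro mult_left_mono) auto
    finally show ?thesis unfolding K_def .
  next
    case False
    let ?z = "(\<theta> + \<i> * t) / sqrt n"
    have "norm (trunc_laplace b ((\<theta> + \<i> * 0) / sqrt n) ^ n - exp ((\<theta> + \<i> * 0)\<^sup>2 / 2))
      \<le> 6 * K * \<theta> ^ 3 / sqrt n * exp (\<theta>\<^sup>2 / 2)"
      using 1[of 0] K by simp
    also have "\<dots> \<le> 1 * exp (\<theta>\<^sup>2 / 2)"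
    proof -
      have "6 * K * \<theta> ^ 3 \<le> 16 * K * \<theta> ^ 3" using K \<theta> by (intro mult_right_mono) auto
      also have "\<dots> \<le> sqrt n" using small by (simp add: K_def)
      finally have "6 * K * \<theta> ^ 3 / sqrt n \<le> 1" using r by simp
      then show ?thesis by (intro mult_right_mono) auto
    qed
    finally have "norm (trunc_laplace b (\<theta> / sqrt n) ^ n - exp ((complex_of_real \<theta>)\<^sup>2 / 2)) \<le> exp (\<theta>\<^sup>2 / 2)"
      by simp
    moreover have "norm (exp ((complex_of_real \<theta>)\<^sup>2 / 2)) = exp (\<theta>\<^sup>2 / 2)"
      by (simp add: norm_exp_eq_Re flip: of_real_power)
    ultimately have m0: "norm (trunc_laplace b (\<theta> / sqrt n) ^ n) \<le> 2 * exp (\<theta>\<^sup>2 / 2)"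
      using norm_triangle_sub[of "trunc_laplace b (\<theta> / sqrt n) ^ n" "exp ((complex_of_real \<theta>)\<^sup>2 / 2)"] by simp
    have "norm (trunc_laplace b ?z ^ n) \<le> norm (trunc_laplace b (\<theta> / sqrt n) ^ n)"
      using norm_trunc_laplace_le[of b ?z] unfolding norm_power by (intro power_mono) (auto simp: Re_divide_of_real)
    then have m1: "norm (trunc_laplace b ?z ^ n) \<le> 2 * exp (\<theta>\<^sup>2 / 2)" using m0 by linarith
    have "Re ((\<theta> + \<i> * t)\<^sup>2 / 2) = \<theta>\<^sup>2 / 2 - t\<^sup>2 / 2"
      by (simp add: power2_eq_square diff_divide_distrib)
    then have "norm (exp ((\<theta> + \<i> * t)\<^sup>2 / 2)) = exp (\<theta>\<^sup>2 / 2 - t\<^sup>2 / 2)" by (simp only: norm_exp_eq_Re)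
    also have "\<dots> \<le> exp (\<theta>\<^sup>2 / 2)" by simp
    finally have m2: "norm (exp ((\<theta> + \<i> * t)\<^sup>2 / 2)) \<le> exp (\<theta>\<^sup>2 / 2)" .
    have "norm (trunc_laplace b ?z ^ n - exp ((\<theta> + \<i> * t)\<^sup>2 / 2)) \<le> exp (\<theta>\<^sup>2 / 2) * 3"
      using m1 m2 norm_triangle_ineq4[of "trunc_laplace b ?z ^ n" "exp ((\<theta> + \<i> * t)\<^sup>2 / 2)"] by linarith
    also have "\<dots> \<le> exp (\<theta>\<^sup>2 / 2) * (3 * (64 * K)\<^sup>2 / n * t\<^sup>2)"
    proof -
      have "sqrt n \<le> \<bar>t\<bar> * (64 * K)" using False K by (simp add: field_simps)
      then have "(sqrt n)\<^sup>2 \<le> (\<bar>t\<bar> * (64 * K))\<^sup>2" by (intro power_mono) auto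
      then have "real n \<le> t\<^sup>2 * (64 * K)\<^sup>2" by (simp add: power_mult_distrib)
      then have "1 \<le> (64 * K)\<^sup>2 / n * t\<^sup>2" using n by (simp add: field_simps)
      then show ?thesis by (intro mult_left_mono) auto
    qed
    also have "\<dots> \<le> exp (\<theta>\<^sup>2 / 2) * (6 * K * \<theta> ^ 3 / sqrt n * ((1 + \<bar>t\<bar>) ^ 3 * exp (- t\<^sup>2 / 4)) + 3 * (64 * K)\<^sup>2 / n * t\<^sup>2)"
      using K \<theta> by (intro mult_left_mono) auto
    finally show ?thesis unfolding K_def .
  qed
qed

end

section \<open>Laws of normalized sums with and without truncation\<close>

context standardized_distribution begin

text \<open>
  The law of the normalized sum of \<open>n\<close> independent variables with distribution \<open>F\<close>.
\<close>

definition sum_law :: "nat \<Rightarrow> real measure" where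
  "sum_law n = distr (PiM {1..n} (\<lambda>_. F)) borel (\<lambda>\<omega>. (\<Sum>i=1..n. \<omega> i) / sqrt n)"

text \<open>
  The part of \<open>sum_law\<close> that comes from the event that all summands lie in \<open>{-b..b}\<close>. It is a
  subprobability, and its Laplace transform is a power of \<open>trunc_laplace\<close>.
\<close>

definition trunc_sum_law :: "real \<Rightarrow> nat \<Rightarrow> real measure" where
  "trunc_sum_law b n = distr (density (PiM {1..n} (\<lambda>_. F)) (\<lambda>\<omega>. ennreal (\<Prod>i=1..n. indicator {-b..b} (\<omega> i))))
     borel (\<lambda>\<omega>. (\<Sum>i=1..n. \<omega> i) / sqrt n)"

lemma finite_product_prob: "finite_product_prob_space (\<lambda>_. F) {1..n::nat}"
  by standard auto

lemma sum_measurable [measurable]: "(\<lambda>\<omega>. (\<Sum>i=1..n. \<omega> i) / sqrt n) \<in> borel_measurable (PiM {1..n::nat} (\<lambda>_. F))"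
  by measurable

lemma prob_space_sum_law: "prob_space (sum_law n)"
proof -
  interpret P: finite_product_prob_space "\<lambda>_. F" "{1..n}" by (rule finite_product_prob)
  show ?thesis unfolding sum_law_def by (rule P.prob_space_distr) measurable
qed

lemma trunc_prod_measurable [measurable]:
  "(\<lambda>\<omega>. \<Prod>i=1..n. indicator {-b..b} (\<omega> i) :: real) \<in> borel_measurable (PiM {1..n::nat} (\<lambda>_. F))"
  by measurable

lemma prod_indicator_bounds: "0 \<le> (\<Prod>i\<in>I. indicator A (f i) :: real)" "(\<Prod>i\<in>I. indicator A (f i) :: real) \<le> 1"
  by (auto intro!: prod_nonneg prod_le_1)

lemma sets_trunc_sum_law [simp, measurable_cong]: "sets (trunc_sum_law b n) = sets borel"
  by (simp add: trunc_sum_law_def)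

lemma sets_sum_law [simp, measurable_cong]: "sets (sum_law n) = sets borel"
  by (simp add: sum_law_def)

lemma finite_measure_trunc_sum_law: "finite_measure (trunc_sum_law b n)"
proof -
  interpret P: finite_product_prob_space "\<lambda>_. F" "{1..n}" by (rule finite_product_prob)
  let ?N = "density (PiM {1..n} (\<lambda>_. F)) (\<lambda>\<omega>. ennreal (\<Prod>i=1..n. indicator {-b..b} (\<omega> i)))"
  have "emeasure ?N (space ?N) = (\<integral>\<^sup>+\<omega>. ennreal (\<Prod>i=1..n. indicator {-b..b} (\<omega> i)) \<partial>PiM {1..n} (\<lambda>_. F))"
    by (subst emeasure_density) (auto intro!: nn_integral_cong)
  also have "\<dots> \<le> (\<integral>\<^sup>+\<omega>. 1 \<partial>PiM {1..n} (\<lambda>_. F))"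
    by (intro nn_integral_mono) (use prod_indicator_bounds in auto)
  also have "\<dots> = 1" using P.emeasure_space_1 by simp
  finally have "emeasure ?N (space ?N) \<noteq> \<infinity>" by (auto simp: top_unique)
  then interpret N: finite_measure ?N by (rule finite_measureI)
  show ?thesis unfolding trunc_sum_law_def by (rule N.finite_measure_distr) measurable
qed

lemma integral_trunc_sum_law:
  fixes g :: "real \<Rightarrow> 'b::{banach, second_countable_topology}"
  assumes [measurable]: "g \<in> borel_measurable borel"
  shows "(\<integral>s. g s \<partial>trunc_sum_law b n)
    = (\<integral>\<omega>. (\<Prod>i=1..n. indicator {-b..b} (\<omega> i)) *\<^sub>R g ((\<Sum>i=1..n. \<omega> i) / sqrt n) \<partial>PiM {1..n} (\<lambda>_. F))"
  unfolding trunc_sum_law_def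
  by (subst integral_distr, measurable, subst integral_density, measurable)
     (auto intro!: AE_I2 prod_indicator_bounds)

lemma exp_sum_product:
  fixes n :: nat
  shows
  "(\<Prod>i=1..n. indicator {-b..b} (\<omega> i)) *\<^sub>R exp (z * complex_of_real ((\<Sum>i=1..n. \<omega> i) / sqrt n))
     = (\<Prod>i=1..n. indicator {-b..b} (\<omega> i) *\<^sub>R exp (z / sqrt n * complex_of_real (\<omega> i)))"
proof -
  have "z * complex_of_real ((\<Sum>i=1..n. \<omega> i) / sqrt n) = (\<Sum>i=1..n. z / sqrt n * complex_of_real (\<omega> i))"
    by (simp add: sum_distrib_left sum_divide_distrib)
  then have "exp (z * complex_of_real ((\<Sum>i=1..n. \<omega> i) / sqrt n)) = (\<Prod>i=1..n. exp (z / sqrt n * complex_of_real (\<omega> i)))"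
    by (simp only: exp_sum[OF finite_atLeastAtMost])
  then show ?thesis by (simp only: scaleR_conv_of_real of_real_prod prod.distrib)
qed

lemma laplace_trunc_sum_law: "laplace (trunc_sum_law b n) z = trunc_laplace b (z / sqrt n) ^ n"
proof -
  interpret P: finite_product_prob_space "\<lambda>_. F" "{1..n}" by (rule finite_product_prob)
  have "laplace (trunc_sum_law b n) z
    = (\<integral>\<omega>. (\<Prod>i=1..n. indicator {-b..b} (\<omega> i) *\<^sub>R exp (z / sqrt n * complex_of_real (\<omega> i))) \<partial>PiM {1..n} (\<lambda>_. F))"
    unfolding laplace_def by (subst integral_trunc_sum_law) (simp, simp only: exp_sum_product)
  also have "\<dots> = (\<Prod>i=1..n. trunc_laplace b (z / sqrt n))"
    unfolding trunc_laplace_def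
    by (rule P.product_integral_prod) (simp, rule integrable_trunc_exp)
  finally show ?thesis by simp
qed

lemma laplace_measure_trunc_sum_law: "laplace_measure (trunc_sum_law b n) \<theta>"
proof -
  interpret P: finite_product_prob_space "\<lambda>_. F" "{1..n}" by (rule finite_product_prob)
  interpret G: finite_measure "trunc_sum_law b n" by (rule finite_measure_trunc_sum_law)
  have "integrable (PiM {1..n} (\<lambda>_. F)) (\<lambda>\<omega>. \<Prod>i=1..n. indicator {-b..b} (\<omega> i) *\<^sub>R exp (complex_of_real \<theta> / sqrt n * complex_of_real (\<omega> i)))"
    by (rule P.product_integrable_prod) (simp, rule integrable_trunc_exp)
  then have "integrable (PiM {1..n} (\<lambda>_. F)) (\<lambda>\<omega>. (\<Prod>i=1..n. indicator {-b..b} (\<omega> i)) *\<^sub>R exp (complex_of_real \<theta> * complex_of_real ((\<Sum>i=1..n. \<omega> i) / sqrt n)))"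
    by (simp only: exp_sum_product)
  then have "integrable (density (PiM {1..n} (\<lambda>_. F)) (\<lambda>\<omega>. ennreal (\<Prod>i=1..n. indicator {-b..b} (\<omega> i)))) (\<lambda>\<omega>. exp (complex_of_real \<theta> * complex_of_real ((\<Sum>i=1..n. \<omega> i) / sqrt n)))"
    by (subst integrable_density) (auto intro!: AE_I2 prod_indicator_bounds)
  then have "integrable (trunc_sum_law b n) (\<lambda>s. exp (complex_of_real \<theta> * complex_of_real s))"
    unfolding trunc_sum_law_def by (subst integrable_distr_eq) measurable
  from integrable_norm[OF this] have "integrable (trunc_sum_law b n) (\<lambda>s. exp (\<theta> * s))" by simp
  then show ?thesis by unfold_locales auto
qed

lemma one_minus_prod_indicator_le:
  assumes "finite I"
  shows "1 - (\<Prod>i\<in>I. indicator A (f i) :: real) \<le> (\<Sum>i\<in>I. indicator (- A) (f i))"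
proof (cases "\<forall>i\<in>I. f i \<in> A")
  case True
  then show ?thesis by (simp add: sum_nonneg)
next
  case False
  then obtain j where j: "j \<in> I" "f j \<notin> A" by auto
  have "1 = (indicator (- A) (f j) :: real)" using j by simp
  also have "\<dots> \<le> (\<Sum>i\<in>I. indicator (- A) (f i))" using assms j by (intro member_le_sum) auto
  finally show ?thesis using prod_indicator_bounds(1)[of A f I] by linarith
qed

lemma measure_trunc_sum_law:
  assumes A: "A \<in> sets borel"
  shows "measure (trunc_sum_law b n) A \<le> measure (sum_law n) A"
    and "measure (sum_law n) A \<le> measure (trunc_sum_law b n) A + n * measure F (- {-b..b})"
proof -
  interpret P: finite_product_prob_space "\<lambda>_. F" "{1..n}" by (rule finite_product_prob)
  interpret G: finite_measure "trunc_sum_law b n" by (rule finite_measure_trunc_sum_law)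
  interpret S: prob_space "sum_law n" by (rule prob_space_sum_law)
  let ?P = "PiM {1..n} (\<lambda>_. F)" and ?T = "\<lambda>\<omega>. (\<Sum>i=1..n. \<omega> i) / sqrt n"
  let ?i = "\<lambda>\<omega>. \<Prod>i=1..n. indicator {-b..b} (\<omega> i) :: real"
  have 1: "measure (trunc_sum_law b n) A = (\<integral>\<omega>. ?i \<omega> * indicator A (?T \<omega>) \<partial>?P)"
  proof -
    have "measure (trunc_sum_law b n) A = (\<integral>s. indicator A s \<partial>trunc_sum_law b n)" using A by simp
    also have "\<dots> = (\<integral>\<omega>. ?i \<omega> * indicator A (?T \<omega>) \<partial>?P)"
      using A by (subst integral_trunc_sum_law) auto
    finally show ?thesis .
  qed
  have 2: "measure (sum_law n) A = (\<integral>\<omega>. indicator A (?T \<omega>) \<partial>?P)"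
  proof -
    have "measure (sum_law n) A = (\<integral>s. indicator A s \<partial>sum_law n)" using A by simp
    also have "\<dots> = (\<integral>\<omega>. indicator A (?T \<omega>) \<partial>?P)"
      unfolding sum_law_def using A by (subst integral_distr) auto
    finally show ?thesis .
  qed
  have i1: "integrable ?P (\<lambda>\<omega>. ?i \<omega> * indicator A (?T \<omega>))"
    using A prod_indicator_bounds
    by (intro P.integrable_const_bound[where B=1]) (auto intro!: AE_I2 mult_le_one simp: abs_mult abs_of_nonneg[OF prod_indicator_bounds(1)])
  have i2: "integrable ?P (\<lambda>\<omega>. indicator A (?T \<omega>) :: real)"
    using A by (intro P.integrable_const_bound[where B=1]) (auto intro!: AE_I2)
  show "measure (trunc_sum_law b n) A \<le> measure (sum_law n) A"
    unfolding 1 2 by (rule integral_mono[OF i1 i2]) (use prod_indicator_bounds in \<open>auto intro!: mult_left_le_one_le\<close>)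
  have i3: "integrable ?P (\<lambda>\<omega>. indicator (- {-b..b}) (\<omega> i) :: real)" if "i \<in> {1..n}" for i
    using that by (intro P.integrable_const_bound[where B=1]) (auto intro!: AE_I2)
  have i4: "integrable ?P (\<lambda>\<omega>. \<Sum>i=1..n. indicator (- {-b..b}) (\<omega> i) :: real)"
    by (rule Bochner_Integration.integrable_sum[OF i3])
  have "measure (sum_law n) A \<le> (\<integral>\<omega>. ?i \<omega> * indicator A (?T \<omega>) + (\<Sum>i=1..n. indicator (- {-b..b}) (\<omega> i)) \<partial>?P)"
    unfolding 2
  proof (rule integral_mono[OF i2])
    show "integrable ?P (\<lambda>\<omega>. ?i \<omega> * indicator A (?T \<omega>) + (\<Sum>i=1..n. indicator (- {-b..b}) (\<omega> i)))"
      using i1 i4 by (rule Bochner_Integration.integrable_add)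
    fix \<omega>
    show "indicator A (?T \<omega>) \<le> ?i \<omega> * indicator A (?T \<omega>) + (\<Sum>i=1..n. indicator (- {-b..b}) (\<omega> i))"
      using one_minus_prod_indicator_le[of "{1..n}" "{-b..b}" \<omega>]
      by (cases "?T \<omega> \<in> A") (auto intro!: sum_nonneg)
  qed
  also have "\<dots> = measure (trunc_sum_law b n) A + (\<Sum>i=1..n. (\<integral>\<omega>. indicator (- {-b..b}) (\<omega> i) \<partial>?P))"
    unfolding 1 using i1 i3 i4 by (simp add: Bochner_Integration.integral_add Bochner_Integration.integral_sum)
  also have "(\<Sum>i=1..n. (\<integral>\<omega>. indicator (- {-b..b}) (\<omega> i) \<partial>?P)) = (\<Sum>i=1..n. measure F (- {-b..b}))"
  proof (rule sum.cong[OF refl])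
    fix i assume i: "i \<in> {1..n}"
    have "measure F (- {-b..b}) = (\<integral>x. indicator (- {-b..b}) x \<partial>F)" by simp
    also have "\<dots> = (\<integral>x. indicator (- {-b..b}) x \<partial>distr ?P F (\<lambda>\<omega>. \<omega> i))"
      using distr_PiM_component[of "{1..n}" "\<lambda>_. F" i] i prob_space_axioms by simp
    also have "\<dots> = (\<integral>\<omega>. indicator (- {-b..b}) (\<omega> i) \<partial>?P)"
      using i by (subst integral_distr) auto
    finally show "(\<integral>\<omega>. indicator (- {-b..b}) (\<omega> i) \<partial>?P) = measure F (- {-b..b})" by simp
  qed
  finally show "measure (sum_law n) A \<le> measure (trunc_sum_law b n) A + n * measure F (- {-b..b})" by simp
qed

end

text \<open>
  The integral over \<open>t\<close> of the first error term in \<open>trunc_laplace_power_bound\<close>, without its prefactor.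
\<close>

definition gauss_cubic_const :: real where
  "gauss_cubic_const = (\<integral>t. (1 + \<bar>t\<bar>) ^ 3 * exp (- t\<^sup>2 / 4) \<partial>lborel)"

lemma integrable_gauss_cubic: "integrable lborel (\<lambda>t::real. (1 + \<bar>t\<bar>) ^ 3 * exp (- t\<^sup>2 / 4))"
proof -
  have m: "integrable lborel (\<lambda>t. normal_density 0 (sqrt 2) t * \<bar>t\<bar> ^ k)" for k
    using integrable_normal_moment_abs[of "sqrt 2" 0 k] by simp
  have "integrable lborel (\<lambda>t. sqrt (4 * pi) * (normal_density 0 (sqrt 2) t * \<bar>t\<bar> ^ 0 + 3 * (normal_density 0 (sqrt 2) t * \<bar>t\<bar> ^ 1)
     + 3 * (normal_density 0 (sqrt 2) t * \<bar>t\<bar> ^ 2) + normal_density 0 (sqrt 2) t * \<bar>t\<bar> ^ 3))"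
    by (intro integrable_mult_right Bochner_Integration.integrable_add m)
  moreover have "sqrt (4 * pi) * (normal_density 0 (sqrt 2) t * \<bar>t\<bar> ^ 0 + 3 * (normal_density 0 (sqrt 2) t * \<bar>t\<bar> ^ 1)
     + 3 * (normal_density 0 (sqrt 2) t * \<bar>t\<bar> ^ 2) + normal_density 0 (sqrt 2) t * \<bar>t\<bar> ^ 3) = (1 + \<bar>t\<bar>) ^ 3 * exp (- t\<^sup>2 / 4)" for t
  proof -
    have "sqrt (4 * pi) * normal_density 0 (sqrt 2) t = exp (- t\<^sup>2 / 4)"
      by (simp add: normal_density_def)
    then have "(1 + \<bar>t\<bar>) ^ 3 * exp (- t\<^sup>2 / 4) = (1 + \<bar>t\<bar>) ^ 3 * (sqrt (4 * pi) * normal_density 0 (sqrt 2) t)" by simp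
    then show ?thesis by (simp only:) (simp add: power2_eq_square power3_eq_cube algebra_simps)
  qed
  ultimately show ?thesis by (simp only:)
qed

lemma gauss_weight_le_1: "gauss_weight \<delta> t \<le> 1"
proof -
  have "exp (- (\<delta> * t)\<^sup>2 / 2) \<le> 1" by simp
  then show ?thesis unfolding gauss_weight_def using pi_gt3 by (subst divide_le_eq_1_pos) (simp, linarith)
qed

lemma gauss_weight_second_moment:
  assumes "\<delta> > 0"
  shows "integrable lborel (\<lambda>t. t\<^sup>2 * gauss_weight \<delta> t)" "(\<integral>t. t\<^sup>2 * gauss_weight \<delta> t \<partial>lborel) \<le> 1 / \<delta> ^ 3"
proof -
  have eq: "t\<^sup>2 * gauss_weight \<delta> t = 1 / (\<delta> * sqrt (2 * pi)) * (normal_density 0 (1 / \<delta>) t * (t - 0) ^ (2 * 1))" for t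
    using assms by (simp add: gauss_weight_def normal_density_def real_sqrt_mult real_sqrt_divide power_mult_distrib power_divide field_simps power2_eq_square[of t])
  have 1: "has_bochner_integral lborel (\<lambda>t. normal_density 0 (1 / \<delta>) t * (t - 0) ^ (2 * 1)) (fact (2 * 1) / ((2 / (1 / \<delta>)\<^sup>2) ^ 1 * fact 1))"
    using assms by (intro normal_moment_even) auto
  show "integrable lborel (\<lambda>t. t\<^sup>2 * gauss_weight \<delta> t)"
    unfolding eq using 1 by (intro integrable_mult_right) (rule integrable.intros)
  have "(\<integral>t. t\<^sup>2 * gauss_weight \<delta> t \<partial>lborel) = 1 / (\<delta> * sqrt (2 * pi)) * (1 / \<delta>\<^sup>2)"
    unfolding eq integral_mult_right_zero has_bochner_integral_integral_eq[OF 1] by (simp add: power_divide)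
  also have "\<dots> = 1 / \<delta> ^ 3 / sqrt (2 * pi)" using assms by (simp add: power2_eq_square power3_eq_cube)
  also have "\<dots> \<le> 1 / \<delta> ^ 3 / 1"
    using assms pi_gt3 by (intro divide_left_mono) (auto intro!: real_le_rsqrt)
  finally show "(\<integral>t. t\<^sup>2 * gauss_weight \<delta> t \<partial>lborel) \<le> 1 / \<delta> ^ 3" by simp
qed

lemma gauss_cubic_const_nonneg: "gauss_cubic_const \<ge> 0"
  unfolding gauss_cubic_const_def by (intro integral_nonneg_AE) auto

section \<open>Tail bounds for the truncated sum\<close>

context standardized_distribution begin

text \<open>
  Here \<open>\<eta>\<close> bounds the integrated relative distance of the two Laplace transforms on the line
  \<open>Re z = \<theta>\<close>, weighted by \<open>gauss_weight \<delta>\<close>.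
\<close>

lemma trunc_sum_law_smooth_comparison:
  fixes \<theta> C \<delta> :: real and n :: nat
  defines "\<eta> \<equiv> 6 * (C + 2) * \<theta> ^ 3 / sqrt n * gauss_cubic_const + 3 * (64 * (C + 2))\<^sup>2 / (n * \<delta> ^ 3)"
  assumes good: "truncation_good b n \<theta> C" and \<delta>: "\<delta> > 0"
  shows "\<bar>(\<integral>s. smooth_tail \<theta> \<delta> y s \<partial>trunc_sum_law b n) - (\<integral>s. smooth_tail \<theta> \<delta> y s \<partial>std_normal_distribution)\<bar>
     \<le> exp (\<theta>\<^sup>2 / 2) * \<eta> * (exp (- \<theta> * y) / \<theta>)"
    and "\<eta> \<ge> 0"
proof -
  note n = truncation_goodD(1)[OF good] and \<theta> = truncation_goodD(2)[OF good] and C0 = truncation_goodD(3)[OF good]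
  let ?c = "6 * (C + 2) * \<theta> ^ 3 / sqrt n" and ?d = "3 * (64 * (C + 2))\<^sup>2 / n"
  let ?B = "\<lambda>t. exp (\<theta>\<^sup>2 / 2) * (?c * ((1 + \<bar>t\<bar>) ^ 3 * exp (- t\<^sup>2 / 4)) + ?d * (t\<^sup>2 * gauss_weight \<delta> t))"
  have c: "?c \<ge> 0" "?d \<ge> 0" using C0 \<theta> by auto
  have iB: "integrable lborel ?B"
    by (intro integrable_mult_right Bochner_Integration.integrable_add integrable_gauss_cubic gauss_weight_second_moment \<delta>)
  have "\<bar>(\<integral>s. smooth_tail \<theta> \<delta> y s \<partial>trunc_sum_law b n) - (\<integral>s. smooth_tail \<theta> \<delta> y s \<partial>std_normal_distribution)\<bar>
     \<le> (\<integral>t. ?B t \<partial>lborel) * (exp (- \<theta> * y) / \<theta>)"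
  proof (rule smooth_tail_comparison[OF laplace_measure_trunc_sum_law laplace_measure_std_normal \<delta> _ iB])
    fix t :: real
    let ?D = "norm (trunc_laplace b ((\<theta> + \<i> * t) / sqrt n) ^ n - exp ((\<theta> + \<i> * t)\<^sup>2 / 2))"
    have "gauss_weight \<delta> t * ?D \<le> gauss_weight \<delta> t * (exp (\<theta>\<^sup>2 / 2) * (?c * ((1 + \<bar>t\<bar>) ^ 3 * exp (- t\<^sup>2 / 4)) + ?d * t\<^sup>2))"
      by (intro mult_left_mono trunc_laplace_power_bound[OF good] gauss_weight_nonneg)
    also have "\<dots> = exp (\<theta>\<^sup>2 / 2) * (gauss_weight \<delta> t * (?c * ((1 + \<bar>t\<bar>) ^ 3 * exp (- t\<^sup>2 / 4))) + ?d * (t\<^sup>2 * gauss_weight \<delta> t))"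
      by (simp only: distrib_left mult_ac)
    also have "\<dots> \<le> ?B t"
    proof -
      have "0 \<le> ?c * ((1 + \<bar>t\<bar>) ^ 3 * exp (- t\<^sup>2 / 4))" by (rule mult_nonneg_nonneg[OF c(1)]) simp
      then show ?thesis
        by (intro mult_left_mono add_mono mult_left_le_one_le gauss_weight_le_1 gauss_weight_nonneg order_refl exp_ge_zero)
    qed
    finally show "gauss_weight \<delta> t * norm (laplace (trunc_sum_law b n) (\<theta> + \<i> * t) - laplace std_normal_distribution (\<theta> + \<i> * t)) \<le> ?B t"
      unfolding laplace_trunc_sum_law by (simp only: laplace_def normal_laplace)
  qed (use \<theta> in auto)
  also have "(\<integral>t. ?B t \<partial>lborel) = exp (\<theta>\<^sup>2 / 2) * (?c * gauss_cubic_const + ?d * (\<integral>t. t\<^sup>2 * gauss_weight \<delta> t \<partial>lborel))"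
    unfolding integral_mult_right_zero gauss_cubic_const_def
    by (subst Bochner_Integration.integral_add)
      (auto simp only: integral_mult_right_zero intro!: integrable_mult_right integrable_gauss_cubic gauss_weight_second_moment \<delta>)
  also have "\<dots> \<le> exp (\<theta>\<^sup>2 / 2) * (?c * gauss_cubic_const + ?d * (1 / \<delta> ^ 3))"
    using c by (intro mult_left_mono add_mono gauss_weight_second_moment \<delta>) auto
  also have "?c * gauss_cubic_const + ?d * (1 / \<delta> ^ 3) = \<eta>" by (simp add: \<eta>_def)
  finally show "\<bar>(\<integral>s. smooth_tail \<theta> \<delta> y s \<partial>trunc_sum_law b n) - (\<integral>s. smooth_tail \<theta> \<delta> y s \<partial>std_normal_distribution)\<bar>
     \<le> exp (\<theta>\<^sup>2 / 2) * \<eta> * (exp (- \<theta> * y) / \<theta>)" using \<theta> by (simp add: mult_right_mono divide_right_mono)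
  show "\<eta> \<ge> 0" unfolding \<eta>_def using C0 \<theta> \<delta> gauss_cubic_const_nonneg by auto
qed

end

lemma integral_exp_std_normal: "(\<integral>s. exp (\<theta> * s) \<partial>std_normal_distribution) = exp (\<theta>\<^sup>2 / 2)"
proof -
  have "complex_of_real (\<integral>s. exp (\<theta> * s) \<partial>std_normal_distribution) = (\<integral>s. exp ((complex_of_real \<theta> + \<i> * complex_of_real 0) * complex_of_real s) \<partial>std_normal_distribution)"
    unfolding integral_complex_of_real[symmetric] by (simp flip: exp_of_real)
  also have "\<dots> = complex_of_real (exp (\<theta>\<^sup>2 / 2))"
    unfolding normal_laplace by (simp flip: exp_of_real)
  finally show ?thesis by (simp only: of_real_eq_iff)
qed

context laplace_measure begin

text \<open>
  Integrated forms of \<open>smooth_tail_lower\<close> and \<open>smooth_tail_upper\<close>.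
\<close>

lemma measure_le_smooth_tail:
  assumes "\<delta> > 0" "\<kappa> > 0" "\<theta> \<ge> 0"
  shows "exp (- \<theta> * \<kappa>) * (1 - 105 * \<delta>^8 / \<kappa>^8) * measure G {x..} \<le> (\<integral>s. smooth_tail \<theta> \<delta> (x - \<kappa>) s \<partial>G)"
proof -
  let ?c = "exp (- \<theta> * \<kappa>) * (1 - 105 * \<delta>^8 / \<kappa>^8)"
  have "?c * measure G {x..} = (\<integral>s. ?c * indicator {x..} s \<partial>G)" by simp
  also have "\<dots> \<le> (\<integral>s. smooth_tail \<theta> \<delta> (x - \<kappa>) s \<partial>G)"
  proof (rule integral_mono)
    show "integrable G (\<lambda>s. ?c * indicator {x..} s)"
      by (intro integrable_mult_right integrable_real_indicator) (auto simp: emeasure_eq_measure)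
    show "integrable G (smooth_tail \<theta> \<delta> (x - \<kappa>))" by (rule smooth_tail_integrable[OF assms(1)])
    show "?c * indicator {x..} s \<le> smooth_tail \<theta> \<delta> (x - \<kappa>) s" for s
      using smooth_tail_lower[OF assms, of x s] smooth_tail_nonneg by (cases "x \<le> s") auto
  qed
  finally show ?thesis .
qed

lemma smooth_tail_le_measure:
  assumes "\<delta> > 0" "\<kappa> > 0" "\<theta> \<ge> 0"
  shows "(\<integral>s. smooth_tail \<theta> \<delta> (x + \<kappa>) s \<partial>G) \<le> exp (\<theta>\<^sup>2 * \<delta>\<^sup>2 / 2) * measure G {x<..}
     + exp (- \<theta> * x) * (105 * \<delta>^8 / \<kappa>^8) * (\<integral>s. exp (\<theta> * s) \<partial>G)"
proof -
  let ?T = "105 * \<delta>^8 / \<kappa>^8"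
  have i: "integrable G (\<lambda>s. indicator {x<..} s :: real)"
    by (intro integrable_real_indicator) (auto simp: emeasure_eq_measure)
  have "(\<integral>s. smooth_tail \<theta> \<delta> (x + \<kappa>) s \<partial>G) \<le> (\<integral>s. exp (\<theta>\<^sup>2 * \<delta>\<^sup>2 / 2) * indicator {x<..} s + exp (- \<theta> * x) * ?T * exp (\<theta> * s) \<partial>G)"
  proof (rule integral_mono)
    show "integrable G (smooth_tail \<theta> \<delta> (x + \<kappa>))" by (rule smooth_tail_integrable[OF assms(1)])
    show "integrable G (\<lambda>s. exp (\<theta>\<^sup>2 * \<delta>\<^sup>2 / 2) * indicator {x<..} s + exp (- \<theta> * x) * ?T * exp (\<theta> * s))"
      by (intro Bochner_Integration.integrable_add integrable_mult_right i exp_integrable)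
    fix s
    have "exp (\<theta> * (s - x)) = exp (- \<theta> * x) * exp (\<theta> * s)"
      unfolding exp_add[symmetric] by (simp add: algebra_simps)
    then show "smooth_tail \<theta> \<delta> (x + \<kappa>) s \<le> exp (\<theta>\<^sup>2 * \<delta>\<^sup>2 / 2) * indicator {x<..} s + exp (- \<theta> * x) * ?T * exp (\<theta> * s)"
      using smooth_tail_upper[OF assms, of x s] by (simp only: mult_ac)
  qed
  also have "\<dots> = exp (\<theta>\<^sup>2 * \<delta>\<^sup>2 / 2) * measure G {x<..} + exp (- \<theta> * x) * ?T * (\<integral>s. exp (\<theta> * s) \<partial>G)"
    by (subst Bochner_Integration.integral_add) (use i exp_integrable in auto)
  finally show ?thesis .
qed

end

context standardized_distribution begin

lemma integral_exp_trunc_sum_law_le: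
  fixes \<theta> C :: real
  assumes good: "truncation_good b n \<theta> C"
  shows "(\<integral>s. exp (\<theta> * s) \<partial>trunc_sum_law b n) \<le> 2 * exp (\<theta>\<^sup>2 / 2)"
proof -
  note n = truncation_goodD(1)[OF good] and \<theta> = truncation_goodD(2)[OF good] and C0 = truncation_goodD(3)[OF good]
    and small = truncation_goodD(6)[OF good]
  have "complex_of_real (\<integral>s. exp (\<theta> * s) \<partial>trunc_sum_law b n) = laplace (trunc_sum_law b n) (\<theta> + \<i> * complex_of_real 0)"
    unfolding laplace_def integral_complex_of_real[symmetric] by (simp flip: exp_of_real)
  then have eq: "complex_of_real (\<integral>s. exp (\<theta> * s) \<partial>trunc_sum_law b n) = trunc_laplace b ((\<theta> + \<i> * complex_of_real 0) / sqrt n) ^ n"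
    by (simp only: laplace_trunc_sum_law)
  have e: "exp ((\<theta> + \<i> * complex_of_real 0)\<^sup>2 / 2) = complex_of_real (exp (\<theta>\<^sup>2 / 2))"
    by (simp flip: exp_of_real)
  have "\<bar>(\<integral>s. exp (\<theta> * s) \<partial>trunc_sum_law b n) - exp (\<theta>\<^sup>2 / 2)\<bar> = norm (complex_of_real (\<integral>s. exp (\<theta> * s) \<partial>trunc_sum_law b n) - complex_of_real (exp (\<theta>\<^sup>2 / 2)))"
    by (metis norm_of_real of_real_diff)
  also have "\<dots> \<le> exp (\<theta>\<^sup>2 / 2) * (6 * (C + 2) * \<theta> ^ 3 / sqrt n)"
    using trunc_laplace_power_bound[OF good, of 0] unfolding eq e by simp
  also have "\<dots> \<le> exp (\<theta>\<^sup>2 / 2) * 1"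
  proof -
    have "6 * (C + 2) * \<theta> ^ 3 \<le> 16 * (C + 2) * \<theta> ^ 3" using C0 \<theta> by (intro mult_right_mono) auto
    then have "6 * (C + 2) * \<theta> ^ 3 \<le> sqrt n" using small by linarith
    then have "6 * (C + 2) * \<theta> ^ 3 / sqrt n \<le> 1" using n by simp
    then show ?thesis by (intro mult_left_mono) auto
  qed
  finally show ?thesis by linarith
qed

text \<open>
  Both inequalities follow one pattern: the tail of one measure is bounded by its smoothed tail, the smoothed tails
  are compared, and the smoothed tail is bounded by the tail of the other measure at a threshold
  shifted by \<open>2 * \<kappa>\<close> in total. The choice \<open>\<theta> = x + 1\<close> makes
  \<open>exp (\<theta>\<^sup>2 / 2 - \<theta> * x)\<close> a multiple of \<open>exp (- x\<^sup>2 / 2)\<close> while \<open>\<theta>\<close> stays away from zero, so that small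
  \<open>x\<close> need no separate treatment.
\<close>

lemma trunc_sum_law_tail_bounds:
  fixes x C \<delta> \<kappa> :: real and n :: nat
  defines "\<theta> \<equiv> x + 1" and "A \<equiv> 2 / mills_const" and "T \<equiv> 105 * \<delta>^8 / \<kappa>^8"
  defines "\<eta> \<equiv> 6 * (C + 2) * \<theta> ^ 3 / sqrt n * gauss_cubic_const + 3 * (64 * (C + 2))\<^sup>2 / (n * \<delta> ^ 3)"
  assumes good: "truncation_good b n \<theta> C" and x: "x \<ge> 0" and \<delta>: "\<delta> > 0" and \<kappa>: "\<kappa> > 0"
  shows "exp (- \<theta> * \<kappa>) * (1 - T) * measure (trunc_sum_law b n) {x..} \<le>
      (exp (\<theta>\<^sup>2 * \<delta>\<^sup>2 / 2) * (1 + 2 * A * (\<theta> * \<kappa>) * exp (2 * (\<theta> * \<kappa>))) + A * (\<theta> * T) * exp (2 * (\<theta> * \<kappa>)) + A * \<eta> * exp (\<theta> * \<kappa>)) * normal_tail x" (is ?up)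
    and "T \<le> 1 \<Longrightarrow> (exp (- \<theta> * \<kappa>) * (1 - T) * (1 - 2 * A * (\<theta> * \<kappa>)) - 2 * A * (\<theta> * T) - A * \<eta>) * normal_tail x
       \<le> exp (\<theta>\<^sup>2 * \<delta>\<^sup>2 / 2) * measure (trunc_sum_law b n) {x<..}" (is "_ \<Longrightarrow> ?lo")
proof -
  let ?G = "trunc_sum_law b n" and ?N = std_normal_distribution
  let ?P = "normal_tail x"
  note \<theta> = truncation_goodD(2)[OF good]
  interpret G: laplace_measure ?G \<theta> by (rule laplace_measure_trunc_sum_law)
  interpret N: laplace_measure ?N \<theta> by (rule laplace_measure_std_normal)
  have T0: "T \<ge> 0" by (simp add: T_def zero_le_power_eq)
  have A0: "A \<ge> 0" using mills_const_pos by (simp add: A_def)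
  have P0: "?P > 0" by (rule normal_tail_pos[OF x])
  note comp = trunc_sum_law_smooth_comparison[OF good \<delta>, folded \<eta>_def]
  have \<eta>0: "\<eta> \<ge> 0" by (rule comp(2))
  have eP2: "2 * exp (- x\<^sup>2 / 2) \<le> A * \<theta> * ?P"
  proof -
    have "mills_const * exp (- x\<^sup>2 / 2) \<le> ?P * \<theta>"
      using normal_tail_lower[OF x] x by (simp add: \<theta>_def field_simps)
    then show ?thesis using mills_const_pos by (simp add: A_def field_simps)
  qed
  \<comment> \<open>All absolute errors carry this factor, which is of the order of the Gaussian tail up to a factor \<open>\<theta>\<close>.\<close>
  have A2: "exp (\<theta>\<^sup>2 / 2) * exp (- \<theta> * x) \<le> A * \<theta> * ?P"
  proof -
    have "exp (\<theta>\<^sup>2 / 2) * exp (- \<theta> * x) = exp (1 / 2) * exp (- x\<^sup>2 / 2)"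
      unfolding exp_add[symmetric] \<theta>_def by (simp add: power2_eq_square field_simps)
    also have "\<dots> \<le> 2 * exp (- x\<^sup>2 / 2)"
    proof -
      have "exp (1 / 2 :: real) ^ 2 = exp 1" by (simp flip: exp_of_nat_mult)
      then have "exp (1 / 2 :: real) ^ 2 \<le> 2 ^ 2" using exp_le by simp
      then have "exp (1 / 2 :: real) \<le> 2" by (rule power2_le_imp_le) simp
      then show ?thesis by (intro mult_right_mono) auto
    qed
    finally show ?thesis using eP2 by linarith
  qed
  have A3: "exp (\<theta>\<^sup>2 / 2) * exp (- \<theta> * (x - a)) \<le> exp (\<theta> * a) * (A * \<theta> * ?P)" for a
  proof -
    have "exp (\<theta>\<^sup>2 / 2) * exp (- \<theta> * (x - a)) = exp (\<theta> * a) * (exp (\<theta>\<^sup>2 / 2) * exp (- \<theta> * x))"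
      unfolding exp_add[symmetric] by (simp add: algebra_simps)
    then show ?thesis using A2 by simp
  qed
  have err: "exp (\<theta>\<^sup>2 / 2) * \<eta> * (exp (- \<theta> * (x - a)) / \<theta>) \<le> A * \<eta> * exp (\<theta> * a) * ?P" for a
  proof -
    have "exp (\<theta>\<^sup>2 / 2) * \<eta> * (exp (- \<theta> * (x - a)) / \<theta>) = \<eta> / \<theta> * (exp (\<theta>\<^sup>2 / 2) * exp (- \<theta> * (x - a)))" by simp
    also have "\<dots> \<le> \<eta> / \<theta> * (exp (\<theta> * a) * (A * \<theta> * ?P))"
      using \<eta>0 \<theta> by (intro mult_left_mono A3) auto
    also have "\<dots> = A * \<eta> * exp (\<theta> * a) * ?P" using \<theta> by simp
    finally show ?thesis .
  qed
  have mN: "measure ?N {y<..} = normal_tail y" for y by (simp add: normal_tail_def)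
  show ?up
  proof -
    have "exp (- \<theta> * \<kappa>) * (1 - T) * measure ?G {x..} \<le> (\<integral>s. smooth_tail \<theta> \<delta> (x - \<kappa>) s \<partial>?G)"
      unfolding T_def using \<theta> by (intro G.measure_le_smooth_tail \<delta> \<kappa>) auto
    also have "\<dots> \<le> (\<integral>s. smooth_tail \<theta> \<delta> (x - \<kappa>) s \<partial>?N) + exp (\<theta>\<^sup>2 / 2) * \<eta> * (exp (- \<theta> * (x - \<kappa>)) / \<theta>)"
      using comp(1)[of "x - \<kappa>"] by linarith
    also have "\<dots> \<le> (\<integral>s. smooth_tail \<theta> \<delta> ((x - 2 * \<kappa>) + \<kappa>) s \<partial>?N) + A * \<eta> * exp (\<theta> * \<kappa>) * ?P"
      using err[of \<kappa>] by (simp add: algebra_simps)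
    also have "(\<integral>s. smooth_tail \<theta> \<delta> ((x - 2 * \<kappa>) + \<kappa>) s \<partial>?N) \<le> exp (\<theta>\<^sup>2 * \<delta>\<^sup>2 / 2) * normal_tail (x - 2 * \<kappa>)
       + exp (- \<theta> * (x - 2 * \<kappa>)) * T * exp (\<theta>\<^sup>2 / 2)"
      using N.smooth_tail_le_measure[OF \<delta> \<kappa>, of "x - 2 * \<kappa>"] \<theta> unfolding mN integral_exp_std_normal T_def by simp
    also have "exp (- \<theta> * (x - 2 * \<kappa>)) * T * exp (\<theta>\<^sup>2 / 2) \<le> A * (\<theta> * T) * exp (2 * (\<theta> * \<kappa>)) * ?P"
      using mult_left_mono[OF A3[of "2 * \<kappa>"] T0] by (simp add: mult_ac)
    also have "normal_tail (x - 2 * \<kappa>) \<le> (1 + 2 * A * (\<theta> * \<kappa>) * exp (2 * (\<theta> * \<kappa>))) * ?P"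
    proof -
      have "normal_tail (x - 2 * \<kappa>) \<le> ?P + 2 * \<kappa> * (exp (x * (2 * \<kappa>)) * exp (- x\<^sup>2 / 2))"
        using normal_tail_diff_left[OF x, of "2 * \<kappa>"] \<kappa> by simp
      also have "\<dots> \<le> ?P + 2 * \<kappa> * (exp (2 * (\<theta> * \<kappa>)) * (A * \<theta> * ?P))"
        using eP2 \<kappa> by (intro add_left_mono mult_left_mono mult_mono)
          (auto simp: \<theta>_def, smt (verit) exp_gt_zero)
      also have "\<dots> = (1 + 2 * A * (\<theta> * \<kappa>) * exp (2 * (\<theta> * \<kappa>))) * ?P" by (simp add: algebra_simps)
      finally show ?thesis .
    qed
    finally show ?thesis by (simp add: algebra_simps)
  qed
  show ?lo if T1: "T \<le> 1"
  proof -
    have N2: "normal_tail x \<le> measure ?N {x + 2 * \<kappa>..} + 2 * A * (\<theta> * \<kappa>) * ?P"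
    proof -
      have "normal_tail x \<le> normal_tail (x + 2 * \<kappa>) + 2 * \<kappa> * exp (- x\<^sup>2 / 2)"
        using normal_tail_diff_right[OF x, of "2 * \<kappa>"] \<kappa> by simp
      also have "normal_tail (x + 2 * \<kappa>) \<le> measure ?N {x + 2 * \<kappa>..}"
        unfolding normal_tail_def by (intro N.finite_measure_mono) auto
      also have "2 * \<kappa> * exp (- x\<^sup>2 / 2) = \<kappa> * (2 * exp (- x\<^sup>2 / 2))" by simp
      also have "\<dots> \<le> \<kappa> * (A * \<theta> * ?P)" using eP2 \<kappa> by (intro mult_left_mono) auto
      also have "\<dots> \<le> 2 * A * (\<theta> * \<kappa>) * ?P" using A0 \<theta> \<kappa> P0 by simp
      finally show ?thesis by simp
    qed
    have "exp (- \<theta> * \<kappa>) * (1 - T) * ((1 - 2 * A * (\<theta> * \<kappa>)) * ?P) \<le> exp (- \<theta> * \<kappa>) * (1 - T) * measure ?N {x + 2 * \<kappa>..}"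
      using N2 T1 by (intro mult_left_mono) (auto simp: algebra_simps)
    also have "\<dots> \<le> (\<integral>s. smooth_tail \<theta> \<delta> (x + 2 * \<kappa> - \<kappa>) s \<partial>?N)"
      unfolding T_def using \<theta> by (intro N.measure_le_smooth_tail \<delta> \<kappa>) auto
    also have "\<dots> = (\<integral>s. smooth_tail \<theta> \<delta> (x + \<kappa>) s \<partial>?N)"
    proof -
      have "x + 2 * \<kappa> - \<kappa> = x + \<kappa>" by simp
      then show ?thesis by (simp only:)
    qed
    also have "\<dots> \<le> (\<integral>s. smooth_tail \<theta> \<delta> (x + \<kappa>) s \<partial>?G) + exp (\<theta>\<^sup>2 / 2) * \<eta> * (exp (- \<theta> * (x - (- \<kappa>))) / \<theta>)"
      using comp(1)[of "x + \<kappa>"] by (simp add: abs_diff_le_iff)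
    also have "exp (\<theta>\<^sup>2 / 2) * \<eta> * (exp (- \<theta> * (x - (- \<kappa>))) / \<theta>) \<le> A * \<eta> * ?P"
    proof -
      have "A * \<eta> * exp (\<theta> * (- \<kappa>)) * ?P \<le> A * \<eta> * 1 * ?P"
        using A0 \<eta>0 P0 \<theta> \<kappa> by (intro mult_right_mono mult_left_mono) auto
      then show ?thesis using err[of "- \<kappa>"] by linarith
    qed
    also have "(\<integral>s. smooth_tail \<theta> \<delta> (x + \<kappa>) s \<partial>?G) \<le> exp (\<theta>\<^sup>2 * \<delta>\<^sup>2 / 2) * measure ?G {x<..}
       + exp (- \<theta> * x) * T * (\<integral>s. exp (\<theta> * s) \<partial>?G)"
      unfolding T_def using \<theta> by (intro G.smooth_tail_le_measure[OF \<delta> \<kappa>]) auto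
    also have "exp (- \<theta> * x) * T * (\<integral>s. exp (\<theta> * s) \<partial>?G) \<le> exp (- \<theta> * x) * T * (2 * exp (\<theta>\<^sup>2 / 2))"
      using T0 by (intro mult_left_mono integral_exp_trunc_sum_law_le[OF good]) auto
    also have "exp (- \<theta> * x) * T * (2 * exp (\<theta>\<^sup>2 / 2)) \<le> 2 * A * (\<theta> * T) * ?P"
      using mult_left_mono[OF A2 T0] by (simp add: mult_ac)
    finally show ?thesis by (simp add: algebra_simps)
  qed
qed

text \<open>
  With \<open>\<theta> = O (n powr (1 / 6))\<close>, the noise scale \<open>\<delta> = n powr (- 1 / 4)\<close> and the shift
  \<open>\<kappa> = n powr (- 5 / 24)\<close> satisfy all requirements: \<open>\<theta> * \<kappa>\<close> tends to zero, and so does \<open>\<theta>\<close> times the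
  noise probability bound \<open>T = 105 * (\<delta> / \<kappa>) ^ 8\<close>, while \<open>n * \<delta> ^ 3\<close> tends to infinity.
\<close>

lemma trunc_sum_law_tail_asymptotics:
  fixes x b :: "nat \<Rightarrow> real" and C e :: real
  assumes x: "\<And>n. x n \<ge> 0" and C0: "C \<ge> 0" and e: "e > 0"
    and C: "\<forall>\<^sub>F n in sequentially. (\<integral>y. indicator {-b n..b n} y * (\<bar>y\<bar> ^ 3 * exp ((x n + 1) / sqrt n * \<bar>y\<bar>)) \<partial>F) \<le> C"
    and \<tau>: "\<forall>\<^sub>F n in sequentially. (\<integral>y. indicator (- {-b n..b n}) y * (1 + \<bar>y\<bar> + y\<^sup>2) \<partial>F) \<le> 1 / (n * sqrt n)"
    and cube: "(\<lambda>n. (x n + 1) ^ 3 / sqrt n) \<longlonglongrightarrow> 0"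
  shows "\<forall>\<^sub>F n in sequentially. measure (trunc_sum_law (b n) n) {x n..} \<le> (1 + e) * normal_tail (x n)
     \<and> (1 - e) * normal_tail (x n) \<le> measure (trunc_sum_law (b n) n) {x n<..}"
proof -
  define \<theta> where "\<theta> n = x n + 1" for n
  define \<delta> \<kappa> T where "\<delta> n = real n powr (- 1 / 4)" and "\<kappa> n = real n powr (- 5 / 24)"
    and "T n = 105 * \<delta> n ^ 8 / \<kappa> n ^ 8" for n
  define A where "A = 2 / mills_const"
  define \<eta> where "\<eta> n = 6 * (C + 2) * \<theta> n ^ 3 / sqrt n * gauss_cubic_const + 3 * (64 * (C + 2))\<^sup>2 / (n * \<delta> n ^ 3)" for n
  have \<theta>1: "\<theta> n \<ge> 1" for n using x[of n] by (simp add: \<theta>_def)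
  have T_eq: "\<forall>\<^sub>F n in sequentially. T n = 105 * real n powr (- 1 / 3)"
    using eventually_gt_at_top[of 0]
  proof eventually_elim
    case (elim n)
    have "\<delta> n ^ 8 = real n powr (- 2)" "\<kappa> n ^ 8 = real n powr (- 5 / 3)"
      using elim by (simp_all add: \<delta>_def \<kappa>_def powr_power)
    then have "\<delta> n ^ 8 / \<kappa> n ^ 8 = real n powr (- 1 / 3)" by (simp flip: powr_diff)
    moreover have "T n = 105 * (\<delta> n ^ 8 / \<kappa> n ^ 8)" by (simp add: T_def)
    ultimately show ?case by (simp only:)
  qed
  have \<theta>_le: "\<forall>\<^sub>F n in sequentially. \<theta> n \<le> real n powr (1 / 6)"
    using order_tendstoD(2)[OF cube zero_less_one] eventually_gt_at_top[of 0]
  proof eventually_elim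
    case (elim n)
    then have "\<theta> n ^ 3 \<le> sqrt n" by (simp add: \<theta>_def)
    also have "\<dots> = (real n powr (1 / 6)) ^ 3"
      using elim by (simp add: powr_half_sqrt[symmetric] powr_power)
    finally show ?case using \<theta>1[of n] by (subst (asm) power_mono_iff) auto
  qed
  have small: "(\<lambda>n. \<theta> n * g n) \<longlonglongrightarrow> 0"
    if g: "\<And>n. g n \<ge> 0" "(\<lambda>n. real n powr (1 / 6) * g n) \<longlonglongrightarrow> 0" for g :: "nat \<Rightarrow> real"
  proof (rule Lim_null_comparison[OF _ g(2)])
    show "\<forall>\<^sub>F n in sequentially. norm (\<theta> n * g n) \<le> real n powr (1 / 6) * g n"
      using \<theta>_le
    proof eventually_elim
      case (elim n)
      then show ?case using \<theta>1[of n] g(1)[of n] by (auto simp: abs_mult intro!: mult_right_mono)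
    qed
  qed
  have l\<kappa>: "(\<lambda>n. \<theta> n * \<kappa> n) \<longlonglongrightarrow> 0"
    unfolding \<kappa>_def by (rule small) (simp, real_asymp)
  have l\<delta>: "(\<lambda>n. \<theta> n * \<delta> n) \<longlonglongrightarrow> 0"
    unfolding \<delta>_def by (rule small) (simp, real_asymp)
  have lT': "(\<lambda>n. 105 * real n powr (- 1 / 3)) \<longlonglongrightarrow> 0" by real_asymp
  have lT: "T \<longlonglongrightarrow> 0" using tendsto_cong[OF T_eq] lT' by simp
  have l\<theta>T: "(\<lambda>n. \<theta> n * T n) \<longlonglongrightarrow> 0"
  proof -
    have "(\<lambda>n. \<theta> n * (105 * real n powr (- 1 / 3))) \<longlonglongrightarrow> 0" by (rule small) (simp, real_asymp)
    moreover have "\<forall>\<^sub>F n in sequentially. \<theta> n * (105 * real n powr (- 1 / 3)) = \<theta> n * T n"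
      using T_eq by eventually_elim simp
    ultimately show ?thesis by (rule Lim_transform_eventually)
  qed
  have l\<eta>: "\<eta> \<longlonglongrightarrow> 0"
  proof -
    have 1: "(\<lambda>n. 3 * (64 * (C + 2))\<^sup>2 * real n powr (- 1 / 4)) \<longlonglongrightarrow> 0" by real_asymp
    have "(\<lambda>n. 6 * (C + 2) * gauss_cubic_const * (\<theta> n ^ 3 / sqrt n) + 3 * (64 * (C + 2))\<^sup>2 * real n powr (- 1 / 4)) \<longlonglongrightarrow> 6 * (C + 2) * gauss_cubic_const * 0 + 0"
      using cube unfolding \<theta>_def by (intro tendsto_intros 1)
    moreover have "\<forall>\<^sub>F n in sequentially. \<eta> n = 6 * (C + 2) * gauss_cubic_const * (\<theta> n ^ 3 / sqrt n) + 3 * (64 * (C + 2))\<^sup>2 * real n powr (- 1 / 4)"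
      using eventually_gt_at_top[of 0]
    proof eventually_elim
      case (elim n)
      have "real n * \<delta> n ^ 3 = real n powr 1 * real n powr (- 3 / 4)" using elim by (simp add: \<delta>_def powr_power)
      also have "\<dots> = real n powr (1 + - 3 / 4)" by (rule powr_add[symmetric])
      also have "\<dots> = real n powr (1 / 4)" by simp
      finally have "real n * \<delta> n ^ 3 = real n powr (1 / 4)" .
      then have "3 * (64 * (C + 2))\<^sup>2 / (n * \<delta> n ^ 3) = 3 * (64 * (C + 2))\<^sup>2 * real n powr (- 1 / 4)"
        by (simp add: powr_minus_divide)
      then show ?case by (simp add: \<eta>_def)
    qed
    ultimately show ?thesis by (simp add: tendsto_cong)
  qed
  define U where "U n = (exp ((\<theta> n * \<delta> n)\<^sup>2 / 2) * (1 + 2 * A * (\<theta> n * \<kappa> n) * exp (2 * (\<theta> n * \<kappa> n))) + A * (\<theta> n * T n) * exp (2 * (\<theta> n * \<kappa> n)) + A * \<eta> n * exp (\<theta> n * \<kappa> n))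
     / (exp (- (\<theta> n * \<kappa> n)) * (1 - T n))" for n
  define L where "L n = (exp (- (\<theta> n * \<kappa> n)) * (1 - T n) * (1 - 2 * A * (\<theta> n * \<kappa> n)) - 2 * A * (\<theta> n * T n) - A * \<eta> n) / exp ((\<theta> n * \<delta> n)\<^sup>2 / 2)" for n
  have "U \<longlonglongrightarrow> (exp (0\<^sup>2 / 2) * (1 + 2 * A * 0 * exp (2 * 0)) + A * 0 * exp (2 * 0) + A * 0 * exp 0) / (exp (- 0) * (1 - 0))"
    unfolding U_def by (intro tendsto_intros l\<kappa> l\<delta> lT l\<theta>T l\<eta>) auto
  then have U: "U \<longlonglongrightarrow> 1" by simp
  have "L \<longlonglongrightarrow> (exp (- 0) * (1 - 0) * (1 - 2 * A * 0) - 2 * A * 0 - A * 0) / exp (0\<^sup>2 / 2)"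
    unfolding L_def by (intro tendsto_intros l\<kappa> l\<delta> lT l\<theta>T l\<eta>) auto
  then have L: "L \<longlonglongrightarrow> 1" by simp
  have sm: "\<forall>\<^sub>F n in sequentially. 16 * (C + 2) * \<theta> n ^ 3 \<le> sqrt n"
  proof -
    have "(\<lambda>n. 16 * (C + 2) * (\<theta> n ^ 3 / sqrt n)) \<longlonglongrightarrow> 16 * (C + 2) * 0"
      using cube unfolding \<theta>_def by (intro tendsto_intros)
    then have "\<forall>\<^sub>F n in sequentially. 16 * (C + 2) * (\<theta> n ^ 3 / sqrt n) < 1"
      using order_tendstoD(2)[of _ "16 * (C + 2) * 0" _ 1] by auto
    then show ?thesis using eventually_gt_at_top[of 0]
      by eventually_elim (simp add: divide_less_eq)
  qed
  have "\<forall>\<^sub>F n in sequentially. U n < 1 + e" using order_tendstoD(2)[OF U, of "1 + e"] e by simp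
  moreover have "\<forall>\<^sub>F n in sequentially. 1 - e < L n" using order_tendstoD(1)[OF L, of "1 - e"] e by simp
  moreover have "\<forall>\<^sub>F n in sequentially. T n < 1" using order_tendstoD(2)[OF lT, of 1] by simp
  ultimately show ?thesis using C \<tau> sm eventually_ge_at_top[of 1]
  proof eventually_elim
    case (elim n)
    have \<delta>0: "\<delta> n > 0" "\<kappa> n > 0" using elim by (auto simp: \<delta>_def \<kappa>_def)
    let ?G = "trunc_sum_law (b n) n" and ?P = "normal_tail (x n)"
    have P0: "?P > 0" by (rule normal_tail_pos[OF x])
    have good: "truncation_good (b n) n (x n + 1) C"
      using elim(4,5,6,7) \<theta>1[of n] C0 unfolding truncation_good_def \<theta>_def by simp
    note bounds = trunc_sum_law_tail_bounds[OF good x[of n] \<delta>0, folded \<theta>_def, folded A_def T_def \<eta>_def]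
    have sq: "(\<theta> n)\<^sup>2 * (\<delta> n)\<^sup>2 = (\<theta> n * \<delta> n)\<^sup>2" by (simp add: power_mult_distrib)
    have m: "- \<theta> n * \<kappa> n = - (\<theta> n * \<kappa> n)" by simp
    have pos: "exp (- (\<theta> n * \<kappa> n)) * (1 - T n) > 0" using elim by simp
    have "measure ?G {x n..} \<le> U n * ?P"
      using bounds(1) pos unfolding sq m U_def by (simp add: pos_le_divide_eq mult.commute)
    also have "\<dots> \<le> (1 + e) * ?P" using elim P0 by (intro mult_right_mono) auto
    finally have 1: "measure ?G {x n..} \<le> (1 + e) * ?P" .
    have "(1 - e) * ?P \<le> L n * ?P" using elim P0 by (intro mult_right_mono) auto
    also have "\<dots> \<le> measure ?G {x n<..}"
      using bounds(2) elim(3) unfolding sq m L_def by (simp add: pos_divide_le_eq mult.commute)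
    finally show ?case using 1 by simp
  qed
qed

end

section \<open>Moderate deviations under the exponential moment condition\<close>

context linnik_growth begin

lemma h_abs_measurable: "(\<lambda>x. h \<bar>x\<bar>) \<in> borel_measurable borel"
proof -
  define g where "g x = (if x > 0 then h x else - 1)" for x
  have "mono g"
  proof (rule monoI)
    fix x y :: real assume "x \<le> y"
    then show "g x \<le> g y" using h_mono[of x y] h_pos[of y] by (auto simp: g_def)
  qed
  then have [measurable]: "g \<in> borel_measurable borel" by (rule borel_measurable_mono)
  have "(\<lambda>x. h \<bar>x\<bar>) = (\<lambda>x. if x = 0 then h 0 else g \<bar>x\<bar>)" by (auto simp: g_def)
  also have "\<dots> \<in> borel_measurable borel" by measurable
  finally show ?thesis .
qed

end

text \<open>
  A standardized distribution with a finite exponential moment of order \<open>h\<close>.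
\<close>

locale linnik_cramer = standardized_distribution F + linnik_growth h h' \<alpha> \<Lambda>
  for F :: "real measure" and h h' :: "real \<Rightarrow> real" and \<alpha> :: real and \<Lambda> :: "nat \<Rightarrow> real" +
  assumes exp_moment: "(\<integral>\<^sup>+x. ennreal (exp (h \<bar>x\<bar>)) \<partial>F) < \<infinity>"
begin

text \<open>
  The value of the exponential moment.
\<close>

definition "Eh = (\<integral>x. exp (h \<bar>x\<bar>) \<partial>F)"

lemma exp_moment_integrable: "integrable F (\<lambda>x. exp (h \<bar>x\<bar>))"
  using exp_moment h_abs_measurable by (intro integrableI_nonneg) auto

lemma Eh_nonneg: "Eh \<ge> 0" unfolding Eh_def by simp

lemma cube_le_exp_h: obtains K where "K \<ge> 1" "\<And>y. y > 0 \<Longrightarrow> y ^ 3 \<le> K * exp (h y / 4)"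
proof -
  obtain y0 where y0: "\<And>y. y \<ge> y0 \<Longrightarrow> 12 * ln y \<le> h y"
    using h_ge_ln[of 12] by (auto simp: eventually_at_top_linorder)
  define K where "K = (max y0 1) ^ 3"
  have "K \<ge> 1" by (simp add: K_def one_le_power)
  moreover have "y ^ 3 \<le> K * exp (h y / 4)" if y: "y > 0" for y
  proof (cases "y \<ge> y0")
    case True
    have "y ^ 3 = exp (3 * ln y)" using y by (simp add: exp_of_nat_mult[of 3, simplified])
    also have "\<dots> \<le> 1 * exp (h y / 4)" using y0[OF True] by simp
    also have "\<dots> \<le> K * exp (h y / 4)" using \<open>K \<ge> 1\<close> by (intro mult_right_mono) auto
    finally show ?thesis .
  next
    case False
    have "y ^ 3 \<le> K * 1" unfolding K_def mult_1_right using False y by (intro power_mono) auto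
    also have "\<dots> \<le> K * exp (h y / 4)" using \<open>K \<ge> 1\<close> h_pos[OF y] by (intro mult_left_mono) auto
    finally show ?thesis .
  qed
  ultimately show ?thesis using that by blast
qed

text \<open>
  The truncation level. The factor \<open>1 / 4\<close> is small enough to control the tilted moments and large
  enough to make jumps beyond the level negligible; both rest on \<open>4 powr (- \<alpha>) > 1 / 2\<close>.
\<close>

definition "bn n = xn n / 4"

lemma eventually_xn_gt: "\<forall>\<^sub>F n in sequentially. xn n > B"
  using xn_at_top by (auto simp: filterlim_at_top_dense)

lemma h_bn_ge: assumes "n \<ge> 1" "xn n > 4" shows "4 powr (- \<alpha>) * (\<Lambda> n)\<^sup>2 \<le> h (bn n)"
proof -
  have "h (xn n) \<le> (xn n / bn n) powr \<alpha> * h (bn n)"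
    using assms by (intro h_le_powr) (auto simp: bn_def)
  then have "(\<Lambda> n)\<^sup>2 \<le> 4 powr \<alpha> * h (bn n)" using assms by (simp add: h_xn bn_def)
  then show ?thesis by (simp add: powr_minus field_simps)
qed

lemma quarter_powr: "1 / 2 < 4 powr (- \<alpha>)"
proof -
  have a: "(4::real) powr (- (1 / 2)) = 1 / 2"
    using powr_half_sqrt[of 4] real_sqrt_unique[of 2 4] by (simp add: powr_minus_divide)
  have "(4::real) powr (- (1 / 2)) < 4 powr (- \<alpha>)" using \<alpha> by (intro powr_less_mono) auto
  then show ?thesis unfolding a .
qed

text \<open>
  Below the truncation level the tilt is dominated by \<open>3 / 4 * h\<close>, so the exponential moment controls
  the tilted third moment.
\<close>

lemma exp_slope_le:
  assumes n: "n \<ge> 1" "xn n > 4" and x: "0 < y" "y \<le> bn n" and \<theta>: "\<theta> \<le> 3 / 2 * \<Lambda> n"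
  shows "\<theta> / sqrt n * y \<le> 3 / 4 * h y"
proof -
  have b: "bn n > 1" using n by (simp add: bn_def)
  have "\<theta> / sqrt n \<le> 3 / 2 * \<Lambda> n / sqrt n" using \<theta> by (rule divide_right_mono) simp
  also have "\<dots> = 3 / 2 * (\<Lambda> n / sqrt n)" by simp
  also have "\<Lambda> n / sqrt n = (\<Lambda> n)\<^sup>2 / xn n"
    using n \<Lambda>_pos[of n] by (simp add: xn_def power2_eq_square)
  also have "(\<Lambda> n)\<^sup>2 / xn n \<le> 2 * h (bn n) / xn n"
  proof -
    have "1 / 2 * (\<Lambda> n)\<^sup>2 \<le> 4 powr (- \<alpha>) * (\<Lambda> n)\<^sup>2" using quarter_powr by (intro mult_right_mono) auto
    then show ?thesis using h_bn_ge[OF n] xn_pos[OF n(1)] by (intro divide_right_mono) auto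
  qed
  also have "2 * h (bn n) / xn n = 1 / 2 * (h (bn n) / bn n)" by (simp add: bn_def)
  also have "h (bn n) / bn n \<le> h y / y" using x by (intro h_over_id_mono)
  finally have "\<theta> / sqrt n \<le> 3 / 4 * (h y / y)" by simp
  then have "\<theta> / sqrt n * y \<le> 3 / 4 * (h y / y) * y" using x by (intro mult_right_mono) auto
  then show ?thesis using x by simp
qed

lemma markov_bound: assumes "b > 0" shows "measure F (- {-b..b}) \<le> Eh * exp (- h b)"
proof -
  have "measure F (- {-b..b}) = (\<integral>x. indicator (- {-b..b}) x \<partial>F)" by simp
  also have "\<dots> \<le> (\<integral>x. exp (- h b) * exp (h \<bar>x\<bar>) \<partial>F)"
  proof (rule integral_mono)
    show "integrable F (\<lambda>x. exp (- h b) * exp (h \<bar>x\<bar>))" using exp_moment_integrable by simp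
    show "integrable F (\<lambda>x. indicator (- {-b..b}) x :: real)"
      by (intro integrable_real_indicator) (auto simp: emeasure_eq_measure)
    fix x
    show "indicator (- {-b..b}) x \<le> exp (- h b) * exp (h \<bar>x\<bar>)"
    proof (cases "x \<in> {-b..b}")
      case False
      then have "h b \<le> h \<bar>x\<bar>" using assms by (intro h_mono) auto
      then show ?thesis using False by (simp flip: exp_add)
    qed simp
  qed
  finally show ?thesis by (simp add: Eh_def mult.commute)
qed

text \<open>
  The uniform statement below is proved along an arbitrary sequence of thresholds \<open>x n \<le> \<Lambda> n\<close>, which
  turns all estimates into limits.
\<close>

lemma sum_law_tail_sequence:
  fixes x :: "nat \<Rightarrow> real"
  assumes x: "\<And>n. x n \<ge> 0" and x\<Lambda>: "\<And>n. n \<ge> 1 \<Longrightarrow> x n \<le> \<Lambda> n" and e: "e > 0"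
  shows "\<forall>\<^sub>F n in sequentially. measure (sum_law n) {x n..} \<le> (1 + e) * normal_tail (x n)
     \<and> (1 - e) * normal_tail (x n) \<le> measure (sum_law n) {x n<..}"
proof -
  obtain K where K: "K \<ge> 1" "\<And>y. y > 0 \<Longrightarrow> y ^ 3 \<le> K * exp (h y / 4)" using cube_le_exp_h by blast
  have \<Lambda>2: "\<forall>\<^sub>F n in sequentially. \<Lambda> n > 2" using \<Lambda>_at_top by (auto simp: filterlim_at_top_dense)
  have cube: "(\<lambda>n. (x n + 1) ^ 3 / sqrt n) \<longlonglongrightarrow> 0"
  proof (rule Lim_null_comparison)
    have "(\<lambda>n. 8 * (\<Lambda> n ^ 3 / sqrt n)) \<longlonglongrightarrow> 8 * 0" by (intro tendsto_intros \<Lambda>_cube_over_sqrt)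
    then show "(\<lambda>n. 8 * (\<Lambda> n ^ 3 / sqrt n)) \<longlonglongrightarrow> 0" by simp
    show "\<forall>\<^sub>F n in sequentially. norm ((x n + 1) ^ 3 / sqrt n) \<le> 8 * (\<Lambda> n ^ 3 / sqrt n)"
      using \<Lambda>2 eventually_ge_at_top[of 1]
    proof eventually_elim
      case (elim n)
      have "(x n + 1) ^ 3 \<le> (2 * \<Lambda> n) ^ 3" using x[of n] x\<Lambda>[of n] elim by (intro power_mono) auto
      then show ?case using x[of n] by (simp add: power_mult_distrib divide_right_mono)
    qed
  qed
  \<comment> \<open>A quarter of \<open>h\<close> pays for the cube and the remaining three quarters for the tilt.\<close>
  have C: "\<forall>\<^sub>F n in sequentially. (\<integral>y. indicator {-bn n..bn n} y * (\<bar>y\<bar> ^ 3 * exp ((x n + 1) / sqrt n * \<bar>y\<bar>)) \<partial>F) \<le> K * Eh"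
    using \<Lambda>2 eventually_ge_at_top[of 1] eventually_xn_gt[of 4]
  proof eventually_elim
    case (elim n)
    have "(\<integral>y. indicator {-bn n..bn n} y * (\<bar>y\<bar> ^ 3 * exp ((x n + 1) / sqrt n * \<bar>y\<bar>)) \<partial>F) \<le> (\<integral>y. K * exp (h \<bar>y\<bar>) \<partial>F)"
    proof (rule integral_mono')
      show "integrable F (\<lambda>y. K * exp (h \<bar>y\<bar>))" using exp_moment_integrable by simp
      fix y
      show "0 \<le> K * exp (h \<bar>y\<bar>)" using K by simp
      show "indicator {-bn n..bn n} y * (\<bar>y\<bar> ^ 3 * exp ((x n + 1) / sqrt n * \<bar>y\<bar>)) \<le> K * exp (h \<bar>y\<bar>)"
      proof (cases "y \<in> {-bn n..bn n} \<and> y \<noteq> 0")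
        case True
        have "(x n + 1) / sqrt n * \<bar>y\<bar> \<le> 3 / 4 * h \<bar>y\<bar>"
          using elim True x\<Lambda>[of n] by (intro exp_slope_le) auto
        then have "\<bar>y\<bar> ^ 3 * exp ((x n + 1) / sqrt n * \<bar>y\<bar>) \<le> (K * exp (h \<bar>y\<bar> / 4)) * exp (3 / 4 * h \<bar>y\<bar>)"
          using K True by (intro mult_mono) auto
        also have "\<dots> = K * exp (h \<bar>y\<bar>)" by (simp add: mult.assoc flip: exp_add)
        finally show ?thesis using True by simp
      qed (use K in auto)
    qed
    then show ?case by (simp add: Eh_def)
  qed
  have \<tau>: "\<forall>\<^sub>F n in sequentially. (\<integral>y. indicator (- {-bn n..bn n}) y * (1 + \<bar>y\<bar> + y\<^sup>2) \<partial>F) \<le> 1 / (n * sqrt n)"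
  proof -
    have "(\<lambda>n. (real n * sqrt n) * real n powr (-3)) \<longlonglongrightarrow> 0" by real_asymp
    from tendsto_mult_right_zero[OF this, of "3 * (K * Eh)"]
    have lim: "(\<lambda>n. 3 * (K * Eh) * (real n * sqrt n) * real n powr (-3)) \<longlonglongrightarrow> 0"
      by (simp only: mult.assoc)
    have "\<forall>\<^sub>F n in sequentially. 3 * (K * Eh) * (real n * sqrt n) * real n powr (-3) < 1"
      using order_tendstoD(2)[OF lim, of 1] by simp
    then show ?thesis
      using eventually_ge_at_top[of 1] eventually_xn_gt[of 4] \<Lambda>_sq_ge_ln[of 8]
    proof eventually_elim
      case (elim n)
      have b1: "bn n > 1" using elim by (simp add: bn_def)
      have hb: "4 * ln n \<le> h (bn n)"
      proof -
        have "1 / 2 * (\<Lambda> n)\<^sup>2 \<le> 4 powr (- \<alpha>) * (\<Lambda> n)\<^sup>2" using quarter_powr by (intro mult_right_mono) auto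
        then show ?thesis using h_bn_ge[OF elim(2,3)] elim(4) by linarith
      qed
      have "(\<integral>y. indicator (- {-bn n..bn n}) y * (1 + \<bar>y\<bar> + y\<^sup>2) \<partial>F) \<le> (\<integral>y. (3 * K * exp (- (3 * ln n))) * exp (h \<bar>y\<bar>) \<partial>F)"
      proof (rule integral_mono')
        show "integrable F (\<lambda>y. (3 * K * exp (- (3 * ln n))) * exp (h \<bar>y\<bar>))"
          by (intro integrable_mult_right exp_moment_integrable)
        fix y
        show "0 \<le> (3 * K * exp (- (3 * ln n))) * exp (h \<bar>y\<bar>)" using K by simp
        show "indicator (- {-bn n..bn n}) y * (1 + \<bar>y\<bar> + y\<^sup>2) \<le> (3 * K * exp (- (3 * ln n))) * exp (h \<bar>y\<bar>)"
        proof (cases "y \<in> {-bn n..bn n}")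
          case False
          then have y: "\<bar>y\<bar> > bn n" by auto
          then have y1: "\<bar>y\<bar> \<ge> 1" using b1 by linarith
          have "h (bn n) \<le> h \<bar>y\<bar>" using y b1 by (intro h_mono) auto
          then have hy: "3 * ln n \<le> 3 / 4 * h \<bar>y\<bar>" using hb by linarith
          have "\<bar>y\<bar> \<le> \<bar>y\<bar> ^ 3" "\<bar>y\<bar>\<^sup>2 \<le> \<bar>y\<bar> ^ 3" "1 \<le> \<bar>y\<bar> ^ 3"
            using y1 self_le_power[of "\<bar>y\<bar>" 3] power_increasing[of 2 3 "\<bar>y\<bar>"] by auto
          then have "1 + \<bar>y\<bar> + y\<^sup>2 \<le> 3 * \<bar>y\<bar> ^ 3" by simp
          also have "\<dots> \<le> 3 * (K * exp (h \<bar>y\<bar> / 4))" using K(2)[of "\<bar>y\<bar>"] y1 by simp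
          also have "\<dots> \<le> 3 * (K * exp (h \<bar>y\<bar> - 3 * ln n))" using hy K by simp
          also have "\<dots> = (3 * K * exp (- (3 * ln n))) * exp (h \<bar>y\<bar>)"
            by (simp add: exp_diff exp_minus field_simps)
          finally show ?thesis using False by simp
        qed (use K in simp)
      qed
      also have "\<dots> = 3 * (K * Eh) * exp (- (3 * ln n))" by (simp add: Eh_def)
      also have "exp (- (3 * ln n)) = real n powr (- 3)" using elim by (simp add: powr_def)
      also have "3 * (K * Eh) * real n powr (- 3) \<le> 1 / (n * sqrt n)"
        using elim(1,2) by (simp add: field_simps)
      finally show ?case .
    qed
  qed
  have e2: "e / 2 > 0" using e by simp
  have KE: "K * Eh \<ge> 0" using K Eh_nonneg by simp
  note trunc = trunc_sum_law_tail_asymptotics[OF x KE e2 C \<tau> cube]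
  \<comment> \<open>The probability of a jump beyond the truncation level is smaller than the Gaussian tail at \<open>\<Lambda> n\<close> by a factor \<open>exp (- g * (\<Lambda> n)\<^sup>2)\<close>, up to polynomial factors.\<close>
  define g where "g = 4 powr (- \<alpha>) - 1 / 2"
  have g: "g > 0" using quarter_powr by (simp add: g_def)
  have "((\<lambda>t. (1 + t) * exp (- g / 2 * t\<^sup>2)) \<longlongrightarrow> 0) at_top" using g by real_asymp
  from filterlim_compose[OF this \<Lambda>_at_top]
  have "(\<lambda>n. (1 + \<Lambda> n) * exp (- g / 2 * (\<Lambda> n)\<^sup>2)) \<longlonglongrightarrow> 0" .
  from tendsto_mult_right_zero[OF this, of "Eh * 1 / mills_const"] e2
  have "\<forall>\<^sub>F n in sequentially. (Eh * 1 / mills_const) * ((1 + \<Lambda> n) * exp (- g / 2 * (\<Lambda> n)\<^sup>2)) < e / 2"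
    by (rule order_tendstoD(2))
  moreover have "\<forall>\<^sub>F n in sequentially. (2 / g) * ln n \<le> (\<Lambda> n)\<^sup>2" by (rule \<Lambda>_sq_ge_ln)
  ultimately have jump: "\<forall>\<^sub>F n in sequentially. n * measure F (- {-bn n..bn n}) \<le> e / 2 * normal_tail (x n)"
    using eventually_ge_at_top[of 1] eventually_xn_gt[of 4]
  proof eventually_elim
    case (elim n)
    have L: "\<Lambda> n > 0" using \<Lambda>_pos elim by auto
    have "n * measure F (- {-bn n..bn n}) \<le> n * (Eh * exp (- h (bn n)))"
      using elim by (intro mult_left_mono markov_bound) (auto simp: bn_def)
    also have "\<dots> \<le> exp (g / 2 * (\<Lambda> n)\<^sup>2) * (Eh * exp (- ((1/2 + g) * (\<Lambda> n)\<^sup>2)))"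
    proof (intro mult_mono mult_left_mono)
      have "ln n \<le> g / 2 * (\<Lambda> n)\<^sup>2" using elim(2) g by (simp add: field_simps)
      then have "exp (ln n) \<le> exp (g / 2 * (\<Lambda> n)\<^sup>2)" by (simp only: exp_le_cancel_iff)
      then show "real n \<le> exp (g / 2 * (\<Lambda> n)\<^sup>2)" using elim by simp
      show "exp (- h (bn n)) \<le> exp (- ((1/2 + g) * (\<Lambda> n)\<^sup>2))"
        using h_bn_ge[OF elim(3,4)] by (simp add: g_def)
    qed (use Eh_nonneg in auto)
    also have "\<dots> = Eh * exp (- g / 2 * (\<Lambda> n)\<^sup>2) * exp (- (\<Lambda> n)\<^sup>2 / 2)"
      by (simp add: algebra_simps flip: exp_add)
    also have "exp (- (\<Lambda> n)\<^sup>2 / 2) \<le> normal_tail (\<Lambda> n) * (1 + \<Lambda> n) / mills_const"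
      using normal_tail_lower[of "\<Lambda> n"] L mills_const_pos by (simp add: field_simps)
    also have "Eh * exp (- g / 2 * (\<Lambda> n)\<^sup>2) * (normal_tail (\<Lambda> n) * (1 + \<Lambda> n) / mills_const)
       = (Eh * 1 / mills_const) * ((1 + \<Lambda> n) * exp (- g / 2 * (\<Lambda> n)\<^sup>2)) * normal_tail (\<Lambda> n)" by simp
    also have "\<dots> \<le> e / 2 * normal_tail (\<Lambda> n)"
      using elim(1) normal_tail_pos[of "\<Lambda> n"] L by (intro mult_right_mono) auto
    also have "\<dots> \<le> e / 2 * normal_tail (x n)"
      using x\<Lambda>[of n] elim e by (intro mult_left_mono normal_tail_mono) auto
    finally show ?case using Eh_nonneg by (simp add: mult_left_mono)
  qed
  from trunc jump show ?thesis
  proof eventually_elim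
    case (elim n)
    have "measure (sum_law n) {x n..} \<le> measure (trunc_sum_law (bn n) n) {x n..} + n * measure F (- {-bn n..bn n})"
      by (rule measure_trunc_sum_law) simp
    also have "\<dots> \<le> (1 + e / 2) * normal_tail (x n) + e / 2 * normal_tail (x n)" using elim by linarith
    also have "\<dots> = (1 + e) * normal_tail (x n)" by (simp add: algebra_simps)
    finally have 1: "measure (sum_law n) {x n..} \<le> (1 + e) * normal_tail (x n)" .
    have "(1 - e) * normal_tail (x n) \<le> (1 - e / 2) * normal_tail (x n)"
      using e normal_tail_pos[OF x[of n]] by (intro mult_right_mono) auto
    also have "\<dots> \<le> measure (trunc_sum_law (bn n) n) {x n<..}" using elim by simp
    also have "\<dots> \<le> measure (sum_law n) {x n<..}" by (rule measure_trunc_sum_law) simp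
    finally show ?case using 1 by simp
  qed
qed

lemma sum_law_tail_uniform:
  assumes e: "e > 0"
  shows "\<forall>\<^sub>F n in sequentially. \<forall>x\<in>{0..\<Lambda> n}. measure (sum_law n) {x..} \<le> (1 + e) * normal_tail x
     \<and> (1 - e) * normal_tail x \<le> measure (sum_law n) {x<..}"
proof -
  define good where "good n x \<longleftrightarrow> measure (sum_law n) {x..} \<le> (1 + e) * normal_tail x
     \<and> (1 - e) * normal_tail x \<le> measure (sum_law n) {x<..}" for n x
  \<comment> \<open>A sequence of counterexamples, as long as there are any.\<close>
  define x where "x n = (if \<exists>x\<in>{0..\<Lambda> n}. \<not> good n x then SOME x. x \<in> {0..\<Lambda> n} \<and> \<not> good n x else 0)" for n
  have bad: "x n \<in> {0..\<Lambda> n} \<and> \<not> good n (x n)" if "\<exists>x\<in>{0..\<Lambda> n}. \<not> good n x" for n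
  proof -
    have "x n = (SOME x. x \<in> {0..\<Lambda> n} \<and> \<not> good n x)" unfolding x_def by (rule if_P[OF that])
    moreover have "(SOME x. x \<in> {0..\<Lambda> n} \<and> \<not> good n x) \<in> {0..\<Lambda> n} \<and> \<not> good n (SOME x. x \<in> {0..\<Lambda> n} \<and> \<not> good n x)"
      by (rule someI_ex) (use that in blast)
    ultimately show ?thesis by (simp only: simp_thms)
  qed
  have zero: "x n = 0" if "\<not> (\<exists>x\<in>{0..\<Lambda> n}. \<not> good n x)" for n
    unfolding x_def by (rule if_not_P[OF that])
  have "x n \<ge> 0" for n using bad[of n] zero[of n] by (cases "\<exists>x\<in>{0..\<Lambda> n}. \<not> good n x") auto
  moreover have "x n \<le> \<Lambda> n" if "n \<ge> 1" for n
    using bad[of n] zero[of n] \<Lambda>_pos[OF that] by (cases "\<exists>x\<in>{0..\<Lambda> n}. \<not> good n x") auto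
  ultimately have "\<forall>\<^sub>F n in sequentially. good n (x n)"
    unfolding good_def by (intro sum_law_tail_sequence e)
  then have "\<forall>\<^sub>F n in sequentially. \<forall>x\<in>{0..\<Lambda> n}. good n x"
    by eventually_elim (use bad in blast)
  then show ?thesis by (simp add: good_def)
qed

end

section \<open>Rectangles as products\<close>

lemma iid_array_indep_sums:
  fixes n :: nat
  assumes iid: "iid_array M n p X F"
  shows "prob_space.indep_vars M (\<lambda>_. borel) (\<lambda>j \<omega>. (\<Sum>i=1..n. X i j \<omega>) / sqrt n) {1..p}"
proof -
  interpret prob_space M using iid by (simp add: iid_array_def)
  let ?X = "\<lambda>(i, j). X i j"
  let ?K = "\<lambda>j. {1..n} \<times> {j}"
  have "indep_vars (\<lambda>_. borel) ?X ({1..n} \<times> {1..p})" using iid by (simp add: iid_array_def)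
  then have "indep_vars (\<lambda>j. PiM (?K j) (\<lambda>_. borel)) (\<lambda>j \<omega>. restrict (\<lambda>k. ?X k \<omega>) (?K j)) {1..p}"
    by (rule indep_vars_restrict) (auto simp: disjoint_family_on_def)
  then have "indep_vars (\<lambda>_. borel) (\<lambda>j \<omega>. (\<Sum>i=1..n. restrict (\<lambda>k. ?X k \<omega>) (?K j) (i, j)) / sqrt n) {1..p}"
    by (rule indep_vars_compose2[where Y="\<lambda>j f. (\<Sum>i=1..n. f (i, j)) / sqrt n"])
      (intro borel_measurable_divide borel_measurable_sum measurable_component_singleton, auto)
  moreover have "(\<Sum>i=1..n. restrict (\<lambda>k. ?X k \<omega>) (?K j) (i, j)) = (\<Sum>i=1..n. X i j \<omega>)" for j \<omega>
    by (intro sum.cong) auto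
  ultimately show ?thesis by simp
qed

lemma iid_array_indep_column:
  fixes n :: nat
  assumes iid: "iid_array M n p X F" and j: "j \<in> {1..p}"
  shows "prob_space.indep_vars M (\<lambda>_. borel) (\<lambda>i. X i j) {1..n}"
proof -
  interpret prob_space M using iid by (simp add: iid_array_def)
  let ?X = "\<lambda>(i, j). X i j"
  let ?K = "\<lambda>i. {(i, j)}"
  have "indep_vars (\<lambda>_. borel) ?X ({1..n} \<times> {1..p})" using iid by (simp add: iid_array_def)
  then have "indep_vars (\<lambda>i. PiM (?K i) (\<lambda>_. borel)) (\<lambda>i \<omega>. restrict (\<lambda>k. ?X k \<omega>) (?K i)) {1..n}"
    by (rule indep_vars_restrict) (use j in \<open>auto simp: disjoint_family_on_def\<close>)
  then have "indep_vars (\<lambda>_. borel) (\<lambda>i \<omega>. restrict (\<lambda>k. ?X k \<omega>) (?K i) (i, j)) {1..n}"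
    by (rule indep_vars_compose2[where Y="\<lambda>i f. f (i, j)"])
      (intro measurable_component_singleton, auto)
  then show ?thesis by simp
qed

lemma (in standardized_distribution) distr_normalized_sum:
  fixes n :: nat
  assumes n: "n \<ge> 1" and iid: "iid_array M n p X F" and j: "j \<in> {1..p}"
  shows "distr M borel (\<lambda>\<omega>. (\<Sum>i=1..n. X i j \<omega>) / sqrt n) = sum_law n"
proof -
  interpret M: prob_space M using iid by (simp add: iid_array_def)
  have ind: "M.indep_vars (\<lambda>_. borel) (\<lambda>i. X i j) {1..n}" by (rule iid_array_indep_column[OF iid j])
  then have m: "X i j \<in> borel_measurable M" if "i \<in> {1..n}" for i
    using that by (auto simp: M.indep_vars_def)
  have "distr M (PiM {1..n} (\<lambda>_. borel)) (\<lambda>\<omega>. \<lambda>i\<in>{1..n}. X i j \<omega>) = PiM {1..n} (\<lambda>i. distr M borel (X i j))"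
    using ind n m by (subst (asm) M.indep_vars_iff_distr_eq_PiM') auto
  also have "\<dots> = PiM {1..n} (\<lambda>_. F)"
    using iid j by (intro PiM_cong) (auto simp: iid_array_def)
  finally have eq: "distr M (PiM {1..n} (\<lambda>_. borel)) (\<lambda>\<omega>. \<lambda>i\<in>{1..n}. X i j \<omega>) = PiM {1..n} (\<lambda>_. F)" .
  have mm: "(\<lambda>\<omega>. \<lambda>i\<in>{1..n}. X i j \<omega>) \<in> measurable M (PiM {1..n} (\<lambda>_. borel))"
    using m by (intro measurable_restrict) auto
  have "sum_law n = distr (distr M (PiM {1..n} (\<lambda>_. borel)) (\<lambda>\<omega>. \<lambda>i\<in>{1..n}. X i j \<omega>)) borel (\<lambda>\<omega>. (\<Sum>i=1..n. \<omega> i) / sqrt n)"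
    unfolding sum_law_def eq ..
  also have "\<dots> = distr M borel ((\<lambda>\<omega>. (\<Sum>i=1..n. \<omega> i) / sqrt n) \<circ> (\<lambda>\<omega>. \<lambda>i\<in>{1..n}. X i j \<omega>))"
    by (rule distr_distr[OF _ mm]) measurable
  also have "\<dots> = distr M borel (\<lambda>\<omega>. (\<Sum>i=1..n. X i j \<omega>) / sqrt n)"
    by (rule distr_cong) auto
  finally show ?thesis by simp
qed

lemma (in standardized_distribution) prob_normalized_sum_box:
  fixes n :: nat
  assumes n: "n \<ge> 1" and p: "p \<ge> 1" and iid: "iid_array M n p X F"
    and B: "\<And>j. j \<in> {1..p} \<Longrightarrow> B j \<in> sets borel"
  shows "measure M {\<omega> \<in> space M. normalized_sum n p X \<omega> \<in> (\<Pi>\<^sub>E j\<in>{1..p}. B j)} = (\<Prod>j=1..p. measure (sum_law n) (B j))"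
proof -
  interpret M: prob_space M using iid by (simp add: iid_array_def)
  let ?T = "\<lambda>j \<omega>. (\<Sum>i=1..n. X i j \<omega>) / sqrt n"
  have ind: "M.indep_vars (\<lambda>_. borel) ?T {1..p}" by (rule iid_array_indep_sums[OF iid])
  then have m: "?T j \<in> borel_measurable M" if "j \<in> {1..p}" for j
    using that by (auto simp: M.indep_vars_def)
  have "{\<omega> \<in> space M. normalized_sum n p X \<omega> \<in> (\<Pi>\<^sub>E j\<in>{1..p}. B j)} = (\<Inter>j\<in>{1..p}. ?T j -` B j \<inter> space M)"
    using p by (auto simp: normalized_sum_def PiE_iff)
  also have "measure M \<dots> = (\<Prod>j=1..p. measure M (?T j -` B j \<inter> space M))"
    by (rule M.indep_varsD_finite[OF ind]) (use p B in auto)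
  also have "\<dots> = (\<Prod>j=1..p. measure (sum_law n) (B j))"
  proof (rule prod.cong[OF refl])
    fix j assume j: "j \<in> {1..p}"
    show "measure M (?T j -` B j \<inter> space M) = measure (sum_law n) (B j)"
      unfolding distr_normalized_sum[OF n iid j, symmetric]
      by (rule measure_distr[symmetric, OF m[OF j] B[OF j]])
  qed
  finally show ?thesis .
qed

lemma measure_std_gaussian_box:
  assumes "\<And>j. j \<in> {1..p} \<Longrightarrow> B j \<in> sets borel"
  shows "measure (std_gaussian p) (\<Pi>\<^sub>E j\<in>{1..p}. B j) = (\<Prod>j=1..p. measure std_normal_distribution (B j))"
proof -
  interpret N: prob_space std_normal_distribution by (rule prob_space_std_normal)
  interpret P: finite_product_prob_space "\<lambda>_. std_normal_distribution" "{1..p}"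
    by standard auto
  show ?thesis unfolding std_gaussian_def
    using assms by (subst P.prob_times) auto
qed

text \<open>
  A relative error \<open>\<epsilon>\<close> and an absolute error \<open>\<eta>\<close> in the factors' complements. If the sum \<open>V\<close> of the
  complements is at most \<open>1 / sqrt \<epsilon>\<close>, the errors add up to at most \<open>sqrt \<epsilon> + card J * \<eta>\<close>; otherwise both
  products are at most a multiple of \<open>exp (- V / 2)\<close>, hence of \<open>sqrt \<epsilon>\<close>.
\<close>

lemma prod_one_minus_diff_le:
  fixes u v :: "'i \<Rightarrow> real" and \<epsilon> \<eta> :: real
  assumes "finite J" and u: "\<And>j. j \<in> J \<Longrightarrow> 0 \<le> u j \<and> u j \<le> 1" and v: "\<And>j. j \<in> J \<Longrightarrow> 0 \<le> v j \<and> v j \<le> 1"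
    and d: "\<And>j. j \<in> J \<Longrightarrow> \<bar>u j - v j\<bar> \<le> \<epsilon> * v j + \<eta>" and \<epsilon>: "0 < \<epsilon>" "\<epsilon> \<le> 1 / 2"
    and \<eta>: "0 \<le> \<eta>" "card J * \<eta> \<le> 1"
  shows "\<bar>(\<Prod>j\<in>J. 1 - u j) - (\<Prod>j\<in>J. 1 - v j)\<bar> \<le> 8 * sqrt \<epsilon> + card J * \<eta>"
proof -
  define V where "V = (\<Sum>j\<in>J. v j)"
  have s: "sqrt \<epsilon> > 0" "sqrt \<epsilon> * sqrt \<epsilon> = \<epsilon>" using \<epsilon> by auto
  have V0: "V \<ge> 0" unfolding V_def using v by (intro sum_nonneg) auto
  show ?thesis
  proof (cases "V \<le> 1 / sqrt \<epsilon>")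
    case True
    have "\<bar>(\<Prod>j\<in>J. 1 - u j) - (\<Prod>j\<in>J. 1 - v j)\<bar> \<le> (\<Sum>j\<in>J. \<bar>(1 - u j) - (1 - v j)\<bar>)"
      using norm_prod_diff[of J "\<lambda>j. 1 - u j" "\<lambda>j. 1 - v j"] u v by auto
    also have "\<dots> \<le> (\<Sum>j\<in>J. \<epsilon> * v j + \<eta>)"
      using d by (intro sum_mono) (auto simp: abs_minus_commute)
    also have "\<dots> = \<epsilon> * V + card J * \<eta>" by (simp add: sum.distrib V_def sum_distrib_left)
    also have "\<epsilon> * V \<le> \<epsilon> * (1 / sqrt \<epsilon>)" using True \<epsilon> by (intro mult_left_mono) auto
    also have "\<epsilon> * (1 / sqrt \<epsilon>) = sqrt \<epsilon>" using s by (simp add: field_simps)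
    finally show ?thesis using s by linarith
  next
    case False
    have e1: "exp (- V / 2) \<le> 2 * sqrt \<epsilon>"
    proof -
      have "1 / (2 * sqrt \<epsilon>) \<le> V / 2" using False by simp
      also have "\<dots> \<le> exp (V / 2)" using exp_ge_add_one_self[of "V / 2"] by linarith
      finally have "1 / exp (V / 2) \<le> 1 / (1 / (2 * sqrt \<epsilon>))"
        using s by (intro divide_left_mono) auto
      then show ?thesis using s by (simp add: exp_minus inverse_eq_divide)
    qed
    have pv: "(\<Prod>j\<in>J. 1 - v j) \<le> 2 * sqrt \<epsilon>"
    proof -
      have "(\<Prod>j\<in>J. 1 - v j) \<le> (\<Prod>j\<in>J. exp (- v j))"
        using v exp_ge_add_one_self[of "- v _"] by (intro prod_mono) auto
      also have "\<dots> = exp (- V)" using \<open>finite J\<close> by (simp add: V_def exp_sum[symmetric] sum_negf)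
      also have "\<dots> \<le> exp (- V / 2)" using V0 by simp
      finally show ?thesis using e1 by linarith
    qed
    have pu: "(\<Prod>j\<in>J. 1 - u j) \<le> 6 * sqrt \<epsilon>"
    proof -
      have "(\<Prod>j\<in>J. 1 - u j) \<le> (\<Prod>j\<in>J. exp (- u j))"
        using u exp_ge_add_one_self[of "- u _"] by (intro prod_mono) auto
      also have "\<dots> = exp (- (\<Sum>j\<in>J. u j))" using \<open>finite J\<close> by (simp add: exp_sum[symmetric] sum_negf)
      also have "\<dots> \<le> exp (1 + - V / 2)"
      proof -
        have "(\<Sum>j\<in>J. v j / 2 - \<eta>) \<le> (\<Sum>j\<in>J. u j)"
        proof (rule sum_mono)
          fix j assume j: "j \<in> J"
          have "\<epsilon> * v j \<le> 1 / 2 * v j" using \<epsilon> v[OF j] by (intro mult_right_mono) auto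
          then show "v j / 2 - \<eta> \<le> u j" using d[OF j] by linarith
        qed
        also have "(\<Sum>j\<in>J. v j / 2 - \<eta>) = V / 2 - card J * \<eta>"
          by (simp add: sum_subtractf V_def sum_divide_distrib)
        finally show ?thesis using \<eta> by simp
      qed
      also have "\<dots> = exp 1 * exp (- V / 2)" by (rule exp_add)
      also have "\<dots> \<le> 3 * (2 * sqrt \<epsilon>)" using exp_le e1 by (intro mult_mono) auto
      finally show ?thesis by simp
    qed
    have "0 \<le> (\<Prod>j\<in>J. 1 - u j)" "0 \<le> (\<Prod>j\<in>J. 1 - v j)" using u v by (auto intro!: prod_nonneg)
    moreover have "0 \<le> card J * \<eta>" using \<eta> by simp
    ultimately show ?thesis using pu pv s by linarith
  qed
qed

text \<open>
  The upper tail of \<open>S\<close> agrees with the Gaussian tail up to a relative error \<open>\<epsilon>\<close> on \<open>{0..L}\<close>. Closed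
  half-lines in the upper bound and open ones in the lower bound cover both kinds.
\<close>

definition tail_close :: "real measure \<Rightarrow> real \<Rightarrow> real \<Rightarrow> bool" where
  "tail_close S L \<epsilon> \<longleftrightarrow> (\<forall>x\<in>{0..L}. measure S {x..} \<le> (1 + \<epsilon>) * normal_tail x \<and> (1 - \<epsilon>) * normal_tail x \<le> measure S {x<..})"

text \<open>
  The distribution of \<open>- X\<close> when \<open>X\<close> has distribution \<open>F\<close>.
\<close>

definition reflect :: "real measure \<Rightarrow> real measure" where
  "reflect F = distr F borel uminus"

lemma reflect_reflect: assumes "real_distribution F" shows "reflect (reflect F) = F"
proof -
  interpret real_distribution F by fact
  have "distr (distr F borel uminus) borel uminus = distr F borel (uminus \<circ> uminus)" by (rule distr_distr) auto
  also have "\<dots> = distr F F (\<lambda>x. x)" by (rule distr_cong) auto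
  finally show ?thesis by (simp add: reflect_def)
qed

lemma measure_reflect:
  assumes "real_distribution F" "A \<in> sets borel"
  shows "measure (reflect F) A = measure F (uminus ` A)"
proof -
  interpret real_distribution F by fact
  have "measure (reflect F) A = measure F (uminus -` A \<inter> space F)"
    unfolding reflect_def using assms by (intro measure_distr) auto
  also have "uminus -` A \<inter> space F = uminus ` A"
  proof (intro set_eqI iffI)
    fix x assume "x \<in> uminus -` A \<inter> space F"
    then show "x \<in> uminus ` A" by (intro image_eqI[of _ _ "- x"]) auto
  qed auto
  finally show ?thesis .
qed

lemma normal_tail_reflect: "measure std_normal_distribution {..<a} = normal_tail (- a)"
proof -
  have "measure std_normal_distribution {..<a} = (\<integral>s. indicator {..<a} s * std_normal_density s \<partial>lborel)"
    by (rule measure_std_normal_eq) auto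
  also have "\<dots> = (\<integral>s. indicator {..<a} (0 + - 1 * s) * std_normal_density (0 + - 1 * s) \<partial>lborel)"
    by (subst lborel_integral_real_affine[of "- 1" _ 0]) auto
  also have "\<dots> = (\<integral>s. indicator {- a<..} s * std_normal_density s \<partial>lborel)"
    by (intro Bochner_Integration.integral_cong) (auto simp: indicator_def std_normal_density_def)
  also have "\<dots> = normal_tail (- a)"
    unfolding normal_tail_def by (rule measure_std_normal_eq[symmetric]) auto
  finally show ?thesis .
qed

lemma measure_std_normal_singleton: "measure std_normal_distribution {a} = 0"
proof -
  have "measure std_normal_distribution {a} = (\<integral>s. indicator {a} s * std_normal_density s \<partial>lborel)"
    by (rule measure_std_normal_eq) auto
  also have "\<dots> = 0"
    using AE_lborel_singleton[of a] by (intro integral_eq_zero_AE) (auto elim!: eventually_mono)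
  finally show ?thesis .
qed

lemma normal_tail_minus: "normal_tail (- c) = 1 - normal_tail c"
proof -
  interpret N: prob_space std_normal_distribution by (rule prob_space_std_normal)
  have "normal_tail (- c) = N.prob {..<c}" by (rule normal_tail_reflect[symmetric])
  also have "\<dots> = N.prob {..c}"
  proof -
    have "N.prob ({..<c} \<union> {c}) = N.prob {..<c} + N.prob {c}" by (rule N.finite_measure_Union) auto
    moreover have "{..<c} \<union> {c} = {..c}" by auto
    ultimately show ?thesis by (simp add: measure_std_normal_singleton)
  qed
  also have "\<dots> = 1 - N.prob (UNIV - {..c})" using N.prob_compl[of "{..c}"] by simp
  also have "UNIV - {..c} = {c<..}" by auto
  finally show ?thesis by (simp add: normal_tail_def)
qed

text \<open>
  The comparison extends to every threshold: beyond \<open>L\<close> by monotonicity, at the cost of a multiple of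
  the tail at \<open>L\<close>, and to negative thresholds by passing to the reflected law.
\<close>

lemma tail_close_all:
  assumes S: "real_distribution S" and R: "R = reflect S"
    and close: "tail_close S L \<epsilon>" "tail_close R L \<epsilon>" and L: "L \<ge> 0" and \<epsilon>: "0 \<le> \<epsilon>" "\<epsilon> \<le> 1"
  shows "\<bar>measure S {b<..} - normal_tail b\<bar> \<le> \<epsilon> * normal_tail b + 2 * normal_tail L"
proof -
  interpret S: real_distribution S by fact
  have "prob_space R" unfolding R reflect_def by (rule S.prob_space_distr) measurable
  then interpret R: prob_space R .
  have sR [simp]: "sets R = sets borel" by (simp add: R reflect_def)
  have L2: "(1 + \<epsilon>) * normal_tail L \<le> 2 * normal_tail L"
    using \<epsilon> normal_tail_pos[OF L] by (intro mult_right_mono) auto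
  have P: "normal_tail L > 0" by (rule normal_tail_pos[OF L])
  have pos: "\<bar>m - normal_tail b\<bar> \<le> \<epsilon> * normal_tail b + 2 * normal_tail L"
    if Q: "prob_space Q" "sets Q = sets borel" and c: "tail_close Q L \<epsilon>" and b: "b \<ge> 0" and m: "measure Q {b<..} \<le> m" "m \<le> measure Q {b..}" for Q m b
  proof (cases "b \<le> L")
    case True
    then have "m \<le> (1 + \<epsilon>) * normal_tail b" "(1 - \<epsilon>) * normal_tail b \<le> m"
      using c b m unfolding tail_close_def by force+
    then show ?thesis using P by (simp add: algebra_simps abs_le_iff)
  next
    case False
    interpret Q: prob_space Q by fact
    have "m \<le> measure Q {b..}" by fact
    also have "\<dots> \<le> measure Q {L..}" using False Q by (intro Q.finite_measure_mono) auto
    also have "\<dots> \<le> (1 + \<epsilon>) * normal_tail L" using c L unfolding tail_close_def by auto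
    finally have 1: "m \<le> 2 * normal_tail L" using L2 by linarith
    have 2: "normal_tail b \<le> normal_tail L" using False by (intro normal_tail_mono) auto
    have "0 \<le> m" using m(1) measure_nonneg[of Q "{b<..}"] by linarith
    moreover have "0 \<le> \<epsilon> * normal_tail b" using \<epsilon> normal_tail_pos[OF b] by simp
    ultimately show ?thesis using 1 2 P normal_tail_pos[OF b] by linarith
  qed
  show ?thesis
  proof (cases "b \<ge> 0")
    case True
    then show ?thesis
      by (intro pos[OF S.prob_space_axioms S.events_eq_borel close(1)] S.finite_measure_mono) auto
  next
    case False
    have "measure R {- b..} = measure S (uminus -` {- b..} \<inter> space S)"
      unfolding R reflect_def by (rule measure_distr) auto
    also have "uminus -` {- b..} \<inter> space S = UNIV - {b<..}" by auto
    also have "measure S (UNIV - {b<..}) = 1 - measure S {b<..}"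
      using S.prob_compl[of "{b<..}"] by simp
    finally have 1: "measure S {b<..} = 1 - measure R {- b..}" by simp
    have "\<bar>measure R {- b..} - normal_tail (- b)\<bar> \<le> \<epsilon> * normal_tail (- b) + 2 * normal_tail L"
      using False by (intro pos[OF R.prob_space_axioms sR close(2)] R.finite_measure_mono) auto
    moreover have "\<epsilon> * normal_tail (- b) \<le> \<epsilon> * normal_tail b"
      using \<epsilon> False by (intro mult_left_mono normal_tail_mono) auto
    moreover have "normal_tail (- b) = 1 - normal_tail b" by (rule normal_tail_minus)
    ultimately show ?thesis unfolding 1 by linarith
  qed
qed

text \<open>
  The complement of an interval with possibly infinite endpoints consists of two disjoint half-lines, each
  of which may also be empty or the whole line.
\<close>

lemma tail_close_interval:
  fixes a b :: ereal
  assumes S: "real_distribution S" and R: "R = reflect S"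
    and close: "tail_close S L \<epsilon>" "tail_close R L \<epsilon>" and L: "L \<ge> 0" and \<epsilon>: "0 \<le> \<epsilon>" "\<epsilon> \<le> 1"
    and ab: "a \<le> b"
  defines "I \<equiv> ereal -` {a..b}"
  shows "\<bar>(1 - measure S I) - (1 - measure std_normal_distribution I)\<bar> \<le> \<epsilon> * (1 - measure std_normal_distribution I) + 4 * normal_tail L"
proof -
  interpret S: real_distribution S by fact
  interpret N: prob_space std_normal_distribution by (rule prob_space_std_normal)
  let ?N = std_normal_distribution
  have P: "normal_tail L > 0" by (rule normal_tail_pos[OF L])
  have RR: "real_distribution R"
    unfolding R reflect_def real_distribution_def real_distribution_axioms_def by (auto intro!: S.prob_space_distr)
  have SR: "S = reflect R" unfolding R by (rule reflect_reflect[OF S, symmetric])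
  define A where "A = {t. ereal t < a}"
  define B where "B = {t. b < ereal t}"
  have [measurable]: "A \<in> sets borel" "B \<in> sets borel" unfolding A_def B_def by measurable
  have disj: "A \<inter> B = {}" using ab by (auto simp: A_def B_def)
  have compl: "1 - measure Q I = measure Q A + measure Q B" if "prob_space Q" "sets Q = sets borel" for Q
  proof -
    interpret Q: prob_space Q by fact
    have sp: "space Q = UNIV" using sets_eq_imp_space_eq[OF that(2)] by simp
    have "I = space Q - (A \<union> B)" by (auto simp: I_def A_def B_def sp)
    then have "measure Q I = 1 - measure Q (A \<union> B)" using that(2) by (simp add: Q.prob_compl)
    also have "measure Q (A \<union> B) = measure Q A + measure Q B"
      using disj that(2) by (intro Q.finite_measure_Union) auto
    finally show ?thesis by simp
  qed
  have B: "\<bar>measure S B - measure ?N B\<bar> \<le> \<epsilon> * measure ?N B + 2 * normal_tail L"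
  proof (cases b)
    case (real r)
    then have "B = {r<..}" by (auto simp: B_def)
    then show ?thesis using tail_close_all[OF S R close L \<epsilon>, of r] by (simp add: normal_tail_def)
  next
    case PInf
    then have "B = {}" by (auto simp: B_def)
    then show ?thesis using P by simp
  next
    case MInf
    then have "B = UNIV" by (auto simp: B_def)
    then show ?thesis using P \<epsilon> S.prob_space N.prob_space by simp
  qed
  have A: "\<bar>measure S A - measure ?N A\<bar> \<le> \<epsilon> * measure ?N A + 2 * normal_tail L"
  proof (cases a)
    case (real r)
    then have Ar: "A = {..<r}" by (auto simp: A_def)
    have "measure R {- r<..} = measure S (uminus -` {- r<..} \<inter> space S)"
      unfolding R reflect_def by (rule measure_distr) auto
    also have "uminus -` {- r<..} \<inter> space S = {..<r}" by auto
    finally have "measure S {..<r} = measure R {- r<..}" by simp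
    then show ?thesis using tail_close_all[OF RR SR close(2,1) L \<epsilon>, of "- r"]
      unfolding Ar normal_tail_reflect by simp
  next
    case MInf
    then have "A = {}" by (auto simp: A_def)
    then show ?thesis using P by simp
  next
    case PInf
    then have "A = UNIV" by (auto simp: A_def)
    then show ?thesis using P \<epsilon> S.prob_space N.prob_space by simp
  qed
  have eqS: "1 - measure S I = measure S A + measure S B" by (intro compl S.prob_space_axioms S.events_eq_borel)
  have eqN: "1 - measure ?N I = measure ?N A + measure ?N B" by (intro compl N.prob_space_axioms) simp
  show ?thesis unfolding eqS eqN distrib_left using A B by linarith
qed

section \<open>Sufficiency\<close>

text \<open>
  A bound for all members is needed even for non-negativity, because the supremum of an unbounded set of reals
  is unspecified.
\<close>

lemma gauss_approx_error_bounds: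
  assumes ne: "\<A> \<noteq> {}" and le: "\<And>A. A \<in> \<A> \<Longrightarrow> \<bar>measure M {\<omega> \<in> space M. normalized_sum n p X \<omega> \<in> A} - measure (std_gaussian p) A\<bar> \<le> B"
  shows "0 \<le> gauss_approx_error M n p X \<A>" and "gauss_approx_error M n p X \<A> \<le> B"
    and "A \<in> \<A> \<Longrightarrow> \<bar>measure M {\<omega> \<in> space M. normalized_sum n p X \<omega> \<in> A} - measure (std_gaussian p) A\<bar> \<le> gauss_approx_error M n p X \<A>"
proof -
  let ?d = "\<lambda>A. \<bar>measure M {\<omega> \<in> space M. normalized_sum n p X \<omega> \<in> A} - measure (std_gaussian p) A\<bar>"
  have bdd: "bdd_above (?d ` \<A>)" using le by (intro bdd_aboveI2) auto
  show "gauss_approx_error M n p X \<A> \<le> B" unfolding gauss_approx_error_def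
    by (rule cSUP_least[OF ne]) (rule le)
  show up: "?d A \<le> gauss_approx_error M n p X \<A>" if "A \<in> \<A>" for A
    unfolding gauss_approx_error_def by (rule cSUP_upper[OF that bdd])
  obtain A where "A \<in> \<A>" using ne by auto
  then show "0 \<le> gauss_approx_error M n p X \<A>" using up[of A] by linarith
qed

lemma standardized_reflect:
  assumes "standardized_distribution F" shows "standardized_distribution (reflect F)"
proof -
  interpret standardized_distribution F by fact
  have "prob_space (reflect F)" unfolding reflect_def by (rule prob_space_distr) auto
  then interpret R: prob_space "reflect F" .
  have um: "(uminus :: real \<Rightarrow> real) \<in> measurable F borel" by simp
  have id: "(\<lambda>x::real. x) \<in> borel_measurable borel" and sq: "(\<lambda>x::real. x\<^sup>2) \<in> borel_measurable borel"
    by simp_all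
  have sets: "sets (reflect F) = sets borel" by (simp add: reflect_def)
  have m1: "integrable (reflect F) (\<lambda>x. x)"
    unfolding reflect_def integrable_distr_eq[OF um id]
    by (rule Bochner_Integration.integrable_minus[OF mean_integrable])
  have m2: "(\<integral>x. x \<partial>reflect F) = 0"
    unfolding reflect_def integral_distr[OF um id] by (simp add: mean_zero)
  have m3: "integrable (reflect F) (\<lambda>x. x\<^sup>2)"
    unfolding reflect_def integrable_distr_eq[OF um sq] by (simp add: var_integrable)
  have m4: "(\<integral>x. x\<^sup>2 \<partial>reflect F) = 1"
    unfolding reflect_def integral_distr[OF um sq] by (simp add: var_one)
  show ?thesis
    by (intro standardized_distribution.intro real_distribution.intro real_distribution_axioms.intro
        standardized_distribution_axioms.intro R.prob_space_axioms sets m1 m2 m3 m4)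
qed

lemma linnik_cramer_reflect:
  assumes "linnik_cramer F h h' \<alpha> \<Lambda>" shows "linnik_cramer (reflect F) h h' \<alpha> \<Lambda>"
proof -
  interpret linnik_cramer F h h' \<alpha> \<Lambda> by fact
  have "(\<integral>\<^sup>+x. ennreal (exp (h \<bar>x\<bar>)) \<partial>reflect F) = (\<integral>\<^sup>+x. ennreal (exp (h \<bar>x\<bar>)) \<partial>F)"
    unfolding reflect_def using h_abs_measurable by (subst nn_integral_distr) auto
  then show ?thesis
    using exp_moment
    by (intro linnik_cramer.intro standardized_reflect[OF standardized_distribution_axioms] linnik_growth_axioms
        linnik_cramer_axioms.intro) (simp only:)
qed

lemma iid_array_reflect:
  assumes "iid_array M n p X F"
  shows "iid_array M n p (\<lambda>i j \<omega>. - X i j \<omega>) (reflect F)"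
proof -
  interpret prob_space M using assms by (simp add: iid_array_def)
  have ind: "indep_vars (\<lambda>_. borel) (\<lambda>(i, j). X i j) ({1..n} \<times> {1..p})" using assms by (simp add: iid_array_def)
  have "indep_vars (\<lambda>_. borel) (\<lambda>k \<omega>. - (case k of (i, j) \<Rightarrow> X i j) \<omega>) ({1..n} \<times> {1..p})"
    by (rule indep_vars_compose2[OF ind, where Y="\<lambda>_ x. - x"]) auto
  also have "(\<lambda>k \<omega>. - (case k of (i, j) \<Rightarrow> X i j) \<omega>) = (\<lambda>(i, j) \<omega>. - X i j \<omega>)" by auto
  finally have 1: "indep_vars (\<lambda>_. borel) (\<lambda>(i, j) \<omega>. - X i j \<omega>) ({1..n} \<times> {1..p})" .
  have 2: "distr M borel (\<lambda>\<omega>. - X i j \<omega>) = reflect F" if ij: "i \<in> {1..n}" "j \<in> {1..p}" for i j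
  proof -
    have m: "X i j \<in> borel_measurable M" using ind ij by (auto simp: indep_vars_def)
    have "reflect F = distr (distr M borel (X i j)) borel uminus"
      using assms ij by (simp add: reflect_def iid_array_def)
    also have "\<dots> = distr M borel (uminus \<circ> X i j)" by (rule distr_distr) (use m in auto)
    finally show ?thesis by (simp add: comp_def)
  qed
  show ?thesis unfolding iid_array_def using 1 2 prob_space_axioms by auto
qed

lemma real_distribution_sum_law:
  assumes "standardized_distribution F" shows "real_distribution (standardized_distribution.sum_law F n)"
proof -
  interpret standardized_distribution F by fact
  show ?thesis unfolding real_distribution_def real_distribution_axioms_def
    using prob_space_sum_law by simp
qed

lemma sum_law_reflect:
  assumes F: "standardized_distribution F" and n: "n \<ge> 1" and iid: "iid_array M n p X F" and p: "p \<ge> 1"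
  shows "standardized_distribution.sum_law (reflect F) n = reflect (standardized_distribution.sum_law F n)"
proof -
  interpret F: standardized_distribution F by fact
  interpret R: standardized_distribution "reflect F" by (rule standardized_reflect[OF F])
  interpret M: prob_space M using iid by (simp add: iid_array_def)
  have j: "1 \<in> {1..p}" using p by simp
  have m: "(\<lambda>\<omega>. (\<Sum>i=1..n. X i 1 \<omega>) / sqrt n) \<in> borel_measurable M"
    using iid_array_indep_sums[OF iid] j by (auto simp: M.indep_vars_def)
  have "R.sum_law n = distr M borel (\<lambda>\<omega>. (\<Sum>i=1..n. - X i 1 \<omega>) / sqrt n)"
    by (rule R.distr_normalized_sum[OF n iid_array_reflect[OF iid] j, symmetric])
  also have "\<dots> = distr M borel (uminus \<circ> (\<lambda>\<omega>. (\<Sum>i=1..n. X i 1 \<omega>) / sqrt n))"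
    by (rule distr_cong) (auto simp: sum_negf)
  also have "\<dots> = distr (distr M borel (\<lambda>\<omega>. (\<Sum>i=1..n. X i 1 \<omega>) / sqrt n)) borel uminus"
    by (rule distr_distr[symmetric]) (use m in auto)
  also have "distr M borel (\<lambda>\<omega>. (\<Sum>i=1..n. X i 1 \<omega>) / sqrt n) = F.sum_law n"
    by (rule F.distr_normalized_sum[OF n iid j])
  finally show ?thesis by (simp add: reflect_def)
qed

lemma hyper_rectangle_error_le:
  fixes \<epsilon> L :: real
  assumes F: "standardized_distribution F" and n: "n \<ge> 1" and p: "p \<ge> 1" and iid: "iid_array M n p X F"
    and close: "tail_close (standardized_distribution.sum_law F n) L \<epsilon>"
      "tail_close (standardized_distribution.sum_law (reflect F) n) L \<epsilon>"
    and L: "L \<ge> 0" and \<epsilon>: "0 < \<epsilon>" "\<epsilon> \<le> 1 / 2" and p1: "p * (4 * normal_tail L) \<le> 1"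
  shows "0 \<le> gauss_approx_error M n p X (hyper_rectangles p)"
    and "gauss_approx_error M n p X (hyper_rectangles p) \<le> 8 * sqrt \<epsilon> + p * (4 * normal_tail L)"
proof -
  interpret F: standardized_distribution F by fact
  let ?S = "F.sum_law n" and ?N = std_normal_distribution
  interpret S: real_distribution ?S by (rule real_distribution_sum_law[OF F])
  interpret N: prob_space ?N by (rule prob_space_std_normal)
  have R: "standardized_distribution.sum_law (reflect F) n = reflect ?S"
    by (rule sum_law_reflect[OF F n iid p])
  have ne: "hyper_rectangles p \<noteq> {}" unfolding hyper_rectangles_def
    by (auto intro!: exI[of _ "\<lambda>_. 0"])
  have le: "\<bar>measure M {\<omega> \<in> space M. normalized_sum n p X \<omega> \<in> A} - measure (std_gaussian p) A\<bar> \<le> 8 * sqrt \<epsilon> + p * (4 * normal_tail L)"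
    if A_in: "A \<in> hyper_rectangles p" for A
  proof -
    obtain a b where A: "A = (\<Pi>\<^sub>E j\<in>{1..p}. ereal -` {a j..b j})" and ab: "\<And>j. j \<in> {1..p} \<Longrightarrow> a j \<le> b j"
      using A_in unfolding hyper_rectangles_def by blast
    let ?I = "\<lambda>j. ereal -` {a j..b j}"
    have m: "?I j \<in> sets borel" for j
      using measurable_sets[of ereal borel borel "{a j..b j}"] by simp
    have "measure M {\<omega> \<in> space M. normalized_sum n p X \<omega> \<in> A} = (\<Prod>j\<in>{1..p}. 1 - (1 - measure ?S (?I j)))"
      unfolding A F.prob_normalized_sum_box[OF n p iid m] by simp
    moreover have "measure (std_gaussian p) A = (\<Prod>j\<in>{1..p}. 1 - (1 - measure ?N (?I j)))"
      unfolding A measure_std_gaussian_box[OF m] by simp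
    moreover have "\<bar>(\<Prod>j\<in>{1..p}. 1 - (1 - measure ?S (?I j))) - (\<Prod>j\<in>{1..p}. 1 - (1 - measure ?N (?I j)))\<bar> \<le> 8 * sqrt \<epsilon> + card {1..p} * (4 * normal_tail L)"
    proof (rule prod_one_minus_diff_le)
      fix j assume "j \<in> {1..p}"
      then show "\<bar>(1 - measure ?S (?I j)) - (1 - measure ?N (?I j))\<bar> \<le> \<epsilon> * (1 - measure ?N (?I j)) + 4 * normal_tail L"
        using \<epsilon> by (intro tail_close_interval[OF S.real_distribution_axioms R close(1) _ L]) (use close(2) ab in auto)
    qed (use \<epsilon> p1 normal_tail_pos[OF L] in auto)
    ultimately show ?thesis by simp
  qed
  show "0 \<le> gauss_approx_error M n p X (hyper_rectangles p)"
    by (rule gauss_approx_error_bounds(1)[OF ne le])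
  show "gauss_approx_error M n p X (hyper_rectangles p) \<le> 8 * sqrt \<epsilon> + p * (4 * normal_tail L)"
    by (rule gauss_approx_error_bounds(2)[OF ne le])
qed

lemma dimension_normal_tail:
  assumes p: "p \<ge> 1" "ln (real p) \<le> L\<^sup>2 / 2" and L: "L > 0"
  shows "p * normal_tail L \<le> 1 / L"
proof -
  have "real p = exp (ln p)" using p by simp
  also have "\<dots> \<le> exp (L\<^sup>2 / 2)" using p(2) by (simp only: exp_le_cancel_iff)
  finally have "p * normal_tail L \<le> exp (L\<^sup>2 / 2) * (exp (- L\<^sup>2 / 2) / L)"
    using normal_tail_upper[OF L] normal_tail_pos[of L] L by (intro mult_mono) auto
  also have "\<dots> = 1 / L" by (simp flip: exp_add)
  finally show ?thesis .
qed

lemma hyper_rectangle_error_tendsto: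
  fixes p :: "nat \<Rightarrow> nat"
  assumes F: "linnik_cramer F h h' \<alpha> \<Lambda>"
    and iid: "\<And>n. n \<ge> 1 \<Longrightarrow> iid_array (M n) n (p n) (X n) F"
    and p: "\<And>n. n \<ge> 1 \<Longrightarrow> p n \<ge> 1 \<and> ln (real (p n)) \<le> (\<Lambda> n)\<^sup>2 / 2"
  shows "(\<lambda>n. gauss_approx_error (M n) n (p n) (X n) (hyper_rectangles (p n))) \<longlonglongrightarrow> 0"
proof -
  interpret F: linnik_cramer F h h' \<alpha> \<Lambda> by fact
  interpret R: linnik_cramer "reflect F" h h' \<alpha> \<Lambda> by (rule linnik_cramer_reflect[OF F])
  show ?thesis
  proof (rule tendstoI)
    fix e :: real assume e: "e > 0"
    define \<epsilon> where "\<epsilon> = min (1 / 2) ((e / 16)\<^sup>2)"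
    have \<epsilon>: "0 < \<epsilon>" "\<epsilon> \<le> 1 / 2" using e by (auto simp: \<epsilon>_def)
    have "sqrt \<epsilon> \<le> sqrt ((e / 16)\<^sup>2)" by (rule real_sqrt_le_mono) (simp add: \<epsilon>_def)
    then have se: "8 * sqrt \<epsilon> \<le> e / 2" using e by simp
    have "\<forall>\<^sub>F n in sequentially. \<Lambda> n > max 4 (8 / e)"
      using F.\<Lambda>_at_top unfolding filterlim_at_top_dense by blast
    then show "\<forall>\<^sub>F n in sequentially. dist (gauss_approx_error (M n) n (p n) (X n) (hyper_rectangles (p n))) 0 < e"
      using F.sum_law_tail_uniform[OF \<epsilon>(1)] R.sum_law_tail_uniform[OF \<epsilon>(1)] eventually_ge_at_top[of 1]
    proof eventually_elim
      case (elim n)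
      have close: "tail_close (F.sum_law n) (\<Lambda> n) \<epsilon>" "tail_close (R.sum_law n) (\<Lambda> n) \<epsilon>"
        using elim by (simp_all add: tail_close_def)
      have L: "\<Lambda> n > 0" using elim by auto
      have pn: "p n * normal_tail (\<Lambda> n) \<le> 1 / \<Lambda> n"
        using p[OF elim(4)] L by (intro dimension_normal_tail) auto
      have l1: "1 / \<Lambda> n \<le> 1 / 4" using elim L by (simp add: field_simps)
      have l2: "1 / \<Lambda> n < e / 8" using elim L e by (simp add: field_simps)
      have 1: "p n * (4 * normal_tail (\<Lambda> n)) \<le> 1" using pn l1 by simp
      note b = hyper_rectangle_error_le[OF F.standardized_distribution_axioms elim(4) _ iid[OF elim(4)] close _ \<epsilon> 1]
      have "gauss_approx_error (M n) n (p n) (X n) (hyper_rectangles (p n)) \<le> 8 * sqrt \<epsilon> + p n * (4 * normal_tail (\<Lambda> n))"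
        using p[OF elim(4)] L by (intro b) auto
      also have "\<dots> < e" using se pn l2 by simp
      finally have "gauss_approx_error (M n) n (p n) (X n) (hyper_rectangles (p n)) < e" .
      moreover have "0 \<le> gauss_approx_error (M n) n (p n) (X n) (hyper_rectangles (p n))"
        using p[OF elim(4)] L by (intro b) auto
      ultimately show ?case by simp
    qed
  qed
qed

lemma rectangle_approx_if_exp_moment:
  fixes p :: "nat \<Rightarrow> nat"
  assumes F: "linnik_cramer F h h' \<alpha> \<Lambda>"
    and iid: "\<And>n p. n \<ge> 1 \<Longrightarrow> p \<ge> 1 \<Longrightarrow> iid_array (M n p) n p (X n p) F"
    and p: "\<And>n. n \<ge> 1 \<Longrightarrow> p n \<ge> 1 \<and> ln (real (p n)) \<le> (\<Lambda> n)\<^sup>2 / 2"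
  shows "two_sided_gauss_approx M X hyper_rectangles p"
  unfolding two_sided_gauss_approx_def
proof
  show "(\<lambda>n. gauss_approx_error (M n (p n)) n (p n) (X n (p n)) (hyper_rectangles (p n))) \<longlonglongrightarrow> 0"
    by (rule hyper_rectangle_error_tendsto[OF F _ p]) (use iid p in auto)
  show "(\<lambda>n. gauss_approx_error (M n (p n)) n (p n) (\<lambda>i j \<omega>. - X n (p n) i j \<omega>) (hyper_rectangles (p n))) \<longlonglongrightarrow> 0"
    by (rule hyper_rectangle_error_tendsto[OF linnik_cramer_reflect[OF F] _ p])
      (use iid p in \<open>auto intro!: iid_array_reflect\<close>)
qed

section \<open>Necessity\<close>

context standardized_distribution begin

text \<open>
  The second moment of a sum of other coordinates, restricted to a large first coordinate. The product
  over all coordinates evaluates at once what independence and \<open>F\<close> having mean \<open>0\<close> and variance \<open>1\<close> give.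
\<close>

lemma integral_indicator_mult_coordinates:
  fixes n :: nat
  assumes i: "i \<in> {2..n}" and k: "k \<in> {2..n}"
  shows "integrable (PiM {1..n} (\<lambda>_. F)) (\<lambda>\<omega>. indicator {a<..} (\<omega> 1) * (\<omega> i * \<omega> k))"
    and "(\<integral>\<omega>. indicator {a<..} (\<omega> 1) * (\<omega> i * \<omega> k) \<partial>PiM {1..n} (\<lambda>_. F)) = (if i = k then measure F {a<..} else 0)"
proof -
  interpret P: finite_product_prob_space "\<lambda>_. F" "{1..n}" by (rule finite_product_prob)
  define f :: "nat \<Rightarrow> real \<Rightarrow> real" where
    "f l x = (if l = 1 then indicator {a<..} x else 1) * ((if l = i then x else 1) * (if l = k then x else 1))" for l x
  have eq: "(\<Prod>l=1..n. f l (\<omega> l)) = indicator {a<..} (\<omega> 1) * (\<omega> i * \<omega> k)" for \<omega>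
    using i k by (simp add: f_def prod.distrib)
  have ind: "integrable F (indicator {a<..} :: real \<Rightarrow> real)"
    by (intro integrable_real_indicator) (auto simp: emeasure_eq_measure)
  have int: "integrable F (f l)" for l
    using i k ind mean_integrable var_integrable
    by (cases "l = 1"; cases "l = i"; cases "l = k") (auto simp: f_def[abs_def] power2_eq_square)
  show "integrable (PiM {1..n} (\<lambda>_. F)) (\<lambda>\<omega>. indicator {a<..} (\<omega> 1) * (\<omega> i * \<omega> k))"
    unfolding eq[symmetric] by (rule P.product_integrable_prod) (use int in auto)
  have "(\<integral>\<omega>. indicator {a<..} (\<omega> 1) * (\<omega> i * \<omega> k) \<partial>PiM {1..n} (\<lambda>_. F)) = (\<Prod>l=1..n. \<integral>x. f l x \<partial>F)"
    unfolding eq[symmetric] by (rule P.product_integral_prod) (use int in auto)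
  also have "\<dots> = (if i = k then measure F {a<..} else 0)"
  proof (cases "i = k")
    case False
    have "(\<integral>x. f i x \<partial>F) = 0" using i False mean_zero by (simp add: f_def)
    then show ?thesis using False i by (auto intro!: prod_zero)
  next
    case True
    have "(\<integral>x. f l x \<partial>F) = (if l = 1 then measure F {a<..} else 1)" for l
      using True i var_one prob_space by (cases "l = 1"; cases "l = i") (auto simp: f_def power2_eq_square)
    then show ?thesis using True i by simp
  qed
  finally show "(\<integral>\<omega>. indicator {a<..} (\<omega> 1) * (\<omega> i * \<omega> k) \<partial>PiM {1..n} (\<lambda>_. F)) = (if i = k then measure F {a<..} else 0)" .
qed

text \<open>
  If the first summand exceeds \<open>sqrt n * (t + 2)\<close>, then the normalized sum exceeds \<open>t\<close> unless the other summands
  add up to at most \<open>- 2 * sqrt n\<close>, which by Chebyshev's inequality has probability at most \<open>1 / 4\<close>.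
\<close>

lemma single_jump:
  assumes n: "n \<ge> 1"
  shows "3 / 4 * measure F {sqrt n * (t + 2)<..} \<le> measure (sum_law n) {t<..}"
proof -
  interpret P: finite_product_prob_space "\<lambda>_. F" "{1..n}" by (rule finite_product_prob)
  interpret S: prob_space "sum_law n" by (rule prob_space_sum_law)
  let ?P = "PiM {1..n} (\<lambda>_. F)" and ?T = "\<lambda>\<omega>. (\<Sum>i=1..n. \<omega> i) / sqrt n"
  define a where "a = sqrt n * (t + 2)"
  let ?R = "\<lambda>\<omega>. \<Sum>i=2..n. \<omega> i"
  have r: "sqrt n > 0" using n by simp
  have 1: "(\<integral>\<omega>. indicator {a<..} (\<omega> 1) \<partial>?P) = measure F {a<..}"
  proof -
    have "measure F {a<..} = (\<integral>x. indicator {a<..} x \<partial>F)" by simp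
    also have "\<dots> = (\<integral>x. indicator {a<..} x \<partial>distr ?P F (\<lambda>\<omega>. \<omega> 1))"
      using distr_PiM_component[of "{1..n}" "\<lambda>_. F" 1] n prob_space_axioms by simp
    also have "\<dots> = (\<integral>\<omega>. indicator {a<..} (\<omega> 1) \<partial>?P)"
      using n by (subst integral_distr) auto
    finally show ?thesis by simp
  qed
  have sq: "indicator {a<..} (\<omega> 1) * (?R \<omega>)\<^sup>2 = (\<Sum>i=2..n. \<Sum>k=2..n. indicator {a<..} (\<omega> 1) * (\<omega> i * \<omega> k))" for \<omega> :: "nat \<Rightarrow> real"
    unfolding power2_eq_square sum_product by (simp only: sum_distrib_left)
  have i2: "integrable ?P (\<lambda>\<omega>. indicator {a<..} (\<omega> 1) * (?R \<omega>)\<^sup>2)"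
    unfolding sq by (intro Bochner_Integration.integrable_sum integral_indicator_mult_coordinates)
  have "(\<integral>\<omega>. indicator {a<..} (\<omega> 1) * (?R \<omega>)\<^sup>2 \<partial>?P) = (\<Sum>i=2..n. \<Sum>k=2..n. if i = k then measure F {a<..} else 0)"
  proof -
    have "(\<integral>\<omega>. indicator {a<..} (\<omega> 1) * (?R \<omega>)\<^sup>2 \<partial>?P) = (\<Sum>i=2..n. \<integral>\<omega>. (\<Sum>k=2..n. indicator {a<..} (\<omega> 1) * (\<omega> i * \<omega> k)) \<partial>?P)"
      unfolding sq by (intro Bochner_Integration.integral_sum Bochner_Integration.integrable_sum integral_indicator_mult_coordinates)
    also have "\<dots> = (\<Sum>i=2..n. \<Sum>k=2..n. \<integral>\<omega>. indicator {a<..} (\<omega> 1) * (\<omega> i * \<omega> k) \<partial>?P)"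
      by (intro sum.cong refl Bochner_Integration.integral_sum integral_indicator_mult_coordinates)
    also have "\<dots> = (\<Sum>i=2..n. \<Sum>k=2..n. if i = k then measure F {a<..} else 0)"
      by (intro sum.cong refl integral_indicator_mult_coordinates)
    finally show ?thesis .
  qed
  also have "\<dots> = (\<Sum>i=2..n. measure F {a<..})" by (intro sum.cong refl) simp
  also have "\<dots> \<le> n * measure F {a<..}" by (simp add: mult_right_mono)
  finally have 2: "(\<integral>\<omega>. indicator {a<..} (\<omega> 1) * (?R \<omega>)\<^sup>2 \<partial>?P) \<le> n * measure F {a<..}" .
  have 3: "measure (sum_law n) {t<..} = (\<integral>\<omega>. indicator {t<..} (?T \<omega>) \<partial>?P)"
  proof -
    have "measure (sum_law n) {t<..} = (\<integral>s. indicator {t<..} s \<partial>sum_law n)" by simp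
    also have "\<dots> = (\<integral>\<omega>. indicator {t<..} (?T \<omega>) \<partial>?P)"
      unfolding sum_law_def by (subst integral_distr) auto
    finally show ?thesis .
  qed
  have "measure F {a<..} \<le> (\<integral>\<omega>. indicator {t<..} (?T \<omega>) + 1 / (4 * n) * (indicator {a<..} (\<omega> 1) * (?R \<omega>)\<^sup>2) \<partial>?P)"
    unfolding 1[symmetric]
  proof (rule integral_mono)
    show "integrable ?P (\<lambda>\<omega>. indicator {a<..} (\<omega> 1) :: real)"
      using n by (intro P.integrable_const_bound[where B=1]) (auto intro!: AE_I2)
    have it: "integrable ?P (\<lambda>\<omega>. indicator {t<..} (?T \<omega>) :: real)"
      by (intro P.integrable_const_bound[where B=1]) (auto intro!: AE_I2)
    show "integrable ?P (\<lambda>\<omega>. indicator {t<..} (?T \<omega>) + 1 / (4 * n) * (indicator {a<..} (\<omega> 1) * (?R \<omega>)\<^sup>2))"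
      by (intro Bochner_Integration.integrable_add integrable_mult_right it i2)
    fix \<omega> :: "nat \<Rightarrow> real"
    show "indicator {a<..} (\<omega> 1) \<le> indicator {t<..} (?T \<omega>) + 1 / (4 * n) * (indicator {a<..} (\<omega> 1) * (?R \<omega>)\<^sup>2)"
    proof (cases "\<omega> 1 > a \<and> ?T \<omega> \<le> t")
      case True
      have "(\<Sum>i=1..n. \<omega> i) = \<omega> 1 + ?R \<omega>"
        using n sum.atLeast_Suc_atMost[of 1 n \<omega>] by (simp add: numeral_2_eq_2)
      moreover have "(\<Sum>i=1..n. \<omega> i) \<le> sqrt n * t" using True r by (simp add: field_simps)
      ultimately have "?R \<omega> \<le> - (2 * sqrt n)" using True by (simp add: a_def algebra_simps)
      then have "(2 * sqrt n)\<^sup>2 \<le> (- ?R \<omega>)\<^sup>2" by (intro power_mono) auto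
      then have "4 * real n \<le> (?R \<omega>)\<^sup>2" by (simp add: power_mult_distrib)
      then show ?thesis using True n by (simp add: field_simps)
    qed (auto simp: indicator_def)
  qed
  also have "\<dots> = measure (sum_law n) {t<..} + 1 / (4 * n) * (\<integral>\<omega>. indicator {a<..} (\<omega> 1) * (?R \<omega>)\<^sup>2 \<partial>?P)"
    unfolding 3 integral_mult_right_zero[symmetric]
    by (intro Bochner_Integration.integral_add integrable_mult_right i2)
      (intro P.integrable_const_bound[where B=1], auto intro!: AE_I2)
  also have "\<dots> \<le> measure (sum_law n) {t<..} + 1 / (4 * n) * (n * measure F {a<..})"
    using 2 by (intro add_left_mono mult_left_mono) auto
  also have "\<dots> = measure (sum_law n) {t<..} + 1 / 4 * measure F {a<..}" using n by simp
  finally show ?thesis unfolding a_def by linarith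
qed

end

lemma left_square_error_lower:
  assumes F: "standardized_distribution F" and n: "n \<ge> 1" and p: "p \<ge> 1" and iid: "iid_array M n p X F"
  shows "\<bar>measure (standardized_distribution.sum_law F n) {..t} ^ p - measure std_normal_distribution {..t} ^ p\<bar>
    \<le> gauss_approx_error M n p X (left_infinite_squares p)"
proof -
  interpret F: standardized_distribution F by fact
  interpret S: prob_space "F.sum_law n" by (rule F.prob_space_sum_law)
  interpret N: prob_space std_normal_distribution by (rule prob_space_std_normal)
  have eq: "measure M {\<omega> \<in> space M. normalized_sum n p X \<omega> \<in> (\<Pi>\<^sub>E j\<in>{1..p}. {..t})} = measure (F.sum_law n) {..t} ^ p" for t
    using F.prob_normalized_sum_box[OF n p iid, of "\<lambda>_. {..t}"] by simp
  have eqN: "measure (std_gaussian p) (\<Pi>\<^sub>E j\<in>{1..p}. {..t}) = measure std_normal_distribution {..t} ^ p" for t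
    using measure_std_gaussian_box[of p "\<lambda>_. {..t}"] by simp
  have "\<bar>measure M {\<omega> \<in> space M. normalized_sum n p X \<omega> \<in> (\<Pi>\<^sub>E j\<in>{1..p}. {..t})} - measure (std_gaussian p) (\<Pi>\<^sub>E j\<in>{1..p}. {..t})\<bar>
     \<le> gauss_approx_error M n p X (left_infinite_squares p)"
  proof (rule gauss_approx_error_bounds(3)[where B=1])
    show "left_infinite_squares p \<noteq> {}" by (auto simp: left_infinite_squares_def)
    show "(\<Pi>\<^sub>E j\<in>{1..p}. {..t}) \<in> left_infinite_squares p" by (auto simp: left_infinite_squares_def)
    fix A assume "A \<in> left_infinite_squares p"
    then obtain t where A: "A = (\<Pi>\<^sub>E j\<in>{1..p}. {..t})" by (auto simp: left_infinite_squares_def)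
    have "0 \<le> measure (F.sum_law n) {..t} ^ p" "measure (F.sum_law n) {..t} ^ p \<le> 1"
      "0 \<le> measure std_normal_distribution {..t} ^ p" "measure std_normal_distribution {..t} ^ p \<le> 1"
      by (auto intro!: power_le_one)
    then show "\<bar>measure M {\<omega> \<in> space M. normalized_sum n p X \<omega> \<in> A} - measure (std_gaussian p) A\<bar> \<le> 1"
      unfolding A eq eqN by linarith
  qed
  then show ?thesis unfolding eq eqN .
qed

text \<open>
  With \<open>s\<close> the tail of the sum at \<open>t\<close>, the square with corner \<open>t\<close> gives \<open>(1 - s) ^ p \<ge> 1 / 2\<close>, hence
  \<open>exp (p * s) \<le> 2\<close>.
\<close>

lemma sum_tail_le_if_left_square_close:
  assumes F: "standardized_distribution F" and n: "n \<ge> 1" and p: "p \<ge> 1" and iid: "iid_array M n p X F"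
    and t: "p * normal_tail t \<le> 1 / 4" and err: "gauss_approx_error M n p X (left_infinite_squares p) \<le> 1 / 4"
  shows "measure (standardized_distribution.sum_law F n) {t<..} \<le> 1 / p"
proof -
  interpret F: standardized_distribution F by fact
  interpret S: prob_space "F.sum_law n" by (rule F.prob_space_sum_law)
  interpret N: prob_space std_normal_distribution by (rule prob_space_std_normal)
  define s where "s = measure (F.sum_law n) {t<..}"
  have sp: "space (F.sum_law n) = UNIV" using sets_eq_imp_space_eq[OF F.sets_sum_law] by simp
  have s1: "measure (F.sum_law n) {..t} = 1 - s"
  proof -
    have "{..t} = space (F.sum_law n) - {t<..}" by (auto simp: sp)
    then show ?thesis unfolding s_def by (simp add: S.prob_compl)
  qed
  have v1: "measure std_normal_distribution {..t} = 1 - normal_tail t"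
  proof -
    have "{..t} = space std_normal_distribution - {t<..}" by auto
    then show ?thesis unfolding normal_tail_def using N.prob_compl[of "{t<..}"] by simp
  qed
  have v01: "normal_tail t \<le> 1" unfolding normal_tail_def by simp
  have s01: "0 \<le> s" "s \<le> 1" by (auto simp: s_def)
  have "1 - p * normal_tail t \<le> (1 - normal_tail t) ^ p"
    using Bernoulli_inequality[of "- normal_tail t" p] v01 by simp
  then have "3 / 4 \<le> (1 - normal_tail t) ^ p" using t by linarith
  then have "1 / 2 \<le> (1 - s) ^ p"
    using left_square_error_lower[OF F n p iid, of t] err unfolding s1 v1 by linarith
  also have "\<dots> \<le> exp (- s) ^ p" using s01 exp_ge_add_one_self[of "- s"] by (intro power_mono) auto
  also have "\<dots> = exp (- (p * s))" by (simp flip: exp_of_nat_mult)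
  finally have "1 / 2 \<le> exp (- (p * s))" .
  then have "exp (p * s) \<le> 2" by (simp add: exp_minus field_simps)
  then have "p * s \<le> 1" using exp_ge_add_one_self[of "p * s"] by linarith
  then show ?thesis using p unfolding s_def by (simp add: field_simps)
qed

context linnik_growth begin

text \<open>
  Consecutive scales are comparable, as \<open>x\<^sup>2 / h x\<close> equals \<open>n\<close> at \<open>x = xn n\<close> and \<open>h x / x\<close> is decreasing.
\<close>

lemma h_xn_Suc: assumes n: "n \<ge> 1" shows "h (xn (Suc n)) \<le> (1 + 1 / n) * h (xn n)"
proof (cases "xn (Suc n) \<le> xn n")
  case True
  have "h (xn (Suc n)) \<le> h (xn n)" using True xn_pos[of "Suc n"] by (intro h_mono) auto
  also have "\<dots> \<le> (1 + 1 / n) * h (xn n)" using h_pos[OF xn_pos[OF n]] by (simp add: field_simps)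
  finally show ?thesis .
next
  case False
  define a b where "a = xn n" and "b = xn (Suc n)"
  have ab: "0 < a" "0 < b" "a < b" using False xn_pos[OF n] xn_pos[of "Suc n"] by (auto simp: a_def b_def)
  have A: "a\<^sup>2 = n * h a" using xn_sq[OF n] by (simp add: a_def)
  have B: "b\<^sup>2 = (n + 1) * h b" using xn_sq[of "Suc n"] by (simp add: b_def algebra_simps)
  have ha: "h a / a = a / n" using A ab n by (simp add: field_simps power2_eq_square)
  have hb: "h b / b = b / (n + 1)" using B ab n by (simp add: field_simps power2_eq_square)
  have le: "h b / b \<le> h a / a" using ab by (intro h_over_id_mono) auto
  then have "b \<le> (n + 1) * (a / n)" unfolding ha hb using n by (simp add: field_simps)
  have "h b = b * (h b / b)" using ab by simp
  also have "\<dots> \<le> (n + 1) * (a / n) * (h a / a)"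
    using \<open>b \<le> _\<close> le ab h_pos[of b] by (intro mult_mono) auto
  also have "\<dots> = (1 + 1 / n) * h a" using ab n by (simp add: field_simps)
  finally show ?thesis by (simp add: a_def b_def)
qed

text \<open>
  A tail bound at the points \<open>2 * xn n\<close> yields one at every large \<open>y\<close>: for \<open>2 * xn n \<le> y < 2 * xn (Suc n)\<close>,
  \<open>h y\<close> is at most \<open>2 powr \<alpha> * (1 + 1 / n)\<close> times \<open>h (xn n)\<close>, and \<open>2 powr \<alpha> < sqrt 2\<close> leaves room for \<open>\<eta>\<close>.
\<close>

lemma tail_interpolation:
  fixes F :: "real measure" and C :: real
  assumes F: "real_distribution F" and C: "C \<ge> 0"
    and tail: "\<forall>\<^sub>F n in sequentially. measure F (- {- (2 * xn n)..2 * xn n}) \<le> C * exp (- (sqrt 2 * h (xn n)))"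
  obtains \<eta> where "\<eta> > 0" "\<forall>\<^sub>F y in at_top. measure F (- {-y..y}) \<le> C * exp (- ((1 + \<eta>) * h y))"
proof -
  interpret real_distribution F by fact
  define q where "q = sqrt 2 / 2 powr \<alpha>"
  have q: "q > 1"
  proof -
    have "2 powr \<alpha> < 2 powr (1 / 2)" using \<alpha> by (intro powr_less_mono) auto
    then show ?thesis by (simp add: q_def powr_half_sqrt)
  qed
  define \<eta> where "\<eta> = (q - 1) / 2"
  have \<eta>: "\<eta> > 0" using q by (simp add: \<eta>_def)
  have "\<forall>\<^sub>F n in sequentially. real n \<ge> (q + 1) / (q - 1)"
    using filterlim_real_sequentially by (auto simp: filterlim_at_top)
  moreover have "\<forall>\<^sub>F n in sequentially. xn n > 1"
    using xn_at_top by (auto simp: filterlim_at_top_dense)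
  ultimately have "\<forall>\<^sub>F n in sequentially. real n \<ge> (q + 1) / (q - 1) \<and> xn n > 1 \<and> n \<ge> 1 \<and>
      measure F (- {- (2 * xn n)..2 * xn n}) \<le> C * exp (- (sqrt 2 * h (xn n)))"
    using tail eventually_ge_at_top[of 1] by eventually_elim simp
  then obtain n0 where n0: "\<And>n. n \<ge> n0 \<Longrightarrow> real n \<ge> (q + 1) / (q - 1) \<and> xn n > 1 \<and> n \<ge> 1 \<and>
      measure F (- {- (2 * xn n)..2 * xn n}) \<le> C * exp (- (sqrt 2 * h (xn n)))"
    by (auto simp: eventually_sequentially)
  have main: "measure F (- {-y..y}) \<le> C * exp (- ((1 + \<eta>) * h y))" if y: "y \<ge> 2 * xn n0" for y
  proof -
    have "\<forall>\<^sub>F m in sequentially. xn m > y / 2" using xn_at_top unfolding filterlim_at_top_dense by blast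
    then obtain m where m: "m \<ge> n0" "2 * xn m > y"
      using eventually_happens'[OF _ eventually_conj[OF _ eventually_ge_at_top[of n0]]] by (force simp: field_simps)
    define k where "k = (LEAST m. m \<ge> n0 \<and> 2 * xn m > y)"
    have k: "k \<ge> n0" "2 * xn k > y" using LeastI[of "\<lambda>m. m \<ge> n0 \<and> 2 * xn m > y" m] m by (auto simp: k_def)
    have "k \<noteq> n0" using k y by auto
    then obtain n where n: "k = Suc n" "n \<ge> n0" using k by (cases k) auto
    have "\<not> (n \<ge> n0 \<and> 2 * xn n > y)" using not_less_Least[of n "\<lambda>m. m \<ge> n0 \<and> 2 * xn m > y"] n by (simp add: k_def)
    then have ny: "2 * xn n \<le> y" using n by auto
    note nn = n0[OF n(2)]
    have x1: "xn (Suc n) > 1" using n0[of "Suc n"] n by simp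
    have y0: "y > 0" using ny nn by linarith
    have hx0: "h (xn n) > 0" using nn by (intro h_pos) auto
    have "h y \<le> h (2 * xn (Suc n))" using k n y0 by (intro h_mono) auto
    also have "\<dots> \<le> 2 powr \<alpha> * h (xn (Suc n))"
      using h_le_powr[of "xn (Suc n)" "2 * xn (Suc n)"] x1 by simp
    also have "\<dots> \<le> 2 powr \<alpha> * ((1 + 1 / n) * h (xn n))" using nn by (intro mult_left_mono h_xn_Suc) auto
    finally have hy: "h y \<le> 2 powr \<alpha> * ((1 + 1 / n) * h (xn n))" .
    have nq: "(1 + \<eta>) * (1 + 1 / n) \<le> q"
    proof -
      have n1: "real n \<ge> 1" using nn by auto
      have "(q + 1) \<le> n * (q - 1)" using nn q by (simp add: field_simps)
      then have "(q + 1) / n \<le> q - 1" using n1 by (simp add: field_simps)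
      moreover have "(1 + \<eta>) * (1 + 1 / n) = (q + 1) / 2 + ((q + 1) / n) / 2"
        using n1 by (simp add: \<eta>_def field_simps)
      ultimately show ?thesis by argo
    qed
    have "(1 + \<eta>) * h y \<le> (1 + \<eta>) * (2 powr \<alpha> * ((1 + 1 / n) * h (xn n)))"
      using hy \<eta> by (intro mult_left_mono) auto
    also have "\<dots> = ((1 + \<eta>) * (1 + 1 / n)) * (2 powr \<alpha> * h (xn n))" by (simp only: mult_ac)
    also have "\<dots> \<le> q * (2 powr \<alpha> * h (xn n))" using nq hx0 by (intro mult_right_mono) auto
    also have "\<dots> = sqrt 2 * h (xn n)" by (simp add: q_def)
    finally have e: "(1 + \<eta>) * h y \<le> sqrt 2 * h (xn n)" .
    have "measure F (- {-y..y}) \<le> measure F (- {- (2 * xn n)..2 * xn n})"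
      using ny by (intro finite_measure_mono) auto
    also have "\<dots> \<le> C * exp (- (sqrt 2 * h (xn n)))" using nn by simp
    also have "\<dots> \<le> C * exp (- ((1 + \<eta>) * h y))" using e C by (intro mult_left_mono) auto
    finally show ?thesis .
  qed
  have "\<forall>\<^sub>F y in at_top. measure F (- {-y..y}) \<le> C * exp (- ((1 + \<eta>) * h y))"
    using eventually_ge_at_top[of "2 * xn n0"] by eventually_elim (rule main)
  then show ?thesis using that \<eta> by blast
qed

text \<open>
  The line is cut into unit shells. The increments of \<open>h\<close> over a shell are bounded by \<open>h 1\<close>, and
  \<open>\<eta> * h k \<ge> 2 * ln k\<close> makes the sum over the shells converge.
\<close>

lemma exp_moment_of_tail:
  fixes F :: "real measure" and C \<eta> :: real
  assumes F: "real_distribution F" and C: "C \<ge> 0" and \<eta>: "\<eta> > 0"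
    and tail: "\<forall>\<^sub>F y in at_top. measure F (- {-y..y}) \<le> C * exp (- ((1 + \<eta>) * h y))"
  shows "(\<integral>\<^sup>+x. ennreal (exp (h \<bar>x\<bar>)) \<partial>F) < \<infinity>"
proof -
  interpret real_distribution F by fact
  have "\<forall>\<^sub>F y in at_top. measure F (- {-y..y}) \<le> C * exp (- ((1 + \<eta>) * h y)) \<and> 2 / \<eta> * ln y \<le> h y \<and> y \<ge> 1"
    using tail h_ge_ln[of "2 / \<eta>"] eventually_ge_at_top[of 1] by eventually_elim simp
  then obtain y0 where y0: "\<And>y. y \<ge> y0 \<Longrightarrow> measure F (- {-y..y}) \<le> C * exp (- ((1 + \<eta>) * h y)) \<and> 2 / \<eta> * ln y \<le> h y \<and> y \<ge> 1"
    by (auto simp: eventually_at_top_linorder)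
  obtain N :: nat where N: "real N \<ge> y0" using real_arch_simple by blast
  have k: "measure F (- {- real k..real k}) \<le> C * exp (- ((1 + \<eta>) * h k)) \<and> 2 / \<eta> * ln k \<le> h k \<and> k \<ge> 1" if "k \<ge> N" for k :: nat
    using y0[of "real k"] N that by (auto simp: order_trans)
  define B where "B = exp (max (h 0) (h N))"
  define f where "f j x = ennreal (exp (h (real (N + j) + 1))) * indicator (- {- real (N + j)..real (N + j)}) x" for j and x :: real
  have fm: "f j \<in> borel_measurable F" for j
    unfolding f_def[abs_def] by measurable
  have pt: "ennreal (exp (h \<bar>x\<bar>)) \<le> ennreal B + (\<Sum>j. f j x)" for x
  proof (cases "\<bar>x\<bar> \<le> N")
    case True
    have "h \<bar>x\<bar> \<le> max (h 0) (h N)"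
      using True h_mono[of "\<bar>x\<bar>" N] by (cases "x = 0") (auto simp: le_max_iff_disj)
    then have "ennreal (exp (h \<bar>x\<bar>)) \<le> ennreal B" by (simp add: B_def ennreal_leI)
    then show ?thesis by (rule order_trans) simp
  next
    case False
    define m where "m = nat (\<lceil>\<bar>x\<bar>\<rceil> - 1)"
    have ce: "\<lceil>\<bar>x\<bar>\<rceil> > int N" using False by (simp add: less_ceiling_iff)
    have m: "m \<ge> N" "real m < \<bar>x\<bar>" "\<bar>x\<bar> \<le> real m + 1"
      using ce by (auto simp: m_def) linarith+
    define j where "j = m - N"
    have mj: "m = N + j" using m by (simp add: j_def)
    have "exp (h \<bar>x\<bar>) \<le> exp (h (real m + 1))" using m by (simp add: h_mono)
    moreover have "x \<in> - {- real m..real m}" using m by auto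
    ultimately have "ennreal (exp (h \<bar>x\<bar>)) \<le> f j x"
      unfolding f_def mj[symmetric] by (simp add: ennreal_leI)
    also have "f j x \<le> (\<Sum>j. f j x)" using sum_le_suminf[OF summableI, of "{j}" "\<lambda>j. f j x"] by simp
    finally show ?thesis by (rule order_trans) simp
  qed
  define D where "D = C * exp (h 1)"
  have D: "D \<ge> 0" using C by (simp add: D_def)
  have int_f: "(\<integral>\<^sup>+x. f j x \<partial>F) \<le> ennreal (D * (1 / (real (N + j))\<^sup>2))" for j
  proof -
    let ?k = "N + j"
    have kk: "measure F (- {- real ?k..real ?k}) \<le> C * exp (- ((1 + \<eta>) * h ?k))" "2 / \<eta> * ln ?k \<le> h ?k" "?k \<ge> 1"
      using k[OF le_add1, of j] by blast+
    have k1: "real ?k \<ge> 1" using kk(3) by (simp only: real_of_nat_ge_one_iff)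
    have "(\<integral>\<^sup>+x. f j x \<partial>F) = ennreal (exp (h (real ?k + 1))) * emeasure F (- {- real ?k..real ?k})"
      unfolding f_def by (subst nn_integral_cmult_indicator) auto
    also have "\<dots> = ennreal (exp (h (real ?k + 1)) * measure F (- {- real ?k..real ?k}))"
      by (simp add: emeasure_eq_measure ennreal_mult')
    also have "\<dots> \<le> ennreal (D * (1 / (real ?k)\<^sup>2))"
    proof (rule ennreal_leI)
      have "h (real ?k + 1) / (real ?k + 1) \<le> h (real ?k) / real ?k" using k1 by (intro h_over_id_mono) auto
      then have "h (real ?k + 1) \<le> (real ?k + 1) * (h (real ?k) / real ?k)" using k1 by (simp add: pos_divide_le_eq mult.commute)
      also have "\<dots> = h (real ?k) + h (real ?k) / real ?k" using k1 by (simp add: field_simps)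
      also have "h (real ?k) / real ?k \<le> h 1 / 1" using k1 by (intro h_over_id_mono) auto
      finally have h1: "h (real ?k + 1) \<le> h (real ?k) + h 1" by simp
      have "exp (h (real ?k + 1)) * measure F (- {- real ?k..real ?k}) \<le> exp (h (real ?k) + h 1) * (C * exp (- ((1 + \<eta>) * h ?k)))"
        using h1 kk(1) by (intro mult_mono) auto
      also have "\<dots> = D * exp (- (\<eta> * h ?k))"
      proof -
        have "exp (h (real ?k) + h 1) * exp (- ((1 + \<eta>) * h ?k)) = exp (h 1) * exp (- (\<eta> * h ?k))"
          unfolding exp_add[symmetric] by (simp add: algebra_simps)
        then show ?thesis by (simp only: D_def mult_ac)
      qed
      also have "\<dots> \<le> D * exp (- (2 * ln ?k))"
        using kk(2) \<eta> D by (intro mult_left_mono) (auto simp: field_simps simp del: of_nat_add)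
      also have "exp (- (2 * ln ?k)) = 1 / (real ?k)\<^sup>2"
      proof -
        have inv_sq: "exp (- (2 * ln u)) = 1 / u\<^sup>2" if "u \<ge> 1" for u :: real
          using that by (simp add: exp_minus exp_double inverse_eq_divide)
        show ?thesis by (rule inv_sq[OF k1])
      qed
      finally show "exp (h (real ?k + 1)) * measure F (- {- real ?k..real ?k}) \<le> D * (1 / (real ?k)\<^sup>2)" .
    qed
    finally show ?thesis .
  qed
  have summ: "summable (\<lambda>j. D * (1 / (real (N + j))\<^sup>2))"
  proof (rule summable_mult)
    have "summable (\<lambda>j. inverse (real j ^ 2))" by (rule inverse_power_summable) simp
    then have "summable (\<lambda>j. inverse (real (j + N) ^ 2))" by (rule summable_ignore_initial_segment)
    then show "summable (\<lambda>j. 1 / (real (N + j))\<^sup>2)" by (simp only: inverse_eq_divide add.commute)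
  qed
  have "(\<integral>\<^sup>+x. ennreal (exp (h \<bar>x\<bar>)) \<partial>F) \<le> (\<integral>\<^sup>+x. ennreal B + (\<Sum>j. f j x) \<partial>F)"
    by (rule nn_integral_mono) (rule pt)
  also have "\<dots> = (\<integral>\<^sup>+x. ennreal B \<partial>F) + (\<integral>\<^sup>+x. (\<Sum>j. f j x) \<partial>F)"
    using fm by (intro nn_integral_add) auto
  also have "\<dots> = ennreal B + (\<Sum>j. (\<integral>\<^sup>+x. f j x \<partial>F))"
  proof -
    have "(\<integral>\<^sup>+x. (\<Sum>j. f j x) \<partial>F) = (\<Sum>j. (\<integral>\<^sup>+x. f j x \<partial>F))" by (rule nn_integral_suminf[OF fm])
    moreover have "(\<integral>\<^sup>+x. ennreal B \<partial>F) = ennreal B"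
      by (simp only: nn_integral_const emeasure_space_1 mult_1_right)
    ultimately show ?thesis by (simp only:)
  qed
  also have "\<dots> \<le> ennreal B + (\<Sum>j. ennreal (D * (1 / (real (N + j))\<^sup>2)))"
    by (rule add_left_mono, rule suminf_le[OF int_f summableI summableI])
  also have "\<dots> < \<infinity>"
  proof -
    have "(\<Sum>j. ennreal (D * (1 / (real (N + j))\<^sup>2))) \<noteq> top"
      by (rule ennreal_suminf_neq_top[OF summ]) (use D in \<open>intro mult_nonneg_nonneg, simp_all\<close>)
    then show ?thesis by (metis ennreal_add_eq_top ennreal_neq_top infinity_ennreal_def top.not_eq_extremum)
  qed
  finally show ?thesis .
qed

text \<open>
  The largest dimension that the necessity hypothesis admits.
\<close>

definition threshold_dim :: "nat \<Rightarrow> nat" where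
  "threshold_dim n = nat \<lfloor>exp (sqrt 2 * (\<Lambda> n)\<^sup>2)\<rfloor>"

lemma threshold_dim:
  shows "threshold_dim n \<ge> 1" "real (threshold_dim n) \<le> exp (sqrt 2 * (\<Lambda> n)\<^sup>2)"
    "ln (real (threshold_dim n)) \<le> sqrt 2 * (\<Lambda> n)\<^sup>2" "1 / real (threshold_dim n) \<le> 2 * exp (- (sqrt 2 * (\<Lambda> n)\<^sup>2))"
proof -
  let ?e = "exp (sqrt 2 * (\<Lambda> n)\<^sup>2)"
  have e1: "?e \<ge> 1" by simp
  then have f1: "\<lfloor>?e\<rfloor> \<ge> 1" by (simp add: le_floor_iff)
  then show p1: "threshold_dim n \<ge> 1" unfolding threshold_dim_def by linarith
  have eq: "real (threshold_dim n) = of_int \<lfloor>?e\<rfloor>" using f1 by (simp add: threshold_dim_def)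
  then show le: "real (threshold_dim n) \<le> ?e" by simp
  then have "ln (real (threshold_dim n)) \<le> ln ?e" using p1 by (subst ln_le_cancel_iff) auto
  then show "ln (real (threshold_dim n)) \<le> sqrt 2 * (\<Lambda> n)\<^sup>2" by simp
  have "?e < real (threshold_dim n) + 1" unfolding eq by linarith
  then have "?e \<le> 2 * real (threshold_dim n)" using p1 by linarith
  then have "?e / real (threshold_dim n) \<le> 2" using p1 by (simp add: field_simps)
  then show "1 / real (threshold_dim n) \<le> 2 * exp (- (sqrt 2 * (\<Lambda> n)\<^sup>2))"
    using p1 by (simp add: exp_minus field_simps)
qed

lemma right_tail_of_square_approx:
  assumes F: "standardized_distribution F"
    and iid: "\<And>n. n \<ge> 1 \<Longrightarrow> iid_array (M n) n (threshold_dim n) (X n) F"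
    and approx: "(\<lambda>n. gauss_approx_error (M n) n (threshold_dim n) (X n) (left_infinite_squares (threshold_dim n))) \<longlonglongrightarrow> 0"
  shows "\<forall>\<^sub>F n in sequentially. measure F {2 * xn n<..} \<le> 3 * exp (- (sqrt 2 * h (xn n)))"
proof -
  interpret F: standardized_distribution F by fact
  \<comment> \<open>The threshold \<open>t = c * \<Lambda> n\<close> satisfies \<open>t\<^sup>2 / 2 = sqrt 2 * (\<Lambda> n)\<^sup>2\<close>; as \<open>c < 2\<close>, eventually \<open>t + 2 \<le> 2 * \<Lambda> n\<close>.\<close>
  define c where "c = sqrt (2 * sqrt 2)"
  have c2: "c\<^sup>2 = 2 * sqrt 2" by (simp add: c_def)
  have "sqrt 2 < sqrt 4" by (rule real_sqrt_less_mono) simp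
  then have s2: "sqrt 2 < 2" using real_sqrt_unique[of 2 4] by simp
  have "c < sqrt 4" unfolding c_def by (rule real_sqrt_less_mono) (use s2 in simp)
  then have c: "c < 2" using real_sqrt_unique[of 2 4] by simp
  have "1 \<le> sqrt 2" by simp
  then have c1: "1 \<le> c" unfolding c_def by (intro real_le_rsqrt, unfold power_one) linarith
  have "\<forall>\<^sub>F n in sequentially. \<Lambda> n > max 4 (2 / (2 - c))"
    using \<Lambda>_at_top unfolding filterlim_at_top_dense by blast
  moreover have "\<forall>\<^sub>F n in sequentially. gauss_approx_error (M n) n (threshold_dim n) (X n) (left_infinite_squares (threshold_dim n)) < 1 / 4"
    using order_tendstoD(2)[OF approx, of "1 / 4"] by simp
  ultimately show ?thesis using eventually_ge_at_top[of 1]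
  proof eventually_elim
    case (elim n)
    let ?p = "threshold_dim n"
    have L: "\<Lambda> n > 4" "\<Lambda> n > 2 / (2 - c)" using elim by auto
    define t where "t = c * \<Lambda> n"
    have t4: "t > 4" using L mult_right_mono[OF c1, of "\<Lambda> n"] unfolding t_def by linarith
    have t2: "t\<^sup>2 / 2 = sqrt 2 * (\<Lambda> n)\<^sup>2" by (simp add: t_def power_mult_distrib c2)
    have "?p * normal_tail t \<le> exp (t\<^sup>2 / 2) * (exp (- t\<^sup>2 / 2) / t)"
      using threshold_dim(2)[of n] normal_tail_upper[of t] normal_tail_pos[of t] t4 unfolding t2
      by (intro mult_mono) auto
    also have "\<dots> = 1 / t" by (simp flip: exp_add)
    also have "\<dots> \<le> 1 / 4" using t4 by (simp add: field_simps)
    finally have pt: "?p * normal_tail t \<le> 1 / 4" .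
    have "t + 2 \<le> 2 * \<Lambda> n"
    proof -
      have "2 \<le> (2 - c) * \<Lambda> n" using L(2) c by (simp add: field_simps)
      then show ?thesis by (simp add: t_def algebra_simps)
    qed
    then have "sqrt n * (t + 2) \<le> sqrt n * (2 * \<Lambda> n)" by (intro mult_left_mono) auto
    then have le: "sqrt n * (t + 2) \<le> 2 * xn n" by (simp add: xn_def)
    have "3 / 4 * measure F {2 * xn n<..} \<le> 3 / 4 * measure F {sqrt n * (t + 2)<..}"
      using le by (intro mult_left_mono F.finite_measure_mono) auto
    also have "\<dots> \<le> measure (F.sum_law n) {t<..}" by (rule F.single_jump[OF elim(3)])
    also have "\<dots> \<le> 1 / ?p"
      using elim by (intro sum_tail_le_if_left_square_close[OF F elim(3) threshold_dim(1) iid[OF elim(3)] pt]) auto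
    also have "\<dots> \<le> 2 * exp (- (sqrt 2 * (\<Lambda> n)\<^sup>2))" by (rule threshold_dim(4))
    also have "(\<Lambda> n)\<^sup>2 = h (xn n)" using h_xn elim by simp
    finally have "3 / 4 * measure F {2 * xn n<..} \<le> 2 * exp (- (sqrt 2 * h (xn n)))" .
    moreover have "0 \<le> exp (- (sqrt 2 * h (xn n)))" by simp
    ultimately show ?case by linarith
  qed
qed

lemma exp_moment_if_square_approx:
  assumes F: "standardized_distribution F"
    and iid: "\<And>n p. n \<ge> 1 \<Longrightarrow> p \<ge> 1 \<Longrightarrow> iid_array (M n p) n p (X n p) F"
    and approx: "two_sided_gauss_approx M X left_infinite_squares threshold_dim"
  shows "(\<integral>\<^sup>+x. ennreal (exp (h \<bar>x\<bar>)) \<partial>F) < \<infinity>"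
proof -
  interpret F: standardized_distribution F by fact
  have iid': "iid_array (M n (threshold_dim n)) n (threshold_dim n) (X n (threshold_dim n)) F" if "n \<ge> 1" for n
    using iid[OF that threshold_dim(1)] .
  have r: "\<forall>\<^sub>F n in sequentially. measure F {2 * xn n<..} \<le> 3 * exp (- (sqrt 2 * h (xn n)))"
    by (rule right_tail_of_square_approx[OF F iid']) (use approx in \<open>simp_all add: two_sided_gauss_approx_def\<close>)
  have l: "\<forall>\<^sub>F n in sequentially. measure (reflect F) {2 * xn n<..} \<le> 3 * exp (- (sqrt 2 * h (xn n)))"
    by (rule right_tail_of_square_approx[OF standardized_reflect[OF F] iid_array_reflect[OF iid']])
      (use approx in \<open>simp_all add: two_sided_gauss_approx_def\<close>)
  have tl: "\<forall>\<^sub>F n in sequentially. measure F (- {- (2 * xn n)..2 * xn n}) \<le> 6 * exp (- (sqrt 2 * h (xn n)))"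
    using r l
  proof eventually_elim
    case (elim n)
    have "uminus ` {2 * xn n<..} = {..< - (2 * xn n)}" by simp
    then have "measure (reflect F) {2 * xn n<..} = measure F {..< - (2 * xn n)}"
      using measure_reflect[OF F.real_distribution_axioms, of "{2 * xn n<..}"] by simp
    moreover have "measure F (- {- (2 * xn n)..2 * xn n}) \<le> measure F ({2 * xn n<..} \<union> {..< - (2 * xn n)})"
      by (intro F.finite_measure_mono) auto
    moreover have "\<dots> \<le> measure F {2 * xn n<..} + measure F {..< - (2 * xn n)}"
      by (rule measure_Un_le) auto
    ultimately show ?case using elim by linarith
  qed
  obtain \<eta> where "\<eta> > 0" "\<forall>\<^sub>F y in at_top. measure F (- {-y..y}) \<le> 6 * exp (- ((1 + \<eta>) * h y))"
    by (rule tail_interpolation[OF F.real_distribution_axioms _ tl]) auto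
  then show ?thesis by (intro exp_moment_of_tail[OF F.real_distribution_axioms]) auto
qed

end

theorem theorem1:
  fixes F :: "real measure"
    and M :: "nat \<Rightarrow> nat \<Rightarrow> 'a measure"
    and X :: "nat \<Rightarrow> nat \<Rightarrow> nat \<Rightarrow> nat \<Rightarrow> 'a \<Rightarrow> real"
    and h h' \<rho> :: "real \<Rightarrow> real"
    and \<alpha> :: real
    and \<Lambda> :: "nat \<Rightarrow> real"
  assumes F_distribution: "real_distribution F"
    and F_mean: "integrable F (\<lambda>x. x)" "(\<integral>x. x \<partial>F) = 0"
    and F_variance: "integrable F (\<lambda>x. x\<^sup>2)" "(\<integral>x. (x - (\<integral>y. y \<partial>F))\<^sup>2 \<partial>F) = 1"
    and X_iid: "\<And>n p. n \<ge> 1 \<Longrightarrow> p \<ge> 1 \<Longrightarrow> iid_array (M n p) n p (X n p) F"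
    and h_nonneg: "\<And>x. x \<ge> 0 \<Longrightarrow> h x \<ge> 0"
    and h_deriv: "\<And>x. x > 0 \<Longrightarrow> (h has_real_derivative h' x) (at x)"
    and h'_cont: "continuous_on {0<..} h'"
    and h'_decreasing: "antimono_on {0<..} h'"
    and \<alpha>: "\<alpha> < 1 / 2"
    and \<rho>_pos: "\<And>x. x > 1 \<Longrightarrow> \<rho> x > 0"
    and \<rho>_mono: "mono_on {1<..} \<rho>"
    and \<rho>_infinity: "filterlim \<rho> at_top at_top"
    and h'_bounds: "\<And>x. x > 1 \<Longrightarrow> 0 < h' x \<and> h' x < \<alpha> * h x / x"
    and h_growth: "\<And>x. x > 1 \<Longrightarrow> h x > \<rho> x * ln x"
    and \<Lambda>: "\<And>n. n \<ge> 1 \<Longrightarrow> \<Lambda> n > 0 \<and> h (sqrt (real n) * \<Lambda> n) = (\<Lambda> n)\<^sup>2"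
  shows
    "((\<integral>\<^sup>+x. ennreal (exp (h \<bar>x\<bar>)) \<partial>F) < \<infinity> \<longrightarrow>
        (\<forall>p :: nat \<Rightarrow> nat. (\<forall>n\<ge>1. p n \<ge> 1 \<and> ln (real (p n)) \<le> (\<Lambda> n)\<^sup>2 / 2) \<longrightarrow>
           two_sided_gauss_approx M X hyper_rectangles p)) \<and>
     ((\<forall>p :: nat \<Rightarrow> nat. (\<forall>n\<ge>1. p n \<ge> 1 \<and> ln (real (p n)) \<le> sqrt 2 * (\<Lambda> n)\<^sup>2) \<longrightarrow>
           two_sided_gauss_approx M X left_infinite_squares p) \<longrightarrow>
        (\<integral>\<^sup>+x. ennreal (exp (h \<bar>x\<bar>)) \<partial>F) < \<infinity>)"
proof -
  have "filterlim (\<lambda>x. h x / ln x) at_top at_top"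
  proof (rule filterlim_at_top_mono[OF \<rho>_infinity])
    show "\<forall>\<^sub>F x in at_top. \<rho> x \<le> h x / ln x"
      using eventually_gt_at_top[of 1]
    proof eventually_elim
      case (elim x)
      then show ?case using h_growth[of x] by (simp add: field_simps)
    qed
  qed
  then interpret linnik_growth h h' \<alpha> \<Lambda>
    using h_nonneg h_deriv h'_decreasing \<alpha> h'_bounds \<Lambda> by unfold_locales auto
  have F: "standardized_distribution F"
    using F_distribution F_mean F_variance
    by (simp add: standardized_distribution_def standardized_distribution_axioms_def)
  show ?thesis
  proof (intro conjI impI allI)
    fix p :: "nat \<Rightarrow> nat"
    assume "(\<integral>\<^sup>+x. ennreal (exp (h \<bar>x\<bar>)) \<partial>F) < \<infinity>"
      and p: "\<forall>n\<ge>1. p n \<ge> 1 \<and> ln (real (p n)) \<le> (\<Lambda> n)\<^sup>2 / 2"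
    then have "linnik_cramer F h h' \<alpha> \<Lambda>"
      by (intro linnik_cramer.intro F linnik_growth_axioms linnik_cramer_axioms.intro)
    then show "two_sided_gauss_approx M X hyper_rectangles p"
      by (rule rectangle_approx_if_exp_moment[OF _ X_iid]) (use p in auto)
  next
    assume "\<forall>p. (\<forall>n\<ge>1. p n \<ge> 1 \<and> ln (real (p n)) \<le> sqrt 2 * (\<Lambda> n)\<^sup>2) \<longrightarrow>
        two_sided_gauss_approx M X left_infinite_squares p"
    then have approx: "two_sided_gauss_approx M X left_infinite_squares threshold_dim"
      using threshold_dim by blast
    show "(\<integral>\<^sup>+x. ennreal (exp (h \<bar>x\<bar>)) \<partial>F) < \<infinity>"
      by (rule exp_moment_if_square_approx[OF F _ approx]) (rule X_iid)
  qed
qed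

end
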